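(* Let $\Phi=B_n$ or $D_n$, let $W$ be its Weyl group, let $D=\{\beta_1,\dots,\beta_t\}\subset\Phi^+$ be an orthogonal rook placement, let $\sigma=r_{\beta_1}\cdots r_{\beta_t}\in W$ be the involution with support $\mathrm{Supp}(\sigma)=D$, and let $\Omega=\Omega_{D,\xi}\subset\mathfrak{u}^*$ be the associated coadjoint orbit for some tuple $\xi=(\xi_\beta)_{\beta\in D}$ of non-zero elements of $\mathbb{F}_q$. Then $$\dim\Omega=l(\sigma)-s(\sigma)-2d(\sigma).$$ In particular, $\dim\Omega$ does not depend on $\xi$.
   Context: Root systems. Let $\epsilon_1,\dots,\epsilon_n$ be the standard basis of $\mathbb{R}^n$. $B_n=\{\pm\epsilon_i\pm\epsilon_j,\ i<j\}\cup\{\pm\epsilon_i\}$, $D_n=\{\pm\epsilon_i\pm\epsilon_j,\ i<j\}$; the positive roots are $B_n^+=\{\epsilon_i\pm\epsilon_j,\ 1\le i<j\le n\}\cup\{\epsilon_i,\ 1\le i\le n\}$ and $D_n^+=\{\epsilon_i\pm\epsilon_j,\ 1\le i<j\le n\}$; the simple roots are $\epsilon_i-\epsilon_{i+1}$ ($1\le i\le n-1$) together with $\epsilon_n$ for $B_n$, respectively $\epsilon_{n-1}+\epsilon_n$ for $D_n$. For positive roots put $\mathrm{col}(\epsilon_i\pm\epsilon_j)=\mathrm{col}(\epsilon_i)=i$, $\mathrm{row}(\epsilon_i\pm\epsilon_j)=\mp j$ (for $i<j$), $\mathrm{row}(\epsilon_i)=0$. Let $R_i=\{\alpha\in\Phi^+\mid\mathrm{row}(\alpha)=i\}$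 for $-n+1\le i\le n-1$ and $C_j=\{\alpha\in\Phi^+\mid\mathrm{col}(\alpha)=j\}$ for $1\le j\le n$. Lie algebra and group. Let $m=2n+1$ for $\Phi=B_n$ and $m=2n$ for $\Phi=D_n$; $\mathbb{F}_q$ is a finite field of characteristic $p\ge m$. Rows and columns of $m\times m$ matrices are indexed by $1,2,\dots,n,0,-n,\dots,-2,-1$ in this order (no index $0$ for $D_n$), and $e_{a,b}$ are the elementary matrices. Put $e_{\epsilon_i}=e_{0,i}-e_{-i,0}$, $e_{\epsilon_i-\epsilon_j}=e_{j,i}-e_{-i,-j}$, $e_{\epsilon_i+\epsilon_j}=e_{-j,i}-e_{-i,j}$ ($i<j$). Then $\mathfrak{u}=\mathfrak{u}(\Phi)\subset\mathfrak{gl}_m(\mathbb{F}_q)$ is the Lie subalgebra with basis $e_\alpha$, $\alpha\in\Phi^+$; $e_\alpha^*$ denotes the dual basis of $\mathfrak{u}^*$. $U=\exp(\mathfrak{u})$ where $\exp(x)=\sum_{i=0}^{m-1}x^i/i!$. The group $U$ acts on $\mathfrak{u}$ by conjugation and on $\mathfrak{u}^*$ by the dual (coadjoint) action $(g.\lambda)(x)=\lambda(g^{-1}xg)$. For a coadjoint orbit $\Omega$, $\dim\Omega$ is the number with $q^{\dim\Omega}=|\Omega|$. Orthogonal rook placement: a subset $D\subset\Phi^+$ of pairwise orthogonal roots with $|D\cap R_i|\le1$ and $|D\cap C_j|\le1$ for all $i,j$. The associated orbit $\Omega_{D,\xi}$ is the coadjoint orbit of $f_{D,\xi}=\sum_{\beta\in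 D}\xi_\beta e_\beta^*$. Weyl group notation. $r_\beta$ is the reflection in the hyperplane orthogonal to $\beta$. For the involution $\tau=\prod_{\beta\in D}r_\beta$ attached to an orthogonal rook placement $D$, $\mathrm{Supp}(\tau)=D$; $l(\tau)$ is the length of a shortest decomposition of $\tau$ into simple reflections; $s(\tau)$ is the length of a shortest decomposition of $\tau$ into arbitrary reflections, which equals $|\mathrm{Supp}(\tau)|$; and $$d(\tau)=\#\{\beta\in\mathrm{Supp}(\tau)\mid\mathrm{col}(\beta)>i,\ \mathrm{row}(\beta)<0\}$$ if $\Phi=B_n$ and $\epsilon_i\in\mathrm{Supp}(\tau)$ for some $i$ (there is at most one such $i$), and $d(\tau)=0$ otherwise. *)

theory Defs
  imports Complex_Main "HOL-Library.FuncSet" "HOL-Library.Cardinality" "Jordan_Normal_Form.Matrix"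
begin

section \<open>Root systems of types B and D\<close>

datatype root_type = TypeB | TypeD

text \<open>Labels for the positive roots: \<open>Short i\<close> stands for \<open>\<epsilon>\<^sub>i\<close>, \<open>Minus i j\<close> for \<open>\<epsilon>\<^sub>i - \<epsilon>\<^sub>j\<close> and
  \<open>Plus i j\<close> for \<open>\<epsilon>\<^sub>i + \<epsilon>\<^sub>j\<close> (with \<open>i < j\<close>); \<open>root_vec\<close> is the root itself, as a vector of \<open>\<real>\<^sup>n\<close>.
  Indices are 1-based, whereas \<open>unit_vec\<close> is 0-based.\<close>

datatype pos_root = Short nat | Minus nat nat | Plus nat nat

definition eps :: "nat \<Rightarrow> nat \<Rightarrow> real vec" where
  "eps n i = unit_vec n (i - 1)"

fun root_vec :: "nat \<Rightarrow> pos_root \<Rightarrow> real vec" where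
  "root_vec n (Short i) = eps n i"
| "root_vec n (Minus i j) = eps n i - eps n j"
| "root_vec n (Plus i j) = eps n i + eps n j"

definition pos_roots :: "root_type \<Rightarrow> nat \<Rightarrow> pos_root set" where
  "pos_roots ty n =
     {Minus i j | i j. 1 \<le> i \<and> i < j \<and> j \<le> n} \<union>
     {Plus i j | i j. 1 \<le> i \<and> i < j \<and> j \<le> n} \<union>
     (case ty of TypeB \<Rightarrow> {Short i | i. 1 \<le> i \<and> i \<le> n} | TypeD \<Rightarrow> {})"

definition roots :: "root_type \<Rightarrow> nat \<Rightarrow> real vec set" where
  "roots ty n = root_vec n ` pos_roots ty n \<union> (\<lambda>\<alpha>. - root_vec n \<alpha>) ` pos_roots ty n"

definition simple_roots :: "root_type \<Rightarrow> nat \<Rightarrow> pos_root set" where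
  "simple_roots ty n =
     {Minus i (i + 1) | i. 1 \<le> i \<and> i \<le> n - 1} \<union>
     (case ty of TypeB \<Rightarrow> {Short n} | TypeD \<Rightarrow> {Plus (n - 1) n})"

fun root_col :: "pos_root \<Rightarrow> nat" where
  "root_col (Short i) = i"
| "root_col (Minus i j) = i"
| "root_col (Plus i j) = i"

fun root_row :: "pos_root \<Rightarrow> int" where
  "root_row (Short i) = 0"
| "root_row (Minus i j) = int j"
| "root_row (Plus i j) = - int j"

definition row_set :: "root_type \<Rightarrow> nat \<Rightarrow> int \<Rightarrow> pos_root set" where
  "row_set ty n i = {\<alpha> \<in> pos_roots ty n. root_row \<alpha> = i}"

definition col_set :: "root_type \<Rightarrow> nat \<Rightarrow> nat \<Rightarrow> pos_root set" where
  "col_set ty n j = {\<alpha> \<in> pos_roots ty n. root_col \<alpha> = j}"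

text \<open>The rows \<open>n\<close> and \<open>-n\<close> need no condition: two distinct roots in the same non-zero row
  have inner product 1, so they are never orthogonal.\<close>

definition orthogonal_rook_placement :: "root_type \<Rightarrow> nat \<Rightarrow> pos_root set \<Rightarrow> bool" where
  "orthogonal_rook_placement ty n D \<longleftrightarrow>
     D \<subseteq> pos_roots ty n \<and>
     (\<forall>\<alpha>\<in>D. \<forall>\<beta>\<in>D. \<alpha> \<noteq> \<beta> \<longrightarrow> root_vec n \<alpha> \<bullet> root_vec n \<beta> = 0) \<and>
     (\<forall>i\<in>{- int n + 1..int n - 1}. card (D \<inter> row_set ty n i) \<le> 1) \<and>
     (\<forall>j\<in>{1..n}. card (D \<inter> col_set ty n j) \<le> 1)"


section \<open>The Weyl group\<close>

text \<open>Elements of the Weyl group are extensional functions on \<open>carrier_vec n\<close>, that is, on \<open>\<real>\<^sup>n\<close>.\<close>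

definition reflection :: "nat \<Rightarrow> real vec \<Rightarrow> real vec \<Rightarrow> real vec" where
  "reflection n \<beta> = (\<lambda>v\<in>carrier_vec n. v - (2 * (v \<bullet> \<beta>) / (\<beta> \<bullet> \<beta>)) \<cdot>\<^sub>v \<beta>)"

definition word_prod :: "nat \<Rightarrow> (real vec \<Rightarrow> real vec) list \<Rightarrow> real vec \<Rightarrow> real vec" where
  "word_prod n ws = foldr (compose (carrier_vec n)) ws (\<lambda>v\<in>carrier_vec n. v)"

definition word_length :: "nat \<Rightarrow> (real vec \<Rightarrow> real vec) set \<Rightarrow> (real vec \<Rightarrow> real vec) \<Rightarrow> nat" where
  "word_length n S \<tau> = (LEAST k. \<exists>ws. length ws = k \<and> set ws \<subseteq> S \<and> word_prod n ws = \<tau>)"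

definition l_stat :: "root_type \<Rightarrow> nat \<Rightarrow> (real vec \<Rightarrow> real vec) \<Rightarrow> nat" where
  "l_stat ty n = word_length n ((\<lambda>\<alpha>. reflection n (root_vec n \<alpha>)) ` simple_roots ty n)"

definition s_stat :: "root_type \<Rightarrow> nat \<Rightarrow> (real vec \<Rightarrow> real vec) \<Rightarrow> nat" where
  "s_stat ty n = word_length n (reflection n ` roots ty n)"

text \<open>The statistic \<open>d(\<tau>)\<close>, as a function of \<open>S = Supp(\<tau>)\<close>.\<close>

definition d_stat :: "root_type \<Rightarrow> pos_root set \<Rightarrow> nat" where
  "d_stat ty S =
     (if ty = TypeB \<and> (\<exists>i. Short i \<in> S)
      then card {\<beta> \<in> S. root_col \<beta> > (THE i. Short i \<in> S) \<and> root_row \<beta> < 0}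
      else 0)"


section \<open>The Lie algebra, the group and coadjoint orbits\<close>

definition mdim :: "root_type \<Rightarrow> nat \<Rightarrow> nat" where
  "mdim ty n = (case ty of TypeB \<Rightarrow> 2 * n + 1 | TypeD \<Rightarrow> 2 * n)"

text \<open>The 0-based position of the index \<open>a\<close> in the sequence \<open>1, \<dots>, n, 0, -n, \<dots>, -1\<close>
  (without \<open>0\<close> for type D).\<close>

definition idx_pos :: "root_type \<Rightarrow> nat \<Rightarrow> int \<Rightarrow> nat" where
  "idx_pos ty n a = (if a > 0 then nat (a - 1) else if a = 0 then n else nat (int (mdim ty n) + a))"

definition elem_mat :: "root_type \<Rightarrow> nat \<Rightarrow> int \<Rightarrow> int \<Rightarrow> 'q::field mat" where
  "elem_mat ty n a b = mat (mdim ty n) (mdim ty n)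
     (\<lambda>(r, c). if r = idx_pos ty n a \<and> c = idx_pos ty n b then 1 else 0)"

fun root_mat :: "root_type \<Rightarrow> nat \<Rightarrow> pos_root \<Rightarrow> 'q::field mat" where
  "root_mat ty n (Short i) = elem_mat ty n 0 (int i) - elem_mat ty n (- int i) 0"
| "root_mat ty n (Minus i j) =
     elem_mat ty n (int j) (int i) - elem_mat ty n (- int i) (- int j)"
| "root_mat ty n (Plus i j) =
     elem_mat ty n (- int j) (int i) - elem_mat ty n (- int i) (int j)"

definition lie_u :: "root_type \<Rightarrow> nat \<Rightarrow> 'q::field mat set" where
  "lie_u ty n = {mat (mdim ty n) (mdim ty n)
     (\<lambda>(r, c). \<Sum>\<alpha>\<in>pos_roots ty n. a \<alpha> * root_mat ty n \<alpha> $$ (r, c)) | a. True}"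

text \<open>Linear forms on \<open>\<uu>\<close> are represented by functions that are \<open>undefined\<close> outside \<open>\<uu>\<close>, so that
  equality of forms is equality of functions.\<close>

definition lie_u_dual :: "root_type \<Rightarrow> nat \<Rightarrow> ('q::field mat \<Rightarrow> 'q) set" where
  "lie_u_dual ty n = {f \<in> extensional (lie_u ty n).
     (\<forall>x\<in>lie_u ty n. \<forall>y\<in>lie_u ty n. f (x + y) = f x + f y) \<and>
     (\<forall>c. \<forall>x\<in>lie_u ty n. f (c \<cdot>\<^sub>m x) = c * f x)}"

definition dual_basis :: "root_type \<Rightarrow> nat \<Rightarrow> pos_root \<Rightarrow> 'q::field mat \<Rightarrow> 'q" where
  "dual_basis ty n \<beta> = (THE f. f \<in> lie_u_dual ty n \<and>
     (\<forall>\<alpha>\<in>pos_roots ty n. f (root_mat ty n \<alpha>) = (if \<alpha> = \<beta> then 1 else 0)))"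

definition mat_exp :: "nat \<Rightarrow> 'q::field mat \<Rightarrow> 'q mat" where
  "mat_exp m x = mat m m (\<lambda>(r, c). \<Sum>i<m. (x ^\<^sub>m i) $$ (r, c) / of_nat (fact i))"

definition group_U :: "root_type \<Rightarrow> nat \<Rightarrow> 'q::field mat set" where
  "group_U ty n = mat_exp (mdim ty n) ` lie_u ty n"

definition coadj ::
  "root_type \<Rightarrow> nat \<Rightarrow> 'q::field mat \<Rightarrow> ('q mat \<Rightarrow> 'q) \<Rightarrow> 'q mat \<Rightarrow> 'q" where
  "coadj ty n g f =
     (\<lambda>x\<in>lie_u ty n. f (inv\<^bsub>ring_mat TYPE('q) (mdim ty n) ()\<^esub> g * x * g))"

definition coadj_orbit ::
  "root_type \<Rightarrow> nat \<Rightarrow> ('q::field mat \<Rightarrow> 'q) \<Rightarrow> ('q mat \<Rightarrow> 'q) set" where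
  "coadj_orbit ty n f = (\<lambda>g. coadj ty n g f) ` group_U ty n"

definition rook_form ::
  "root_type \<Rightarrow> nat \<Rightarrow> pos_root set \<Rightarrow> (pos_root \<Rightarrow> 'q::field) \<Rightarrow> 'q mat \<Rightarrow> 'q" where
  "rook_form ty n D \<xi> = (\<lambda>x\<in>lie_u ty n. \<Sum>\<beta>\<in>D. \<xi> \<beta> * dual_basis ty n \<beta> x)"

definition rook_orbit ::
  "root_type \<Rightarrow> nat \<Rightarrow> pos_root set \<Rightarrow> (pos_root \<Rightarrow> 'q::field) \<Rightarrow> ('q mat \<Rightarrow> 'q) set" where
  "rook_orbit ty n D \<xi> = coadj_orbit ty n (rook_form ty n D \<xi>)"

text \<open>The number \<open>d\<close> with \<open>q\<^sup>d = |\<Omega>|\<close>, where \<open>q\<close> is the order of the ground field.\<close>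

definition orbit_dim :: "('q::{field,finite} mat \<Rightarrow> 'q) set \<Rightarrow> real" where
  "orbit_dim \<Omega> = log (real CARD('q)) (real (card \<Omega>))"

end

(*
  The orbit of f has |u| / |Rad f| elements, where Rad f is the radical of the form f([x, y]) on u.
  Both the stabiliser of f in U and the group U itself are parametrised by the Cayley transform,
  (1 + x)(1 + g) = 2, under which g fixes f exactly when x lies in Rad f; this avoids the
  Baker-Campbell-Hausdorff formula. In the basis of root vectors the form has a nonzero entry at
  (alpha, gamma) exactly when alpha + gamma lies in D, so the rank has to be read off a graph on the
  positive roots. Fix a generic linear functional h that is positive on positive roots. An edge joins
  two roots on which h(alpha) + h(sigma alpha) takes opposite nonzero values. The roots where
  it is negative are one half of the inversions of sigma outside D (the other half is their image under
  alpha -> - sigma alpha), and, apart from d isolated ones, they can be removed successively together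
  with a neighbouring leaf. Hence the rank is 2 (#half - d) = (l - s) - 2 d.
*)
theory Submission
  imports Defs "Jordan_Normal_Form.Determinant"
begin

section \<open>Kernels of matrices supported on a graph\<close>

text \<open>The dimension must be the same for all \<open>\<xi>\<close>, so only the support of the
  form may be used. Two facts allow this: the sum of two roots is at most one member of D, so every
  entry of the matrix is zero or plus or minus a single \<open>\<xi> \<beta>\<close>; and removing a
  leaf with its neighbour is an elimination step that only needs nonzero entries. The functional
  enters because sigma negates D: h + h sigma vanishes on D, so it is opposite on two roots with sum
  in D. The defect d cannot be avoided: with increasing labels for the coordinates, if e_a and e_r +
  e_b lie in D and 0 < b < r < a, then h + h sigma is negative on e_a + e_b, but its only possible
  neighbours, - e_b and e_r - e_a, are negative roots. For the groups, the point is that u consists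
  of all strictly lower triangular matrices that are skew for the antidiagonal form, so U lies in
  the group of unipotent isometries, and equality follows by counting. Weyl group elements are
  treated as odd permutations of the integers, where the sign of the root e_a + e_b is that of the
  integer a + b.\<close>

definition coeff_kernel :: "'a set \<Rightarrow> ('a \<Rightarrow> 'a \<Rightarrow> 'q) \<Rightarrow> ('a \<Rightarrow> 'q::field) set" where
  "coeff_kernel V B = {f \<in> V \<rightarrow>\<^sub>E UNIV. \<forall>\<gamma>\<in>V. (\<Sum>\<alpha>\<in>V. f \<alpha> * B \<alpha> \<gamma>) = 0}"

text \<open>The equation at the leaf \<open>v\<close> forces \<open>f u = 0\<close>; then the
  equation at \<open>u\<close> determines \<open>f v\<close>, and no other equation involves
  \<open>v\<close>. So restriction to the remaining vertices is a bijection of kernels, whatever the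
  values of the nonzero entries.\<close>

lemma card_coeff_kernel_remove_leaf:
  fixes B :: "'a \<Rightarrow> 'a \<Rightarrow> 'q::field"
  assumes V: "finite V" "u \<in> V" "v \<in> V" "u \<noteq> v"
    and B: "B u v \<noteq> 0" "B v u \<noteq> 0"
    and leaf: "\<And>x. x \<in> V \<Longrightarrow> x \<noteq> u \<Longrightarrow> B x v = 0 \<and> B v x = 0"
  shows "card (coeff_kernel V B) = card (coeff_kernel (V - {u, v}) B)"
proof -
  define V' where "V' = V - {u, v}"
  have fin: "finite V'" and nin: "u \<notin> V'" "v \<notin> V'" and Veq: "V = insert u (insert v V')"
    using V by (auto simp: V'_def)
  have split: "(\<Sum>\<alpha>\<in>V. f \<alpha> * B \<alpha> \<gamma>) = f u * B u \<gamma> + f v * B v \<gamma> + (\<Sum>\<alpha>\<in>V'. f \<alpha> * B \<alpha> \<gamma>)"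
    for f :: "'a \<Rightarrow> 'q" and \<gamma>
    using fin nin V(4) by (simp add: Veq add.assoc)
  \<comment> \<open>Inverse of the restriction: the value at \<open>u\<close> is 0, and the value at
    \<open>v\<close> solves the equation at \<open>u\<close>.\<close>
  define ext where "ext g = (\<lambda>x\<in>V. if x = u then 0
      else if x = v then - (\<Sum>\<alpha>\<in>V'. g \<alpha> * B \<alpha> u) / B v u else g x)" for g :: "'a \<Rightarrow> 'q"
  have ext_sum: "(\<Sum>\<alpha>\<in>V'. ext g \<alpha> * B \<alpha> \<gamma>) = (\<Sum>\<alpha>\<in>V'. g \<alpha> * B \<alpha> \<gamma>)" for g \<gamma>
    by (rule sum.cong) (auto simp: ext_def V'_def)
  have fu: "f u = 0" if "f \<in> coeff_kernel V B" for f
  proof -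
    have "(\<Sum>\<alpha>\<in>V'. f \<alpha> * B \<alpha> v) = 0"
      by (rule sum.neutral) (use leaf in \<open>auto simp: V'_def\<close>)
    moreover have "(\<Sum>\<alpha>\<in>V. f \<alpha> * B \<alpha> v) = 0"
      using that V by (auto simp: coeff_kernel_def)
    moreover have "B v v = 0" using leaf V by metis
    ultimately show ?thesis using B by (simp add: split)
  qed
  have "bij_betw (\<lambda>f. restrict f V') (coeff_kernel V B) (coeff_kernel V' B)"
  proof (rule bij_betw_byWitness[where f' = ext])
    show "\<forall>f\<in>coeff_kernel V B. ext (restrict f V') = f"
    proof
      fix f assume f: "f \<in> coeff_kernel V B"
      have "(\<Sum>\<alpha>\<in>V. f \<alpha> * B \<alpha> u) = 0"
        using f V by (auto simp: coeff_kernel_def)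
      hence "f v = - (\<Sum>\<alpha>\<in>V'. f \<alpha> * B \<alpha> u) / B v u"
        using fu[OF f] B by (simp add: split field_simps eq_neg_iff_add_eq_0)
      moreover have "(\<Sum>\<alpha>\<in>V'. restrict f V' \<alpha> * B \<alpha> u) = (\<Sum>\<alpha>\<in>V'. f \<alpha> * B \<alpha> u)"
        by (rule sum.cong) auto
      moreover have "f x = undefined" if "x \<notin> V" for x
        using f that by (auto simp: coeff_kernel_def PiE_def extensional_def)
      ultimately show "ext (restrict f V') = f"
        using fu[OF f] by (auto simp: ext_def V'_def fun_eq_iff)
    qed
    show "\<forall>g\<in>coeff_kernel V' B. restrict (ext g) V' = g"
    proof
      fix g assume "g \<in> coeff_kernel V' B"
      hence "g x = undefined" if "x \<notin> V'" for x
        using that by (auto simp: coeff_kernel_def PiE_def extensional_def)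
      thus "restrict (ext g) V' = g"
        by (auto simp: ext_def V'_def fun_eq_iff)
    qed
    show "(\<lambda>f. restrict f V') ` coeff_kernel V B \<subseteq> coeff_kernel V' B"
    proof (rule image_subsetI)
      fix f assume f: "f \<in> coeff_kernel V B"
      have "(\<Sum>\<alpha>\<in>V'. f \<alpha> * B \<alpha> \<gamma>) = 0" if "\<gamma> \<in> V'" for \<gamma>
      proof -
        have "(\<Sum>\<alpha>\<in>V. f \<alpha> * B \<alpha> \<gamma>) = 0" "B v \<gamma> = 0"
          using f leaf[of \<gamma>] that by (auto simp: coeff_kernel_def V'_def)
        thus ?thesis using fu[OF f] by (simp add: split)
      qed
      thus "restrict f V' \<in> coeff_kernel V' B"
        by (auto simp: coeff_kernel_def)
    qed
    show "ext ` coeff_kernel V' B \<subseteq> coeff_kernel V B"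
    proof (rule image_subsetI)
      fix g assume g: "g \<in> coeff_kernel V' B"
      have "(\<Sum>\<alpha>\<in>V. ext g \<alpha> * B \<alpha> \<gamma>) = 0" if \<gamma>: "\<gamma> \<in> V" for \<gamma>
      proof -
        have eu: "ext g u = 0" using V by (auto simp: ext_def)
        have ev: "ext g v = - (\<Sum>\<alpha>\<in>V'. g \<alpha> * B \<alpha> u) / B v u" using V by (auto simp: ext_def)
        consider "\<gamma> = u" | "\<gamma> = v" | "\<gamma> \<in> V'" using \<gamma> unfolding V'_def by blast
        thus ?thesis
        proof cases
          case 1 thus ?thesis using eu ev B by (simp add: split ext_sum)
        next
          case 2
          have "B v v = 0" using leaf V by metis
          moreover have "(\<Sum>\<alpha>\<in>V'. g \<alpha> * B \<alpha> v) = 0"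
            by (rule sum.neutral) (use leaf in \<open>auto simp: V'_def\<close>)
          ultimately show ?thesis using 2 eu by (simp add: split ext_sum)
        next
          case 3
          hence "B v \<gamma> = 0" "(\<Sum>\<alpha>\<in>V'. g \<alpha> * B \<alpha> \<gamma>) = 0"
            using leaf[of \<gamma>] g by (auto simp: V'_def coeff_kernel_def)
          thus ?thesis using eu by (simp add: split ext_sum)
        qed
      qed
      moreover have "ext g \<in> V \<rightarrow>\<^sub>E UNIV" by (auto simp: ext_def)
      ultimately show "ext g \<in> coeff_kernel V B" by (auto simp: coeff_kernel_def)
    qed
  qed
  thus ?thesis unfolding V'_def by (rule bij_betw_same_card)
qed

text \<open>The vertices in \<open>U\<close> are removed by increasing height, each together with a neighbour that is a leaf by then.\<close>

lemma card_coeff_kernel_triangular: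
  fixes B :: "'a \<Rightarrow> 'a \<Rightarrow> 'q::{field,finite}" and ht :: "'a \<Rightarrow> nat"
  assumes "finite V" "U \<subseteq> V"
    and bip: "\<And>x y. x \<in> V \<Longrightarrow> y \<in> V \<Longrightarrow> B x y \<noteq> 0 \<Longrightarrow> (x \<in> U) \<noteq> (y \<in> U)"
    and sym: "\<And>x y. x \<in> V \<Longrightarrow> y \<in> V \<Longrightarrow> B x y = 0 \<longleftrightarrow> B y x = 0"
    and tri: "\<And>u. u \<in> U \<Longrightarrow> \<exists>x\<in>V. B u x \<noteq> 0 \<and>
                (\<forall>u'\<in>V. B u' x \<noteq> 0 \<longrightarrow> u' \<noteq> u \<longrightarrow> ht u' < ht u)"
  shows "card (coeff_kernel V B) * CARD('q) ^ (2 * card U) = CARD('q) ^ card V"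
  using assms
proof (induction "card U" arbitrary: V U)
  case 0
  have "finite U" using 0 by (meson finite_subset)
  hence [simp]: "U = {}" using 0 by simp
  have "coeff_kernel V B = V \<rightarrow>\<^sub>E UNIV"
    unfolding coeff_kernel_def using 0(4) by (auto intro!: sum.neutral) blast
  thus ?case using 0 by (simp add: card_funcsetE)
next
  case (Suc k)
  have finU: "finite U" using Suc.prems by (meson finite_subset)
  have "U \<noteq> {}" using Suc by auto
  \<comment> \<open>Minimal height turns the condition on heights into a leaf condition: another
    neighbour of \<open>x\<close> would be an element of \<open>U\<close> of smaller height.\<close>
  then obtain u where u: "u \<in> U" "\<And>u'. u' \<in> U \<Longrightarrow> ht u \<le> ht u'"
    using ex_has_least_nat[of "\<lambda>u. u \<in> U" _ ht] by auto
  obtain x where x: "x \<in> V" "B u x \<noteq> 0" and xht: "\<And>u'. u' \<in> V \<Longrightarrow> B u' x \<noteq> 0 \<Longrightarrow> u' \<noteq> u \<Longrightarrow> ht u' < ht u"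
    using Suc.prems(5)[OF u(1)] by auto
  have uV: "u \<in> V" using u Suc.prems by auto
  have xU: "x \<notin> U" using Suc.prems(3)[OF uV x] u by auto
  have leaf: "B y x = 0" if "y \<in> V" "y \<noteq> u" for y
  proof (rule ccontr)
    assume "B y x \<noteq> 0"
    hence "y \<in> U" "ht y < ht u" using Suc.prems(3)[of y x] xht that x xU by auto
    thus False using u(2)[of y] by simp
  qed
  define V' where "V' = V - {u, x}"
  define U' where "U' = U - {u}"
  have cU: "card U = Suc (card U')" using u finU Suc by (simp add: U'_def)
  have cV: "card V = Suc (Suc (card V'))"
  proof -
    have "V = insert u (insert x V')" "u \<notin> insert x V'" "x \<notin> V'" "finite V'"
      using uV x u xU Suc.prems(1) by (auto simp: V'_def)
    thus ?thesis by (metis card_insert_disjoint finite_insert)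
  qed
  have "card (coeff_kernel V' B) * CARD('q) ^ (2 * card U') = CARD('q) ^ card V'"
  proof (rule Suc.hyps(1))
    show "k = card U'" using Suc.hyps(2) cU by simp
    show "finite V'" using Suc.prems by (simp add: V'_def)
    show "U' \<subseteq> V'" using Suc.prems xU by (auto simp: V'_def U'_def)
    show "(y \<in> U') \<noteq> (z \<in> U')" if "y \<in> V'" "z \<in> V'" "B y z \<noteq> 0" for y z
      using Suc.prems(3)[of y z] that by (auto simp: V'_def U'_def)
    show "B y z = 0 \<longleftrightarrow> B z y = 0" if "y \<in> V'" "z \<in> V'" for y z
      using Suc.prems(4)[of y z] that by (auto simp: V'_def)
    fix w assume w: "w \<in> U'"
    then obtain z where z: "z \<in> V" "B w z \<noteq> 0"
      and zht: "\<forall>u'\<in>V. B u' z \<noteq> 0 \<longrightarrow> u' \<noteq> w \<longrightarrow> ht u' < ht w"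
      using Suc.prems(5)[of w] by (auto simp: U'_def)
    have wV: "w \<in> V" using w Suc.prems by (auto simp: U'_def)
    \<comment> \<open>The vertex chosen for \<open>w\<close> survives: \<open>x\<close> is adjacent
      to \<open>u\<close> only, and \<open>u\<close> lies on the same side of the bipartition as
      \<open>w\<close>.\<close>
    have "z \<noteq> x" using leaf[of w] wV w z by (auto simp: U'_def)
    moreover have "z \<noteq> u" using Suc.prems(3)[OF wV z] w u by (auto simp: U'_def)
    ultimately show "\<exists>x\<in>V'. B w x \<noteq> 0 \<and> (\<forall>u'\<in>V'. B u' x \<noteq> 0 \<longrightarrow> u' \<noteq> w \<longrightarrow> ht u' < ht w)"
      using z zht by (intro bexI[of _ z]) (auto simp: V'_def)
  qed
  moreover have "card (coeff_kernel V B) = card (coeff_kernel V' B)"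
    unfolding V'_def
  proof (rule card_coeff_kernel_remove_leaf)
    show "B x u \<noteq> 0" using Suc.prems(4)[OF uV x(1)] x by simp
    show "B y x = 0 \<and> B x y = 0" if "y \<in> V" "y \<noteq> u" for y
      using leaf[OF that] Suc.prems(4)[OF that(1) x(1)] by simp
    show "u \<noteq> x" using u xU by auto
  qed (fact uV x Suc.prems(1))+
  ultimately have "card (coeff_kernel V B) * CARD('q) ^ (2 * card U') = CARD('q) ^ card V'"
    by simp
  hence "card (coeff_kernel V B) * CARD('q) ^ (2 * card U') * CARD('q)^2 = CARD('q) ^ card V' * CARD('q)^2"
    by simp
  thus ?case
    by (simp add: cU cV power2_eq_square algebra_simps)
qed

section \<open>Signed involutions of orthogonal rook placements\<close>

text \<open>A generic functional with the order of the roots: because of the base 5, four weights sum to zero only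
  if they cancel in pairs.\<close>

definition weight :: "int \<Rightarrow> int" where
  "weight p = sgn p * 5 ^ nat \<bar>p\<bar>"

lemma weight_uminus [simp]: "weight (- p) = - weight p"
  by (simp add: weight_def sgn_minus)

lemma weight_0 [simp]: "weight 0 = 0"
  by (simp add: weight_def)

lemma weight_less: assumes "p < q" shows "weight p < weight q"
proof -
  have *: "weight p < weight q" if "0 \<le> p" "p < q" for p q
  proof (cases "p = 0")
    case False
    have "(5::int) ^ nat p < 5 ^ nat q"
      by (rule power_strict_increasing) (use that in auto)
    thus ?thesis using that False by (simp add: weight_def)
  qed (use that in \<open>simp add: weight_def\<close>)
  consider "0 \<le> p" | "q \<le> 0" | "p < 0" "0 < q" by linarith
  thus ?thesis
  proof cases
    case 1 thus ?thesis using * assms by simp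
  next
    case 2 thus ?thesis using *[of "- q" "- p"] assms by simp
  next
    case 3 thus ?thesis using *[of 0 q] *[of 0 "- p"] by simp
  qed
qed

lemma weight_less_iff [simp]: "weight p < weight q \<longleftrightarrow> p < q"
  by (metis weight_less less_asym' linorder_less_linear)

lemma weight_eq_iff [simp]: "weight p = weight q \<longleftrightarrow> p = q"
  by (metis weight_less less_irrefl linorder_less_linear)

lemma weight_le_iff [simp]: "weight p \<le> weight q \<longleftrightarrow> p \<le> q"
  by (simp add: not_less[symmetric])

lemma weight_add_pos_iff: "0 < weight p + weight q \<longleftrightarrow> 0 < p + q"
  using weight_less_iff[of "- q" p] by (simp only: weight_uminus) linarith

text \<open>Each of the three other weights is at least \<open>- (5 ^ (a - 1))\<close>, while
  \<open>weight a\<close> is five times \<open>5 ^ (a - 1)\<close>, so they cannot outweigh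
  it.\<close>

lemma weight_dominant:
  assumes "a > 0" "\<bar>b\<bar> \<le> a" "\<bar>c\<bar> \<le> a" "\<bar>d\<bar> \<le> a" "b \<noteq> - a" "c \<noteq> - a" "d \<noteq> - a"
  shows "weight a + weight b + weight c + weight d > 0"
proof -
  have *: "weight x \<ge> - (5 ^ nat (a - 1))" if "\<bar>x\<bar> \<le> a" "x \<noteq> - a" for x
  proof -
    have "weight (1 - a) \<le> weight x"
      using weight_less_iff[of x "1 - a"] that by (simp add: not_less[symmetric])
    moreover have "weight (1 - a) \<ge> - (5 ^ nat (a - 1))"
      using assms(1) by (auto simp: weight_def sgn_if)
    ultimately show ?thesis by linarith
  qed
  have "nat a = Suc (nat (a - 1))" using assms by simp
  hence "weight a = 5 * 5 ^ nat (a - 1)" using assms by (simp add: weight_def)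
  moreover have "(5::int) ^ nat (a - 1) > 0" by simp
  ultimately show ?thesis
    using *[of b] *[of c] *[of d] assms by linarith
qed

text \<open>The entry of largest absolute value must not dominate, so its negative is among the
  others; the remaining two weights then sum to zero as well.\<close>

lemma weight_four_zero:
  assumes "weight a + weight b + weight c + weight d = 0"
  shows "a = - b \<and> c = - d \<or> a = - c \<and> b = - d \<or> a = - d \<and> b = - c"
proof -
  have dom: "b = - a \<or> c = - a \<or> d = - a"
    if "weight a + weight b + weight c + weight d = 0" "\<bar>b\<bar> \<le> \<bar>a\<bar>" "\<bar>c\<bar> \<le> \<bar>a\<bar>" "\<bar>d\<bar> \<le> \<bar>a\<bar>"
    for a b c d
  proof (rule ccontr)
    assume neg: "\<not> ?thesis"
    consider "a > 0" | "a < 0" | "a = 0" by linarith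
    thus False
    proof cases
      case 1 thus ?thesis using weight_dominant[of a b c d] that neg by auto
    next
      case 2 thus ?thesis using weight_dominant[of "- a" "- b" "- c" "- d"] that neg by auto
    next
      case 3 thus ?thesis using that neg by auto
    qed
  qed
  have two: "x = - y" if "weight x + weight y = 0" for x y
    using that weight_eq_iff[of x "- y"] by simp
  consider "\<bar>b\<bar> \<le> \<bar>a\<bar>" "\<bar>c\<bar> \<le> \<bar>a\<bar>" "\<bar>d\<bar> \<le> \<bar>a\<bar>" | "\<bar>a\<bar> \<le> \<bar>b\<bar>" "\<bar>c\<bar> \<le> \<bar>b\<bar>" "\<bar>d\<bar> \<le> \<bar>b\<bar>"
    | "\<bar>a\<bar> \<le> \<bar>c\<bar>" "\<bar>b\<bar> \<le> \<bar>c\<bar>" "\<bar>d\<bar> \<le> \<bar>c\<bar>" | "\<bar>a\<bar> \<le> \<bar>d\<bar>" "\<bar>b\<bar> \<le> \<bar>d\<bar>" "\<bar>c\<bar> \<le> \<bar>d\<bar>"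
    by linarith
  hence "a = - b \<or> a = - c \<or> a = - d \<or> b = - c \<or> b = - d \<or> c = - d"
  proof cases
    case 1 thus ?thesis using dom[of a b c d] assms by auto
  next
    case 2 thus ?thesis using dom[of b a c d] assms by auto
  next
    case 3 thus ?thesis using dom[of c a b d] assms by auto
  next
    case 4 thus ?thesis using dom[of d a b c] assms by auto
  qed
  thus ?thesis
    using assms two[of a b] two[of a c] two[of a d] two[of b c] two[of b d] two[of c d] by auto
qed

text \<open>The pair \<open>(a, b)\<close> stands for the positive root \<open>e\<^sub>a + e\<^sub>b\<close>, where \<open>e\<^sub>a = \<epsilon>\<^bsub>n+1-a\<^esub>\<close> for \<open>a > 0\<close>,
  \<open>e\<^bsub>-a\<^esub> = - e\<^sub>a\<close> and \<open>e\<^sub>0 = 0\<close>. The reversed numbering turns the order of the \<open>\<epsilon>\<^sub>i\<close> into that of the integers.\<close>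

definition sroots :: "bool \<Rightarrow> int \<Rightarrow> (int \<times> int) set" where
  "sroots short n = {(a, b). \<bar>b\<bar> < a \<and> a \<le> n \<and> (short \<or> b \<noteq> 0)}"

lemma finite_sroots: "finite (sroots short n)"
proof (rule finite_subset)
  show "sroots short n \<subseteq> {- n..n} \<times> {- n..n}" by (auto simp: sroots_def)
qed simp

text \<open>The root e_p + e_q does not depend on the order of its indices, but in
  \<open>sroots\<close> the index of larger absolute value, which carries the sign, comes
  first.\<close>

definition nrm :: "int \<Rightarrow> int \<Rightarrow> int \<times> int" where
  "nrm p q = (if \<bar>q\<bar> < \<bar>p\<bar> then (p, q) else (q, p))"

text \<open>Since 0 counts as an index of a short root, the disjointness assumption allows at most one short root.\<close>

locale rook_involution =
  fixes short :: bool and n :: int and D :: "(int \<times> int) set" and s :: "int \<Rightarrow> int"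
  assumes D_sub: "D \<subseteq> sroots short n"
    and D_disj: "(a, b) \<in> D \<Longrightarrow> (c, d) \<in> D \<Longrightarrow> {\<bar>a\<bar>, \<bar>b\<bar>} \<inter> {\<bar>c\<bar>, \<bar>d\<bar>} \<noteq> {} \<Longrightarrow> a = c \<and> b = d"
    and s_uminus: "s (- p) = - s p"
    and s_long: "(a, b) \<in> D \<Longrightarrow> b \<noteq> 0 \<Longrightarrow> s a = - b \<and> s b = - a"
    and s_short: "(a, 0) \<in> D \<Longrightarrow> s a = - a"
    and s_free: "(\<And>a b. (a, b) \<in> D \<Longrightarrow> \<bar>p\<bar> \<noteq> \<bar>a\<bar> \<and> \<bar>p\<bar> \<noteq> \<bar>b\<bar>) \<Longrightarrow> s p = p"
begin

section \<open>Matched indices, adjacency and the functional on indices\<close>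

definition mt :: "int \<Rightarrow> int \<Rightarrow> bool" where
  "mt p r \<longleftrightarrow> (p, r) \<in> D \<or> (r, p) \<in> D"

text \<open>Membership in \<open>sroots\<close> up to the order of the indices: neighbours arise as
  e_r - e_q, where it is not known in advance which index is larger.\<close>

definition root :: "int \<Rightarrow> int \<Rightarrow> bool" where
  "root p q \<longleftrightarrow> \<bar>p\<bar> \<noteq> \<bar>q\<bar> \<and> \<bar>p\<bar> \<le> n \<and> \<bar>q\<bar> \<le> n \<and> 0 < p + q \<and> (short \<or> p \<noteq> 0 \<and> q \<noteq> 0)"

text \<open>\<open>adj \<alpha> \<gamma>\<close> means \<open>\<alpha> + \<gamma> \<in> D\<close>: the root \<open>e\<^sub>p + e\<^sub>q\<close> has the neighbours \<open>e\<^sub>r - e\<^sub>q\<close> with \<open>e\<^sub>p + e\<^sub>r \<in> D\<close>.\<close>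

fun adj :: "int \<times> int \<Rightarrow> int \<times> int \<Rightarrow> bool" where
  "adj (p, q) (p', q') \<longleftrightarrow>
     mt p p' \<and> q' = - q \<or> mt p q' \<and> p' = - q \<or> mt q p' \<and> q' = - p \<or> mt q q' \<and> p' = - p"

text \<open>The value of h + h s on the vector e_p, where h is given by \<open>weight\<close>. Its
  value on a root is the sum over the two indices.\<close>

definition cw :: "int \<Rightarrow> int" where
  "cw p = weight p + weight (s p)"

text \<open>These roots are the isolated vertices responsible for the correction term \<open>d\<close>.\<close>

definition exc :: "int \<Rightarrow> int \<Rightarrow> bool" where
  "exc q p \<longleftrightarrow> mt q 0 \<and> (\<exists>r. mt p r \<and> 0 < p \<and> p < r \<and> r < q)"

lemma D_D: "(a, b) \<in> D \<Longrightarrow> \<bar>b\<bar> < a \<and> a \<le> n \<and> (short \<or> b \<noteq> 0)"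
  using D_sub by (auto simp: sroots_def)

lemma mt_sym: "mt p r \<longleftrightarrow> mt r p"
  by (auto simp: mt_def)

lemma mt_D: "mt p r \<Longrightarrow> 0 < p + r \<and> \<bar>p\<bar> \<noteq> \<bar>r\<bar> \<and> \<bar>p\<bar> \<le> n \<and> \<bar>r\<bar> \<le> n \<and> (short \<or> p \<noteq> 0 \<and> r \<noteq> 0)"
  unfolding mt_def using D_D by fastforce

lemma mt_unique: "mt p r \<Longrightarrow> mt p r' \<Longrightarrow> r = r'"
  unfolding mt_def using D_disj by (metis D_D IntI abs_ge_self empty_iff insertI1 insertI2 not_less)

text \<open>Members of D with indices p and -p share an absolute value, so they coincide, and -p is
  p itself or its partner; the partner has a different absolute value.\<close>

lemma mt_opp: assumes "mt p r" "mt (- p) r'" shows "p = 0"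
proof -
  have "r' = r \<and> - p = p \<or> r' = p \<and> - p = r"
    using assms D_disj[of p r "- p" r'] D_disj[of p r r' "- p"] D_disj[of r p "- p" r'] D_disj[of r p r' "- p"]
    unfolding mt_def by auto
  thus ?thesis using mt_D[OF assms(1)] by auto
qed

lemma s_0 [simp]: "s 0 = 0"
  using s_uminus[of 0] by simp

lemma s_mt: "mt p r \<Longrightarrow> p \<noteq> 0 \<Longrightarrow> r \<noteq> 0 \<Longrightarrow> s p = - r"
  unfolding mt_def using s_long by auto

lemma s_mt_0: "mt p 0 \<Longrightarrow> s p = - p"
  unfolding mt_def using s_short D_D by fastforce

lemma s_unmatched: assumes "\<And>r. \<not> mt p r" "\<And>r. \<not> mt (- p) r" shows "s p = p"
  using s_free[of p] assms unfolding mt_def abs_eq_iff by (metis minus_minus)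

lemma rootI:
  "\<bar>p\<bar> \<noteq> \<bar>q\<bar> \<Longrightarrow> \<bar>p\<bar> \<le> n \<Longrightarrow> \<bar>q\<bar> \<le> n \<Longrightarrow> 0 < p + q \<Longrightarrow> short \<or> p \<noteq> 0 \<and> q \<noteq> 0 \<Longrightarrow> root p q"
  by (simp add: root_def)

lemma root_sym: "root p q \<longleftrightarrow> root q p"
  by (auto simp: root_def)

lemma adj_swap1: "adj (p, q) \<gamma> \<longleftrightarrow> adj (q, p) \<gamma>"
  by (cases \<gamma>) auto

lemma adj_swap2: "adj \<gamma> (p, q) \<longleftrightarrow> adj \<gamma> (q, p)"
  by (cases \<gamma>) auto

lemma adj_sym: "adj \<alpha> \<gamma> \<longleftrightarrow> adj \<gamma> \<alpha>"
  by (cases \<alpha>; cases \<gamma>) (auto simp: mt_sym)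

lemma cw_0 [simp]: "cw 0 = 0"
  by (simp add: cw_def)

lemma cw_mt: "mt p r \<Longrightarrow> p \<noteq> 0 \<Longrightarrow> r \<noteq> 0 \<Longrightarrow> cw p = weight p - weight r"
  by (simp add: cw_def s_mt)

lemma cw_mt_0: "mt p 0 \<Longrightarrow> cw p = 0"
  by (simp add: cw_def s_mt_0)

lemma cw_uminus: "cw (- p) = - cw p"
  by (simp add: cw_def s_uminus)

lemma cw_unmatched: "(\<And>r. \<not> mt p r) \<Longrightarrow> (\<And>r. \<not> mt (- p) r) \<Longrightarrow> cw p = 2 * weight p"
  by (simp add: cw_def s_unmatched)

text \<open>On each of these cases \<open>cw p\<close> is given by one formula: in this order 0,
  \<open>2 * weight p\<close>, \<open>weight p - weight r\<close>, 0,
  \<open>weight p + weight r\<close>, 0.\<close>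

lemma status_cases:
  obtains (zero) "p = 0" | (unmatched) "p \<noteq> 0" "\<And>r. \<not> mt p r" "\<And>r. \<not> mt (- p) r"
  | (pos) r where "p \<noteq> 0" "r \<noteq> 0" "mt p r" | (pos0) "p \<noteq> 0" "mt p 0"
  | (neg) r where "p \<noteq> 0" "r \<noteq> 0" "mt (- p) r" | (neg0) "p \<noteq> 0" "mt (- p) 0"
  by metis

lemma cw_neg: "mt (- p) r \<Longrightarrow> p \<noteq> 0 \<Longrightarrow> r \<noteq> 0 \<Longrightarrow> cw p = weight p + weight r"
  using cw_mt[of "- p" r] cw_uminus[of p] by simp

lemma cw_neg0: "mt (- p) 0 \<Longrightarrow> cw p = 0"
  using cw_mt_0[of "- p"] cw_uminus[of p] by simp

lemma cw_mt_add: assumes "mt p r" shows "cw p + cw r = 0"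
proof (cases "p = 0 \<or> r = 0")
  case True
  thus ?thesis using cw_mt_0[of p] cw_mt_0[of r] assms mt_sym by auto
next
  case False
  thus ?thesis using cw_mt[of p r] cw_mt[of r p] assms mt_sym by auto
qed

text \<open>Since s negates the members of D, \<open>cw\<close> sums to 0 over matched indices; the
  other two indices of adjacent roots are opposite and cancel because \<open>cw\<close> is odd. This
  is the source of the bipartition.\<close>

lemma cw_adj:
  assumes "adj (p, q) (p', q')"
  shows "cw p + cw q + (cw p' + cw q') = 0"
proof -
  show ?thesis using assms cw_mt_add[of p p'] cw_mt_add[of p q'] cw_mt_add[of q p'] cw_mt_add[of q q']
    by (auto simp: cw_uminus)
qed

text \<open>Long roots are only removed after all short roots, so short neighbours do not prevent a vertex from
  being a leaf.\<close>

definition pivot :: "int \<Rightarrow> int \<Rightarrow> int \<Rightarrow> int \<Rightarrow> bool" where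
  "pivot p q p' q' \<longleftrightarrow> root p' q' \<and> adj (p, q) (p', q') \<and>
     (\<forall>u v. root u v \<longrightarrow> adj (u, v) (p', q') \<longrightarrow>
        u = p \<and> v = q \<or> u = q \<and> v = p \<or> (u = 0 \<or> v = 0) \<and> p \<noteq> 0 \<and> q \<noteq> 0)"

lemma pivot_sym: "pivot p q p' q' \<longleftrightarrow> pivot q p p' q'"
  unfolding pivot_def using adj_swap1 by blast

text \<open>Besides e_p + e_q, the root e_r - e_q can only be adjacent to e_x - e_r for a partner x
  of -q, and this is positive only if r < x. The last premise excludes that root or lets it pass as
  a short one.\<close>

lemma pivotI:
  assumes "mt p r" "root r (- q)"
    and "\<And>r'. mt (- q) r' \<Longrightarrow> r < r' \<Longrightarrow> (r = 0 \<or> r' = 0) \<and> p \<noteq> 0 \<and> q \<noteq> 0"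
  shows "pivot p q r (- q)"
proof -
  have inv: "p = x" if "mt x r" for x
    using that assms(1) mt_sym mt_unique by blast
  have "u = p \<and> v = q \<or> u = q \<and> v = p \<or> (u = 0 \<or> v = 0) \<and> p \<noteq> 0 \<and> q \<noteq> 0"
    if uv: "root u v" "adj (u, v) (r, - q)" for u v
  proof -
    from uv(2) consider "mt u r" "v = q" | "mt v r" "u = q" | "mt (- q) u" "v = - r" | "mt (- q) v" "u = - r"
      by (auto simp: mt_sym)
    thus ?thesis
      using inv assms(3)[of u] assms(3)[of v] uv(1) by cases (auto simp: root_def)
  qed
  thus ?thesis using assms unfolding pivot_def by auto
qed

text \<open>The main candidates are e_r - e_q and, for a partner x of q, e_x - e_p. In each case
  \<open>cw p + cw q < 0\<close>, combined with the positivity of e_p + e_q, makes one of them a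
  positive root with no further neighbour; where this fails, \<open>exc\<close> intervenes.\<close>

lemma pivot_ex_matched:
  assumes "mt p r" "p \<noteq> 0" "r \<noteq> 0" "root p q" "cw p + cw q < 0" "\<not> exc q p"
  shows "\<exists>p' q'. pivot p q p' q'"
proof -
  have pq: "0 < weight p + weight q" "0 < p + q" "\<bar>p\<bar> \<le> n" "\<bar>q\<bar> \<le> n" "short \<or> q \<noteq> 0"
    using assms(4) by (auto simp: weight_add_pos_iff root_def)
  have r: "\<bar>r\<bar> \<le> n" using mt_D[OF assms(1)] by simp
  have cp: "cw p = weight p - weight r" using cw_mt assms by simp
  \<comment> \<open>For r = -q the root e_p - e_q lies in D, so s fixes e_p + e_q and the sum would
    be twice its positive weight.\<close>
  have rq: "r \<noteq> - q"
  proof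
    assume "r = - q"
    hence "mt (- q) p" "q \<noteq> 0" using assms mt_sym by auto
    hence "cw q = weight q + weight p" using cw_neg assms by simp
    moreover have "weight q = - weight r" using \<open>r = - q\<close> weight_uminus[of r] by simp
    ultimately show False using cp assms(5) pq by simp
  qed
  have R: "root r (- q)" if "q < r" using that rq pq r assms(3) by (intro rootI) auto
  show ?thesis
  proof (cases q rule: status_cases)
    case zero
    \<comment> \<open>A short root needs a genuine leaf. If e_c lies in D with p < c, then e_c - e_p
      is one, since -p is unmatched. Otherwise a partner c of 0 satisfies c \<le> p < r, so the
      rival neighbour e_c - e_r of e_r is not positive.\<close>
    show ?thesis
    proof (cases "\<exists>c. mt 0 c \<and> p < c")
      case True
      then obtain c where c: "mt 0 c" "p < c" by auto
      have "\<not> mt (- p) r'" for r' using mt_opp assms by blast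
      moreover have "root c (- p)" using c mt_D[OF c(1)] pq assms zero by (intro rootI) auto
      ultimately have "pivot 0 p c (- p)" using c by (intro pivotI) auto
      thus ?thesis using zero pivot_sym by blast
    next
      case False
      have "p < r" using assms(5) cp zero by simp
      moreover have "p > 0" using pq zero by simp
      ultimately have "pivot p q r (- q)"
        using R zero False assms(1) by (intro pivotI) auto
      thus ?thesis by blast
    qed
  next
    case unmatched
    have "cw q = 2 * weight q" using cw_unmatched unmatched by simp
    hence "weight q < weight r" using assms(5) cp pq by linarith
    hence "q < r" by simp
    hence "pivot p q r (- q)" using R unmatched assms(1) by (intro pivotI) auto
    thus ?thesis by blast
  next
    case (pos r')
    have neg: "\<not> mt (- q) x" "\<not> mt (- p) x" for x
      using mt_opp[OF pos(3)] mt_opp[OF assms(1)] pos assms by blast+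
    have cq: "cw q = weight q - weight r'" using cw_mt pos by simp
    have "r \<noteq> q"
    proof
      assume "r = q"
      moreover have "r' = p" using mt_unique[OF pos(3)] assms(1) mt_sym \<open>r = q\<close> by blast
      ultimately show False using cp cq assms(5) by simp
    qed
    \<comment> \<open>The hypothesis says \<open>weight p + weight q < weight r + weight r'\<close>,
      so q < r or p < r'; and since -p and -q are unmatched, there are no rival neighbours.\<close>
    show ?thesis
    proof (cases "q < r")
      case True
      hence "pivot p q r (- q)" using R neg assms(1) by (intro pivotI) auto
      thus ?thesis by blast
    next
      case False
      hence "r < q" using \<open>r \<noteq> q\<close> by simp
      hence "weight r < weight q" by simp
      hence "weight p < weight r'" using cp cq assms(5) pq by linarith
      hence "p < r'" by simp
      moreover have "r' \<noteq> - p"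
      proof
        assume "r' = - p"
        hence "mt (- p) q" using pos mt_sym by blast
        thus False using neg by simp
      qed
      ultimately have "root r' (- p)" using pq mt_D[OF pos(3)] assms by (intro rootI) auto
      hence "pivot q p r' (- p)" using neg pos by (intro pivotI) auto
      thus ?thesis using pivot_sym by blast
    qed
  next
    case pos0
    have "cw q = 0" using cw_mt_0 pos0 by simp
    hence pr: "p < r" using cp assms(5) by simp
    have q: "q > 0" using mt_D[OF pos0(2)] by simp
    have neg: "\<not> mt (- q) x" "\<not> mt (- p) x" for x
      using mt_opp[OF pos0(2)] mt_opp[OF assms(1)] pos0 assms by blast+
    have "r \<noteq> q" using mt_unique[OF pos0(2), of p] assms mt_sym by blast
    show ?thesis
    proof (cases "q < r")
      case True
      hence "pivot p q r (- q)" using R neg assms(1) by (intro pivotI) auto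
      thus ?thesis by blast
    next
      case False
      \<comment> \<open>Here r < q, so a positive p would make e_q + e_p exceptional. For p < 0 the
        short root e_{-p} is positive, and it is a neighbour because q is matched with 0.\<close>
      hence "p < 0" using assms(1,2,6) pos0 pr \<open>r \<noteq> q\<close> unfolding exc_def
        by (metis linorder_less_linear)
      hence "root 0 (- p)" using pq mt_D[OF pos0(2)] by (intro rootI) auto
      hence "pivot q p 0 (- p)" using neg pos0 by (intro pivotI) auto
      thus ?thesis using pivot_sym by blast
    qed
  next
    case (neg r')
    have cq: "cw q = weight q + weight r'" using cw_neg neg by simp
    have "q < r'" using mt_D[OF neg(3)] by simp
    hence "weight q < weight r'" by simp
    hence "weight q < weight r" using cq cp assms(5) pq by linarith
    hence "q < r" by simp
    moreover have "weight r' < weight r" using cq cp assms(5) pq by linarith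
    hence "\<not> r < x" if "mt (- q) x" for x using mt_unique[OF neg(3) that] by auto
    ultimately have "pivot p q r (- q)" using R assms(1) by (intro pivotI) auto
    thus ?thesis by blast
  next
    case neg0
    have "cw q = 0" using cw_neg0 neg0 by simp
    hence pr: "p < r" using cp assms(5) by simp
    have q: "q < 0" using mt_D[OF neg0(2)] by simp
    hence "p > 0" using pq by simp
    have "\<not> r < x" if "mt (- q) x" for x using mt_unique[OF neg0(2) that] pr \<open>p > 0\<close> by simp
    hence "pivot p q r (- q)" using R assms(1) q pr \<open>p > 0\<close> by (intro pivotI) auto
    thus ?thesis by blast
  qed
qed

text \<open>The neighbour used is the short root e_{-q}. It is positive because
  \<open>cw q < 0\<close> forces q < 0 when q has no nonzero partner.\<close>

lemma pivot_ex_short: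
  assumes "mt p 0" "p \<noteq> 0" "root p q" "cw p + cw q < 0" "\<And>r. mt q r \<Longrightarrow> r = 0"
  shows "\<exists>p' q'. pivot p q p' q'"
proof -
  have pq: "0 < weight p + weight q" "0 < p + q" "\<bar>p\<bar> \<le> n" "\<bar>q\<bar> \<le> n" "short"
    using assms(3) mt_D[OF assms(1)] by (auto simp: weight_add_pos_iff root_def)
  have cq: "cw q < 0" using assms(4) cw_mt_0[OF assms(1)] by simp
  have p: "p > 0" using mt_D[OF assms(1)] by simp
  show ?thesis
  proof (cases q rule: status_cases)
    case zero thus ?thesis using cq by simp
  next
    case unmatched
    hence "weight q < weight 0" using cw_unmatched[of q] cq by simp
    hence "q < 0" by (simp only: weight_less_iff)
    hence "pivot p q 0 (- q)" using assms(1) unmatched pq by (intro pivotI rootI) auto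
    thus ?thesis by blast
  next
    case (pos r) thus ?thesis using assms(5) by simp
  next
    case pos0 thus ?thesis using cq cw_mt_0 by simp
  next
    case (neg r)
    \<comment> \<open>The root e_{-q} may also be adjacent to the short root e_r, which precedes the
      long root e_p + e_q in the elimination: this is what the exemption in \<open>pivot\<close> is
      for.\<close>
    have "weight q + weight r < 0" using cq neg cw_neg by simp
    hence "q + r < 0" using weight_add_pos_iff[of "- q" "- r"] by simp
    hence "q < 0" using mt_D[OF neg(3)] by simp
    hence "pivot p q 0 (- q)" using assms(1,2) neg pq by (intro pivotI rootI) auto
    thus ?thesis by blast
  next
    case neg0 thus ?thesis using cq cw_neg0 by simp
  qed
qed

text \<open>An index x that is 0 or has no partner satisfies \<open>2 * weight x \<le> cw x\<close>,
  because a partner of -x is larger than x. So the sum is at least twice the weight of a positive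
  root.\<close>

lemma cw_nonneg_cases:
  assumes "root p q" "\<And>r. \<not> mt p r \<or> p = 0" "\<And>r. \<not> mt q r \<or> q = 0"
  shows "0 \<le> cw p + cw q"
proof -
  have pq: "0 < weight p + weight q" using assms(1) by (auto simp: weight_add_pos_iff root_def)
  have *: "cw x = 0 \<and> x = 0 \<or> cw x = 2 * weight x \<or> 2 * weight x \<le> cw x \<or> cw x = 0 \<and> x < 0"
    if "\<And>r. \<not> mt x r \<or> x = 0" for x
  proof (cases x rule: status_cases)
    case unmatched thus ?thesis using cw_unmatched by simp
  next
    case (neg r)
    have "weight x < weight r" using mt_D[OF neg(3)] by simp
    thus ?thesis using cw_neg[of x r] neg by simp
  next
    case neg0
    thus ?thesis using cw_neg0 mt_D[OF neg0(2)] by simp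
  qed (use that in auto)
  have neg: "x < 0 \<Longrightarrow> weight x < 0" for x using weight_less_iff[of x 0] by simp
  show ?thesis
    using *[OF assms(2)] *[OF assms(3)] pq neg[of p] neg[of q] by (auto simp del: weight_less_iff)
qed

lemma pivot_ex:
  assumes "root p q" "cw p + cw q < 0" "\<not> exc p q" "\<not> exc q p"
  shows "\<exists>p' q'. pivot p q p' q'"
proof -
  have s: "root q p" "cw q + cw p < 0" using assms root_sym by auto
  consider r where "p \<noteq> 0" "r \<noteq> 0" "mt p r" | r where "q \<noteq> 0" "r \<noteq> 0" "mt q r"
    | "mt p 0" "p \<noteq> 0" "\<And>r. mt q r \<Longrightarrow> r = 0" | "mt q 0" "q \<noteq> 0" "\<And>r. mt p r \<Longrightarrow> r = 0"
    | "\<And>r. \<not> mt p r \<or> p = 0" "\<And>r. \<not> mt q r \<or> q = 0" | "mt p 0" "q = 0" | "mt q 0" "p = 0"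
    by metis
  thus ?thesis
  proof cases
    case 1 thus ?thesis using pivot_ex_matched assms by blast
  next
    case 2 thus ?thesis using pivot_ex_matched[of q _ p] assms s pivot_sym by blast
  next
    case 3 thus ?thesis using pivot_ex_short assms by blast
  next
    case 4 thus ?thesis using pivot_ex_short[of q p] assms s pivot_sym by blast
  next
    case 5 thus ?thesis using cw_nonneg_cases[of p q] assms by simp
  next
    case 6 thus ?thesis using cw_mt_0[of p] assms by simp
  next
    case 7 thus ?thesis using cw_mt_0[of q] assms by simp
  qed
qed

section \<open>Inversions and the sign of the functional\<close>

definition gw :: "int \<times> int \<Rightarrow> int" where
  "gw \<alpha> = cw (fst \<alpha>) + cw (snd \<alpha>)"

text \<open>One root of each pair \<open>{\<alpha>, - s \<alpha>}\<close> of inversions outside \<open>D\<close>.\<close>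

definition lower :: "(int \<times> int) set" where
  "lower = {\<alpha> \<in> sroots short n. gw \<alpha> < 0}"

definition inversions :: "(int \<times> int) set" where
  "inversions = {\<alpha> \<in> sroots short n. s (fst \<alpha>) + s (snd \<alpha>) < 0}"

definition exceptional :: "(int \<times> int) set" where
  "exceptional = {\<alpha> \<in> sroots short n. exc (fst \<alpha>) (snd \<alpha>)}"

definition flip :: "int \<times> int \<Rightarrow> int \<times> int" where
  "flip \<alpha> = nrm (- s (fst \<alpha>)) (- s (snd \<alpha>))"

lemma sroots_root: "(a, b) \<in> sroots short n \<Longrightarrow> root a b"
  by (auto simp: sroots_def root_def)

lemma nrm_sroots: "root p q \<Longrightarrow> nrm p q \<in> sroots short n"
  by (auto simp: sroots_def root_def nrm_def)

lemma s_s [simp]: "s (s p) = p"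
proof (cases p rule: status_cases)
  case (pos r)
  hence "s p = - r" "s r = - p" using s_mt mt_sym by auto
  thus ?thesis by (simp add: s_uminus)
next
  case pos0 thus ?thesis by (simp add: s_mt_0 s_uminus)
next
  case (neg r)
  hence "s (- p) = - r" "s r = p" using s_mt[of "- p" r] s_mt[of r "- p"] mt_sym by auto
  thus ?thesis by (simp add: s_uminus)
next
  case neg0 
  hence "s (- p) = p" using s_mt_0[of "- p"] by simp
  hence "s p = - p" by (simp add: s_uminus)
  thus ?thesis by (simp add: s_uminus)
qed (simp_all add: s_unmatched)

lemma abs_s_le: "\<bar>p\<bar> \<le> n \<Longrightarrow> \<bar>s p\<bar> \<le> n"
proof (cases p rule: status_cases)
  case (pos r) thus ?thesis using s_mt mt_D by auto
next
  case pos0 assume "\<bar>p\<bar> \<le> n" thus ?thesis using s_mt_0 pos0 by auto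
next
  case (neg r) thus ?thesis using s_mt[of "- p" r] mt_D[of "- p" r] by (auto simp: s_uminus)
next
  case neg0 assume "\<bar>p\<bar> \<le> n" thus ?thesis using s_mt_0[of "- p"] neg0 by (auto simp: s_uminus)
qed (simp_all add: s_unmatched)

lemma s_eq_iff: "s p = s q \<longleftrightarrow> p = q"
  by (metis s_s)

lemma s_eq_0_iff [simp]: "s p = 0 \<longleftrightarrow> p = 0"
  by (metis s_s s_0)

lemma abs_s_eq_iff: "\<bar>s p\<bar> = \<bar>s q\<bar> \<longleftrightarrow> \<bar>p\<bar> = \<bar>q\<bar>"
  using s_eq_iff[of p q] s_eq_iff[of p "- q"] by (simp add: abs_eq_iff s_uminus)

lemma cw_s: "cw (s p) = cw p"
  by (simp add: cw_def)

lemma root_flip: "root p q \<Longrightarrow> s p + s q < 0 \<Longrightarrow> root (- s p) (- s q)"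
  unfolding root_def using abs_s_le abs_s_eq_iff by auto

lemma flip_inversions: assumes "\<alpha> \<in> inversions" shows "flip \<alpha> \<in> inversions"
proof -
  obtain a b where \<alpha>: "\<alpha> = (a, b)" by force
  have r: "root a b" "s a + s b < 0" using assms by (auto simp: inversions_def \<alpha> sroots_root)
  have "0 < a + b" using r by (simp add: root_def)
  hence "s (- s a) + s (- s b) < 0" by (simp add: s_uminus)
  moreover have "flip \<alpha> \<in> sroots short n"
    using nrm_sroots root_flip r by (simp add: flip_def \<alpha>)
  ultimately show ?thesis by (auto simp: inversions_def flip_def nrm_def \<alpha>)
qed

lemma flip_flip: assumes "\<alpha> \<in> sroots short n" shows "flip (flip \<alpha>) = \<alpha>"
proof -
  obtain a b where \<alpha>: "\<alpha> = (a, b)" by force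
  thus ?thesis using assms by (auto simp: flip_def nrm_def s_uminus sroots_def)
qed

lemma gw_flip: "gw (flip \<alpha>) = - gw \<alpha>"
  by (auto simp: gw_def flip_def nrm_def cw_uminus cw_s)

text \<open>This is where genericity of the weights enters: four weights cancel only in pairs, which
  forces s to negate the root in a way that only members of D allow.\<close>

lemma gw_eq_0_iff: assumes "\<alpha> \<in> sroots short n" shows "gw \<alpha> = 0 \<longleftrightarrow> \<alpha> \<in> D"
proof
  assume "\<alpha> \<in> D"
  thus "gw \<alpha> = 0" using cw_mt_add[of "fst \<alpha>" "snd \<alpha>"] by (auto simp: gw_def mt_def)
next
  assume g: "gw \<alpha> = 0"
  obtain a b where \<alpha>: "\<alpha> = (a, b)" by force
  have ab: "\<bar>b\<bar> < a" using assms by (auto simp: \<alpha> sroots_def)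
  have "weight a + weight b + weight (s a) + weight (s b) = 0"
    using g by (simp add: gw_def cw_def \<alpha>)
  \<comment> \<open>The third pairing would need a = -b, against |b| < a.\<close>
  then consider "s a = - a" "s b = - b" | "s a = - b"
    using weight_four_zero ab by fastforce
  thus "\<alpha> \<in> D"
  proof cases
    case 1
    have *: "mt p 0 \<or> mt (- p) 0" if "s p = - p" "p \<noteq> 0" for p
    proof (cases p rule: status_cases)
      case unmatched thus ?thesis using s_unmatched that by auto
    next
      case (pos r) thus ?thesis using s_mt[of p r] mt_D[of p r] that by auto
    next
      case (neg r) thus ?thesis using s_mt[of "- p" r] mt_D[of "- p" r] that by (auto simp: s_uminus)
    qed (use that in auto)
    have "a > 0" using ab by linarith
    hence a0: "mt a 0" using *[of a] 1 mt_D[of "- a" 0] by auto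
    \<comment> \<open>Otherwise 0 would have two partners, namely a and one of b and -b.\<close>
    have "b = 0"
    proof (rule ccontr)
      assume "b \<noteq> 0"
      hence "mt 0 b \<or> mt 0 (- b)" using *[of b] 1 mt_sym[of 0] by simp
      hence "b = a \<or> - b = a" using mt_unique[of 0 _ a] a0 mt_sym[of 0 a] by blast
      thus False using ab by linarith
    qed
    thus ?thesis using a0 D_D[of 0 a] ab by (auto simp: \<alpha> mt_def)
  next
    case 2
    show ?thesis
    proof (cases a rule: status_cases)
      case unmatched thus ?thesis using s_unmatched[of a] 2 ab by auto
    next
      case (pos r)
      hence "mt a b" using s_mt 2 by auto
      thus ?thesis using D_D[of b a] ab by (auto simp: \<alpha> mt_def)
    next
      case pos0 thus ?thesis using s_mt_0[of a] 2 ab by auto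
    next
      case (neg r) thus ?thesis using s_mt[of "- a" r] mt_D[of "- a" r] 2 ab by (auto simp: s_uminus)
    next
      case neg0 thus ?thesis using s_mt_0[of "- a"] 2 ab by (auto simp: s_uminus)
    qed (use ab in auto)
  qed
qed

lemma D_inversions: "D \<subseteq> inversions"
proof
  fix \<alpha> assume \<alpha>: "\<alpha> \<in> D"
  obtain a b where ab: "\<alpha> = (a, b)" by force
  have "s a + s b < 0"
    using s_long[of a b] s_short[of a] D_D[of a b] \<alpha> ab by (cases "b = 0") auto
  thus "\<alpha> \<in> inversions" using \<alpha> D_sub by (auto simp: inversions_def ab)
qed

text \<open>The functional is positive on positive roots, so a negative sum h + h s makes h s
  negative.\<close>

lemma lower_inversions: "lower \<subseteq> inversions"
proof
  fix \<alpha> assume \<alpha>: "\<alpha> \<in> lower"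
  obtain a b where ab: "\<alpha> = (a, b)" by force
  have "0 < weight a + weight b" "cw a + cw b < 0"
    using \<alpha> by (auto simp: lower_def ab sroots_def gw_def weight_add_pos_iff)
  hence "0 < weight (- s a) + weight (- s b)" by (simp add: cw_def)
  thus "\<alpha> \<in> inversions" using \<alpha> by (simp only: weight_add_pos_iff) (auto simp: inversions_def lower_def ab)
qed

lemma finite_inversions: "finite inversions"
  using finite_sroots by (rule rev_finite_subset) (auto simp: inversions_def)

text \<open>\<open>flip\<close> maps inversions to inversions and changes the sign of
  \<open>gw\<close>, so it carries \<open>lower\<close> onto the inversions with positive
  \<open>gw\<close>; those with \<open>gw\<close> equal to 0 form D.\<close>

lemma card_inversions: "card inversions = 2 * card lower + card D"
proof -
  have eq: "inversions = lower \<union> flip ` lower \<union> D"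
  proof
    show "inversions \<subseteq> lower \<union> flip ` lower \<union> D"
    proof
      fix \<alpha> assume \<alpha>: "\<alpha> \<in> inversions"
      hence P: "\<alpha> \<in> sroots short n" "flip \<alpha> \<in> sroots short n"
        using flip_inversions[OF \<alpha>] by (auto simp: inversions_def)
      consider "gw \<alpha> < 0" | "gw \<alpha> = 0" | "gw (flip \<alpha>) < 0"
        unfolding gw_flip by linarith
      thus "\<alpha> \<in> lower \<union> flip ` lower \<union> D"
      proof cases
        case 1 thus ?thesis using P by (auto simp: lower_def)
      next
        case 2 thus ?thesis using P gw_eq_0_iff by auto
      next
        case 3
        hence "flip (flip \<alpha>) \<in> flip ` lower" using P by (intro imageI) (auto simp: lower_def)
        thus ?thesis using flip_flip P by simp
      qed
    qed
  qed (use lower_inversions D_inversions flip_inversions in auto)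
  have dis: "lower \<inter> flip ` lower = {}" "(lower \<union> flip ` lower) \<inter> D = {}"
  proof -
    have "gw \<alpha> = 0" if "\<alpha> \<in> D" for \<alpha> using that gw_eq_0_iff D_sub by blast
    moreover have "gw \<alpha> \<noteq> 0" if "\<alpha> \<in> lower \<union> flip ` lower" for \<alpha>
      using that by (auto simp: lower_def gw_flip)
    ultimately show "(lower \<union> flip ` lower) \<inter> D = {}" by blast
  qed (auto simp: lower_def gw_flip)
  have inj: "inj_on flip lower"
    by (rule inj_on_inverseI[of _ flip]) (auto simp: lower_def flip_flip)
  have fin: "finite lower" "finite D"
    using finite_inversions lower_inversions D_inversions finite_subset by blast+
  show ?thesis
    unfolding eq using fin dis inj by (simp add: card_Un_disjoint card_image)
qed

section \<open>Isolated roots and the size of the kernel\<close>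

lemma D_isolated:
  assumes "(a, b) \<in> D" "root c d" shows "\<not> adj (a, b) (c, d)"
proof
  assume "adj (a, b) (c, d)"
  moreover have "mt a b" "mt b a" using assms by (auto simp: mt_def)
  hence "mt a x \<Longrightarrow> x = b" "mt b x \<Longrightarrow> x = a" for x using mt_unique by blast+
  ultimately show False using assms(2) by (auto simp: root_def)
qed

text \<open>The partners of a and b are 0 and r, so the only candidates for neighbours are - e_b and
  e_r - e_a, and both are negative.\<close>

lemma exceptional_isolated:
  assumes "exc a b" "root c d" shows "\<not> adj (a, b) (c, d)"
proof
  assume A: "adj (a, b) (c, d)"
  obtain r where r: "mt a 0" "mt b r" "0 < b" "b < r" "r < a" using assms by (auto simp: exc_def)
  hence *: "mt a x \<Longrightarrow> x = 0" "mt b x \<Longrightarrow> x = r" for x using mt_unique by blast+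
  have "0 < c + d" using assms(2) by (simp add: root_def)
  moreover from A consider "mt a c" "d = - b" | "mt a d" "c = - b" | "mt b c" "d = - a" | "mt b d" "c = - a"
    by auto
  hence "c + d = - b \<or> c + d = r - a"
    by cases (auto dest: *)
  ultimately show False using r by linarith
qed

lemma exceptional_lower: "exceptional \<subseteq> lower"
proof
  fix \<alpha> assume \<alpha>: "\<alpha> \<in> exceptional"
  obtain a b where ab: "\<alpha> = (a, b)" by force
  obtain r where r: "mt a 0" "mt b r" "0 < b" "b < r" "r < a"
    using \<alpha> by (auto simp: exc_def exceptional_def ab)
  hence "cw a = 0" "cw b = weight b - weight r" using cw_mt_0 cw_mt by auto
  thus "\<alpha> \<in> lower" using r \<alpha> by (auto simp: lower_def exceptional_def ab gw_def)
qed

text \<open>D contains at most one short root e_a, and replacing r by a turns the roots e_r + e_b in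
  D with 0 < b and r < a into the exceptional ones.\<close>

lemma card_exceptional:
  "card exceptional = card {\<beta> \<in> D. 0 < snd \<beta> \<and> (\<exists>a. (a, 0) \<in> D \<and> fst \<beta> < a)}" (is "_ = card ?S")
proof (cases "\<exists>a. (a, 0) \<in> D")
  case True
  then obtain a where a: "(a, 0) \<in> D" by auto
  have uniq: "a' = a" if "(a', 0) \<in> D" for a' using D_disj[OF a that] by simp
  have "exceptional = (\<lambda>\<beta>. (a, snd \<beta>)) ` ?S"
  proof
    show "exceptional \<subseteq> (\<lambda>\<beta>. (a, snd \<beta>)) ` ?S"
    proof
      fix \<alpha> assume \<alpha>: "\<alpha> \<in> exceptional"
      obtain c b where cb: "\<alpha> = (c, b)" by force
      obtain r where r: "mt c 0" "mt b r" "0 < b" "b < r" "r < c"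
        using \<alpha> by (auto simp: exc_def exceptional_def cb)
      have "c = a" using r uniq[of c] D_D[of 0 c] by (auto simp: mt_def)
      moreover have "(r, b) \<in> D" using r D_D[of b r] by (auto simp: mt_def)
      ultimately show "\<alpha> \<in> (\<lambda>\<beta>. (a, snd \<beta>)) ` ?S" 
        using a r cb by (intro image_eqI[of _ _ "(r, b)"]) auto
    qed
    show "(\<lambda>\<beta>. (a, snd \<beta>)) ` ?S \<subseteq> exceptional"
    proof (rule image_subsetI)
      fix \<beta> assume \<beta>: "\<beta> \<in> ?S"
      obtain r b where rb: "\<beta> = (r, b)" by force
      have "(r, b) \<in> D" "0 < b" "r < a" using \<beta> uniq rb by auto
      thus "(a, snd \<beta>) \<in> exceptional"
        using a rb D_D[of r b] D_D[of a 0] unfolding exceptional_def exc_def mt_def sroots_def by auto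
    qed
  qed
  moreover have "inj_on (\<lambda>\<beta>. (a, snd \<beta>)) ?S"
  proof (rule inj_onI)
    fix \<beta> \<gamma> assume "\<beta> \<in> ?S" "\<gamma> \<in> ?S" "(a, snd \<beta>) = (a, snd \<gamma>)"
    thus "\<beta> = \<gamma>" using D_disj[of "fst \<beta>" "snd \<beta>" "fst \<gamma>" "snd \<gamma>"] by (cases \<beta>; cases \<gamma>) auto
  qed
  ultimately show ?thesis by (simp add: card_image)
next
  case False
  have "exceptional = {}"
  proof (rule ccontr)
    assume "exceptional \<noteq> {}"
    then obtain c b where "exc c b" by (auto simp: exceptional_def)
    hence "mt c 0" by (auto simp: exc_def)
    thus False using False D_D[of 0 c] by (auto simp: mt_def)
  qed
  thus ?thesis using False by simp
qed

text \<open>Elimination with height 0 for short and 1 for long roots, in agreement with the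
  exemption in \<open>pivot\<close>. Roots with an edge have nonzero \<open>gw\<close> and are not
  exceptional, and adjacent roots have opposite \<open>gw\<close>, so each edge has exactly one end
  in \<open>lower - exceptional\<close>.\<close>

lemma card_kernel_lower:
  fixes B :: "int \<times> int \<Rightarrow> int \<times> int \<Rightarrow> 'q::{field,finite}"
  assumes B: "\<And>\<alpha> \<gamma>. \<alpha> \<in> sroots short n \<Longrightarrow> \<gamma> \<in> sroots short n \<Longrightarrow> B \<alpha> \<gamma> \<noteq> 0 \<longleftrightarrow> adj \<alpha> \<gamma>"
  shows "card (coeff_kernel (sroots short n) B) * CARD('q) ^ (2 * card (lower - exceptional))
    = CARD('q) ^ card (sroots short n)"
proof (rule card_coeff_kernel_triangular)
  let ?P = "sroots short n"
  show "finite ?P" by (rule finite_sroots)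
  show "lower - exceptional \<subseteq> ?P" by (auto simp: lower_def)
  show "B x y = 0 \<longleftrightarrow> B y x = 0" if "x \<in> ?P" "y \<in> ?P" for x y
    using B[OF that] B[OF that(2,1)] adj_sym by blast
  have half: "gw x \<noteq> 0 \<and> x \<notin> exceptional" if "x \<in> ?P" "y \<in> ?P" "adj x y" for x y
  proof -
    have "root (fst y) (snd y)" using that(2) sroots_root by simp
    hence "x \<notin> D" "x \<notin> exceptional"
      using D_isolated[of "fst x" "snd x" "fst y" "snd y"] that(3)
            exceptional_isolated[of "fst x" "snd x" "fst y" "snd y"] by (auto simp: exceptional_def)
    thus ?thesis using gw_eq_0_iff[OF that(1)] by simp
  qed
  show "(x \<in> lower - exceptional) \<noteq> (y \<in> lower - exceptional)"
    if "x \<in> ?P" "y \<in> ?P" "B x y \<noteq> 0" for x y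
  proof -
    have adj: "adj x y" "adj y x" using B that adj_sym by blast+
    have "gw x + gw y = 0"
      using cw_adj[of "fst x" "snd x" "fst y" "snd y"] adj by (simp add: gw_def)
    thus ?thesis using half[OF that(1,2) adj(1)] half[OF that(2,1) adj(2)] that by (auto simp: lower_def)
  qed
  fix u assume u: "u \<in> lower - exceptional"
  obtain p q where pq: "u = (p, q)" by force
  have uP: "(p, q) \<in> ?P" "\<bar>q\<bar> < p" using u by (auto simp: lower_def pq sroots_def)
  have "\<not> exc p q" "\<not> exc q p" using u uP by (auto simp: exceptional_def pq exc_def)
  moreover have "cw p + cw q < 0" using u by (simp add: lower_def pq gw_def)
  ultimately obtain p' q' where piv: "pivot p q p' q'"
    using pivot_ex sroots_root uP by blast
  let ?x = "nrm p' q'"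
  have x: "?x \<in> ?P" using piv nrm_sroots by (simp add: pivot_def)
  have adjx: "adj \<alpha> ?x \<longleftrightarrow> adj \<alpha> (p', q')" for \<alpha>
    using adj_swap2[of \<alpha> p' q'] by (simp add: nrm_def)
  have "B u ?x \<noteq> 0" using B x uP piv adjx by (simp add: pq pivot_def)
  moreover have "(if snd u' = 0 then 0 else 1) < (if snd u = 0 then 0 else 1::nat)"
    if "u' \<in> ?P" "B u' ?x \<noteq> 0" "u' \<noteq> u" for u'
  proof -
    obtain c d where cd: "u' = (c, d)" by force
    have "adj (c, d) (p', q')" using that B x adjx cd by auto
    moreover have "root c d" "\<bar>d\<bar> < c" using that sroots_root cd by (auto simp: sroots_def)
    ultimately have "c = p \<and> d = q \<or> c = q \<and> d = p \<or> (c = 0 \<or> d = 0) \<and> p \<noteq> 0 \<and> q \<noteq> 0"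
      using piv unfolding pivot_def by blast
    thus ?thesis using \<open>\<bar>d\<bar> < c\<close> uP that(3) by (auto simp: cd pq)
  qed
  ultimately show "\<exists>x\<in>?P. B u x \<noteq> 0 \<and> (\<forall>u'\<in>?P. B u' x \<noteq> 0 \<longrightarrow> u' \<noteq> u \<longrightarrow>
      (if snd u' = 0 then 0 else 1) < (if snd u = 0 then 0 else 1::nat))"
    using x by blast
qed

text \<open>The exponent k is the rank, twice the size of \<open>lower - exceptional\<close>. The
  equations avoid subtraction and division of natural numbers.\<close>

lemma card_kernel:
  fixes B :: "int \<times> int \<Rightarrow> int \<times> int \<Rightarrow> 'q::{field,finite}"
  assumes B: "\<And>\<alpha> \<gamma>. \<alpha> \<in> sroots short n \<Longrightarrow> \<gamma> \<in> sroots short n \<Longrightarrow> B \<alpha> \<gamma> \<noteq> 0 \<longleftrightarrow> adj \<alpha> \<gamma>"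
  defines "d \<equiv> card {\<beta> \<in> D. 0 < snd \<beta> \<and> (\<exists>a. (a, 0) \<in> D \<and> fst \<beta> < a)}"
  shows "\<exists>k. card (coeff_kernel (sroots short n) B) * CARD('q) ^ k = CARD('q) ^ card (sroots short n)
    \<and> k + card D + 2 * d = card inversions"
proof -
  have fin: "finite lower" using finite_inversions lower_inversions by (rule rev_finite_subset)
  hence "finite exceptional" using exceptional_lower by (rule rev_finite_subset)
  hence "card (lower - exceptional) = card lower - d"
    using exceptional_lower card_exceptional by (simp add: d_def card_Diff_subset)
  moreover have "d \<le> card lower"
    using card_mono[OF fin exceptional_lower] card_exceptional by (simp add: d_def)
  ultimately have "2 * card (lower - exceptional) + card D + 2 * d = card inversions"
    using card_inversions by simp
  thus ?thesis using card_kernel_lower[OF B] by blast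
qed

end

section \<open>Signed permutations and their inversions\<close>

text \<open>The hyperoctahedral group, extended by the identity beyond n so that its elements are
  total functions closed under composition.\<close>

definition sperm :: "nat \<Rightarrow> (int \<Rightarrow> int) \<Rightarrow> bool" where
  "sperm n s \<longleftrightarrow> (\<forall>p. s (- p) = - s p) \<and> inj s \<and> (\<forall>p. \<bar>p\<bar> \<le> int n \<longrightarrow> \<bar>s p\<bar> \<le> int n) \<and>
     (\<forall>p. int n < \<bar>p\<bar> \<longrightarrow> s p = p)"

definition signs :: "nat \<Rightarrow> (int \<Rightarrow> int) \<Rightarrow> int" where
  "signs n s = (\<Prod>a\<in>{1..int n}. sgn (s a))"

text \<open>Type D consists of the signed permutations with an even number of sign changes.\<close>

definition weyl :: "bool \<Rightarrow> nat \<Rightarrow> (int \<Rightarrow> int) \<Rightarrow> bool" where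
  "weyl short n s \<longleftrightarrow> sperm n s \<and> (short \<or> signs n s = 1)"

text \<open>The vector e_{s a} + e_{s b} is a negative root exactly if the sum of its labels is
  negative.\<close>

definition ninv :: "bool \<Rightarrow> nat \<Rightarrow> (int \<Rightarrow> int) \<Rightarrow> nat" where
  "ninv short n s = card {\<alpha> \<in> sroots short (int n). s (fst \<alpha>) + s (snd \<alpha>) < 0}"

definition sref :: "int \<times> int \<Rightarrow> int \<Rightarrow> int" where
  "sref \<alpha> p = (let (a, b) = \<alpha> in
     if b = 0 then (if \<bar>p\<bar> = a then - p else p)
     else if p = a then - b else if p = - a then b else if p = b then - a else if p = - b then a else p)"

text \<open>In the reversed numbering \<epsilon>_n is e_1, so the special simple root is e_1 for
  type B and e_2 + e_1 for type D.\<close>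

definition simples :: "bool \<Rightarrow> nat \<Rightarrow> (int \<times> int) set" where
  "simples short n = {(a, 1 - a) | a. 2 \<le> a \<and> a \<le> int n} \<union> (if short then {(1, 0)} else {(2, 1)})"

text \<open>The composition is reversed because permutations act on coordinates contravariantly;
  \<open>act\<close> then turns \<open>wperm\<close> into the product of the word in its given
  order.\<close>

fun wperm :: "(int \<times> int) list \<Rightarrow> int \<Rightarrow> int" where
  "wperm [] = id"
| "wperm (\<alpha> # \<alpha>s) = wperm \<alpha>s \<circ> sref \<alpha>"

section \<open>Signed permutations and their generation by simple reflections\<close>

lemma sperm_uminus: "sperm n s \<Longrightarrow> s (- p) = - s p"
  by (simp add: sperm_def)

lemma sperm_eq_iff: "sperm n s \<Longrightarrow> s p = s q \<longleftrightarrow> p = q"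
  unfolding sperm_def by (metis injD)

lemma sperm_0: "sperm n s \<Longrightarrow> s 0 = 0"
  using sperm_uminus[of n s 0] by simp

lemma sperm_eq_0_iff: "sperm n s \<Longrightarrow> s p = 0 \<longleftrightarrow> p = 0"
  using sperm_0 sperm_eq_iff by metis

lemma sperm_abs_eq_iff: "sperm n s \<Longrightarrow> \<bar>s p\<bar> = \<bar>s q\<bar> \<longleftrightarrow> \<bar>p\<bar> = \<bar>q\<bar>"
  using sperm_eq_iff[of n s p q] sperm_eq_iff[of n s p "- q"] sperm_uminus[of n s q]
  by (simp add: abs_eq_iff)

lemma sperm_abs_le: "sperm n s \<Longrightarrow> \<bar>p\<bar> \<le> int n \<Longrightarrow> \<bar>s p\<bar> \<le> int n"
  by (simp add: sperm_def)

lemma sperm_id: "sperm n id"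
  by (simp add: sperm_def)

lemma sperm_comp: "sperm n s \<Longrightarrow> sperm n t \<Longrightarrow> sperm n (s \<circ> t)"
  by (auto simp: sperm_def intro: inj_compose)

lemma sref_sref: "\<bar>snd \<alpha>\<bar> < fst \<alpha> \<Longrightarrow> sref \<alpha> (sref \<alpha> p) = p"
  by (cases \<alpha>) (auto simp: sref_def)

lemma sperm_sref: assumes "\<alpha> \<in> sroots short (int n)" shows "sperm n (sref \<alpha>)"
proof -
  obtain a b where ab: "\<alpha> = (a, b)" "\<bar>b\<bar> < a" "a \<le> int n" using assms by (auto simp: sroots_def)
  have "inj (sref \<alpha>)" using sref_sref[of \<alpha>] ab by (metis fst_conv snd_conv injI)
  moreover have "sref \<alpha> (- p) = - sref \<alpha> p" for p using ab(2) by (auto simp: ab(1) sref_def)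
  moreover have "\<bar>sref \<alpha> p\<bar> \<le> int n" if "\<bar>p\<bar> \<le> int n" for p
    using ab(2,3) that by (auto simp: ab(1) sref_def)
  moreover have "sref \<alpha> p = p" if "int n < \<bar>p\<bar>" for p
    using ab(2,3) that by (auto simp: ab(1) sref_def)
  ultimately show ?thesis by (simp add: sperm_def)
qed

lemma signs_comp: assumes s: "sperm n s" and t: "sperm n t" shows "signs n (s \<circ> t) = signs n s * signs n t"
proof -
  have inj: "inj_on (\<lambda>a. \<bar>t a\<bar>) {1..int n}"
    using sperm_abs_eq_iff[OF t] by (auto intro!: inj_onI)
  have "\<bar>t a\<bar> \<in> {1..int n}" if "a \<in> {1..int n}" for a
    using sperm_abs_le[OF t, of a] sperm_eq_0_iff[OF t, of a] that by auto
  hence img: "(\<lambda>a. \<bar>t a\<bar>) ` {1..int n} = {1..int n}"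
    by (intro endo_inj_surj inj) auto
  \<comment> \<open>Once the sign of \<open>t a\<close> is split off, the absolute values |t a| run
    through 1, ..., n again, so the remaining product can be reindexed.\<close>
  have "sgn (s (t a)) = sgn (s \<bar>t a\<bar>) * sgn (t a)" if "a \<in> {1..int n}" for a
  proof (cases "t a > 0")
    case False
    have "t a \<noteq> 0" using that sperm_eq_0_iff[OF t, of a] by auto
    hence "t a < 0" using False by simp
    thus ?thesis using sperm_uminus[OF s, of "t a"] by (simp add: sgn_minus)
  qed simp
  hence "signs n (s \<circ> t) = (\<Prod>a\<in>{1..int n}. sgn (s \<bar>t a\<bar>)) * signs n t"
    by (simp add: signs_def prod.distrib[symmetric])
  also have "(\<Prod>a\<in>{1..int n}. sgn (s \<bar>t a\<bar>)) = signs n s"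
    unfolding signs_def using prod.reindex[OF inj, of "\<lambda>a. sgn (s a)"] by (simp add: img)
  finally show ?thesis .
qed

lemma signs_sref: assumes "(a, b) \<in> sroots short (int n)" "b \<noteq> 0" shows "signs n (sref (a, b)) = 1"
proof (cases "b > 0")
  case False
  have "sgn (sref (a, b) p) = 1" if "p \<in> {1..int n}" for p
    using assms that False by (auto simp: sref_def sroots_def)
  thus ?thesis by (simp add: signs_def)
next
  case True
  have "signs n (sref (a, b)) = (\<Prod>p\<in>{a, b}. sgn (sref (a, b) p))"
    unfolding signs_def using assms True
    by (intro prod.mono_neutral_right) (auto simp: sref_def sroots_def)
  also have "\<dots> = 1" using assms True by (auto simp: sref_def sroots_def)
  finally show ?thesis .
qed

lemma weyl_id: "weyl short n id"
  by (simp add: weyl_def sperm_id signs_def)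

lemma weyl_comp: "weyl short n s \<Longrightarrow> weyl short n t \<Longrightarrow> weyl short n (s \<circ> t)"
  by (auto simp: weyl_def sperm_comp signs_comp)

lemma weyl_sref: "\<alpha> \<in> sroots short (int n) \<Longrightarrow> weyl short n (sref \<alpha>)"
  using sperm_sref[of \<alpha> short n] signs_sref[of "fst \<alpha>" "snd \<alpha>" short n]
  by (auto simp: weyl_def sroots_def)

lemma weyl_wperm: "set \<alpha>s \<subseteq> sroots short (int n) \<Longrightarrow> weyl short n (wperm \<alpha>s)"
  by (induction \<alpha>s) (auto intro: weyl_comp weyl_sref weyl_id)

lemma simples_sroots: "n \<ge> 1 \<Longrightarrow> (\<not> short \<Longrightarrow> n \<ge> 2) \<Longrightarrow> simples short n \<subseteq> sroots short (int n)"
  by (auto simp: simples_def sroots_def)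

text \<open>The standard fact that a simple reflection permutes the positive roots other than its
  own; the comparison of inversions below rests on it.\<close>

lemma sref_simple_sroots:
  assumes "\<alpha> \<in> simples short n" "(c, d) \<in> sroots short (int n)" "(c, d) \<noteq> \<alpha>"
  shows "nrm (sref \<alpha> c) (sref \<alpha> d) \<in> sroots short (int n) - {\<alpha>}"
proof -
  have cd: "\<bar>d\<bar> < c" "c \<le> int n" "short \<or> d \<noteq> 0" using assms(2) by (auto simp: sroots_def)
  consider "short" "\<alpha> = (1, 0)" | "\<not> short" "\<alpha> = (2, 1)"
    | a where "\<alpha> = (a, 1 - a)" "2 \<le> a" "a \<le> int n"
    using assms(1) by (auto simp: simples_def split: if_splits)
  thus ?thesis
  proof cases
    case 1
    have "sref \<alpha> c = c" "sref \<alpha> d = (if \<bar>d\<bar> = 1 then - d else d)"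
      using assms(3) cd 1 by (auto simp: sref_def)
    thus ?thesis using cd 1 assms(3) by (auto simp: sroots_def nrm_def)
  next
    case 2
    show ?thesis
    proof (cases "c = 2")
      case True
      hence "d = - 1" using cd 2 assms(3) by auto
      thus ?thesis using True cd 2 by (simp add: sroots_def nrm_def sref_def)
    next
      case False
      hence c: "3 \<le> c" "sref \<alpha> c = c" using cd 2 by (auto simp: sref_def)
      have "\<bar>sref \<alpha> d\<bar> < c" "sref \<alpha> d = 0 \<longleftrightarrow> d = 0" using c cd 2 by (auto simp: sref_def)
      thus ?thesis using c cd 2 by (auto simp: sroots_def nrm_def)
    qed
  next
    case 3
    have sr: "sref (a, 1 - a) p = (if p = a then a - 1 else if p = - a then 1 - a else if p = a - 1 then a
        else if p = 1 - a then - a else p)" for p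
      using 3 by (auto simp: sref_def)
    have d0: "sref (a, 1 - a) d = 0 \<longleftrightarrow> d = 0" using 3(2) unfolding sr by auto
    consider "c = a" | "c = a - 1" | "c < a - 1" | "a < c" by linarith
    thus ?thesis
    proof cases
      case c: 1
      show ?thesis
      proof (cases "d = a - 1")
        case True
        thus ?thesis using c cd 3 by (simp add: sr sroots_def nrm_def)
      next
        case False
        hence "\<bar>d\<bar> < a - 1" using c cd assms(3) 3 by auto
        hence "sref (a, 1 - a) d = d" "sref (a, 1 - a) c = a - 1" using 3 c by (auto simp: sr)
        thus ?thesis using \<open>\<bar>d\<bar> < a - 1\<close> cd 3 by (auto simp: sroots_def nrm_def)
      qed
    next
      case c: 2
      hence "sref (a, 1 - a) d = d" "sref (a, 1 - a) c = a" using 3 cd by (auto simp: sr)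
      thus ?thesis using c cd 3 by (auto simp: sroots_def nrm_def)
    next
      case c: 3
      hence "sref (a, 1 - a) d = d" "sref (a, 1 - a) c = c" using 3 cd by (auto simp: sr)
      thus ?thesis using c cd 3 by (auto simp: sroots_def nrm_def)
    next
      case c: 4
      hence "sref (a, 1 - a) c = c" "\<bar>sref (a, 1 - a) d\<bar> < c" using 3 cd by (auto simp: sr)
      thus ?thesis using c cd 3 d0 by (auto simp: sroots_def nrm_def)
    qed
  qed
qed

text \<open>The reflection permutes the other positive roots, so away from \<open>\<alpha>\<close>
  the inversions of both maps correspond, and on \<open>\<alpha>\<close> the value changes sign. The
  first claim yields reduced words, the second their minimality.\<close>

lemma ninv_comp_simple:
  assumes \<alpha>: "\<alpha> \<in> simples short n" and n: "n \<ge> 1" "\<not> short \<Longrightarrow> n \<ge> 2" and s: "sperm n s"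
  shows "s (fst \<alpha>) + s (snd \<alpha>) < 0 \<Longrightarrow> Suc (ninv short n (s \<circ> sref \<alpha>)) = ninv short n s"
    and "ninv short n (s \<circ> sref \<alpha>) \<le> Suc (ninv short n s)"
proof -
  let ?P = "sroots short (int n)"
  obtain a b where ab: "\<alpha> = (a, b)" by force
  have \<alpha>P: "(a, b) \<in> ?P" using simples_sroots[OF n] \<alpha> ab by blast
  define \<phi> where "\<phi> \<gamma> = nrm (sref \<alpha> (fst \<gamma>)) (sref \<alpha> (snd \<gamma>))" for \<gamma>
  define N where "N s = {\<gamma> \<in> ?P - {\<alpha>}. s (fst \<gamma>) + s (snd \<gamma>) < 0}" for s :: "int \<Rightarrow> int"
  have finN: "finite (N s)" for s using finite_sroots by (auto simp: N_def)
  have \<phi>P: "\<phi> \<gamma> \<in> ?P - {\<alpha>}" if "\<gamma> \<in> ?P - {\<alpha>}" for \<gamma>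
    using sref_simple_sroots[OF \<alpha>, of "fst \<gamma>" "snd \<gamma>"] that by (auto simp: \<phi>_def)
  have \<phi>\<phi>: "\<phi> (\<phi> \<gamma>) = \<gamma>" if "\<gamma> \<in> ?P" for \<gamma>
    using that \<alpha>P sref_sref[of \<alpha>] by (auto simp: \<phi>_def nrm_def sroots_def ab)
  have sum: "s (fst (\<phi> \<gamma>)) + s (snd (\<phi> \<gamma>)) = s (sref \<alpha> (fst \<gamma>)) + s (sref \<alpha> (snd \<gamma>))"
    for \<gamma> and s :: "int \<Rightarrow> int"
    by (auto simp: \<phi>_def nrm_def add.commute)
  have "bij_betw \<phi> (N (s \<circ> sref \<alpha>)) (N s)"
  proof (rule bij_betw_byWitness[where f' = \<phi>])
    have "s (sref \<alpha> (fst (\<phi> \<gamma>))) + s (sref \<alpha> (snd (\<phi> \<gamma>))) = s (fst \<gamma>) + s (snd \<gamma>)"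
      if "\<gamma> \<in> ?P" for \<gamma> using sum[of s "\<phi> \<gamma>"] \<phi>\<phi>[OF that] by simp
    hence "\<phi> \<gamma> \<in> N (s \<circ> sref \<alpha>)" if "\<gamma> \<in> N s" for \<gamma>
      using \<phi>P[of \<gamma>] that unfolding N_def by simp
    thus "\<phi> ` N s \<subseteq> N (s \<circ> sref \<alpha>)" by (rule image_subsetI)
    have "\<phi> \<gamma> \<in> N s" if "\<gamma> \<in> N (s \<circ> sref \<alpha>)" for \<gamma>
      using \<phi>P[of \<gamma>] sum[of s \<gamma>] that unfolding N_def by simp
    thus "\<phi> ` N (s \<circ> sref \<alpha>) \<subseteq> N s" by (rule image_subsetI)
  qed (auto simp: N_def \<phi>\<phi>)
  hence eq: "card (N (s \<circ> sref \<alpha>)) = card (N s)" by (rule bij_betw_same_card)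
  have ninv: "ninv short n f = (if f a + f b < 0 then Suc (card (N f)) else card (N f))" for f
  proof -
    have "{\<gamma> \<in> ?P. f (fst \<gamma>) + f (snd \<gamma>) < 0} = (if f a + f b < 0 then insert \<alpha> (N f) else N f)"
      using \<alpha>P by (auto simp: N_def ab)
    moreover have "\<alpha> \<notin> N f" by (simp add: N_def)
    ultimately show ?thesis using finN by (simp add: ninv_def)
  qed
  have neg: "(s \<circ> sref \<alpha>) a + (s \<circ> sref \<alpha>) b = - (s a + s b)"
    using \<alpha>P sperm_uminus[OF s] sperm_0[OF s] by (auto simp: ab sref_def sroots_def)
  show "s (fst \<alpha>) + s (snd \<alpha>) < 0 \<Longrightarrow> Suc (ninv short n (s \<circ> sref \<alpha>)) = ninv short n s"
    unfolding ninv neg eq by (simp add: ab)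
  show "ninv short n (s \<circ> sref \<alpha>) \<le> Suc (ninv short n s)"
    unfolding ninv neg eq by simp
qed

text \<open>Nonnegativity on simple roots makes s strictly increasing on 1, ..., n with values at
  most n, so only the lower end must be pinned down. For type B this is s 1 > 0; for type D one gets
  2 \<le> s 2, and s 1 = -1 is excluded by the parity of sign changes.\<close>

lemma weyl_dominant_id:
  assumes s: "weyl short n s" and n: "n \<ge> 1" "\<not> short \<Longrightarrow> n \<ge> 2"
    and dom: "\<And>a b. (a, b) \<in> simples short n \<Longrightarrow> 0 \<le> s a + s b"
  shows "s = id"
proof -
  have sp: "sperm n s" using s by (simp add: weyl_def)
  have pos: "0 < s a + s b" if "(a, b) \<in> simples short n" for a b
  proof -
    have "\<bar>a\<bar> \<noteq> \<bar>b\<bar>" using that by (auto simp: simples_def split: if_splits)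
    hence "\<bar>s a\<bar> \<noteq> \<bar>s b\<bar>" using sperm_abs_eq_iff[OF sp] by simp
    thus ?thesis using dom[OF that] by linarith
  qed
  have step: "s (a - 1) < s a" if "2 \<le> a" "a \<le> int n" for a
  proof -
    have "(a, 1 - a) \<in> simples short n" using that by (auto simp: simples_def)
    from pos[OF this] show ?thesis using sperm_uminus[OF sp, of "a - 1"] by simp
  qed
  have incr: "s a + (b - a) \<le> s b" if "1 \<le> a" "a \<le> b" "b \<le> int n" for a b
    using that(2,3)
  proof (induction b rule: int_ge_induct)
    case (step b)
    thus ?case using \<open>\<And>a. 2 \<le> a \<Longrightarrow> a \<le> int n \<Longrightarrow> s (a - 1) < s a\<close>[of "b + 1"] that(1) by simp
  qed simp
  have sn: "s (int n) \<le> int n" using sperm_abs_le[OF sp, of "int n"] by simp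
  have pid: "s a = a" if "1 \<le> a" "a \<le> int n" for a
  proof (cases short)
    case True
    hence "0 < s 1" using pos[of 1 0] sperm_0[OF sp] by (simp add: simples_def)
    thus ?thesis using incr[of 1 a] incr[of a "int n"] that sn by simp
  next
    case False
    have n2: "2 \<le> int n" using n(2)[OF False] by simp
    have "0 < s 2 + s 1" using pos[of 2 1] False by (simp add: simples_def)
    moreover have "s 1 < s 2" using step[of 2] n2 by simp
    moreover have "s 1 \<noteq> 0" using sperm_eq_0_iff[OF sp] by simp
    ultimately have s2: "2 \<le> s 2" by linarith
    have big: "s a = a" if "2 \<le> a" "a \<le> int n" for a
      using incr[of 2 a] incr[of a "int n"] that sn s2 by simp
    have "s 1 = 1 \<or> s 1 = - 1"
      using \<open>0 < s 2 + s 1\<close> \<open>s 1 < s 2\<close> \<open>s 1 \<noteq> 0\<close> big[of 2] n2 by linarith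
    moreover have "s 1 \<noteq> - 1"
    proof
      assume s1: "s 1 = - 1"
      have "signs n s = (\<Prod>a\<in>{1}. sgn (s a))"
        unfolding signs_def using n2 big by (intro prod.mono_neutral_right) auto
      thus False using s False s1 by (simp add: weyl_def)
    qed
    ultimately show ?thesis using big[of a] that by (cases "a = 1") auto
  qed
  show "s = id"
  proof
    fix p
    consider "int n < \<bar>p\<bar>" | "p = 0" | "1 \<le> p" "p \<le> int n" | "1 \<le> - p" "- p \<le> int n" by linarith
    thus "s p = id p"
    proof cases
      case 1 thus ?thesis using sp by (simp add: sperm_def)
    next
      case 2 thus ?thesis using sperm_0[OF sp] by simp
    next
      case 3 thus ?thesis using pid by simp
    next
      case 4 thus ?thesis using pid[of "- p"] sperm_uminus[OF sp, of p] by simp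
    qed
  qed
qed

lemma ninv_wperm_le:
  assumes n: "n \<ge> 1" "\<not> short \<Longrightarrow> n \<ge> 2" and "set \<alpha>s \<subseteq> simples short n"
  shows "ninv short n (wperm \<alpha>s) \<le> length \<alpha>s"
  using assms(3)
proof (induction \<alpha>s)
  case Nil
  have "{\<alpha> \<in> sroots short (int n). id (fst \<alpha>) + id (snd \<alpha>) < 0} = {}"
    by (auto simp: sroots_def)
  thus ?case by (simp only: ninv_def wperm.simps card.empty)
next
  case (Cons \<alpha> \<alpha>s)
  have "sperm n (wperm \<alpha>s)"
    using weyl_wperm[of \<alpha>s short n] simples_sroots[OF n] Cons.prems by (auto simp: weyl_def)
  hence "ninv short n (wperm (\<alpha> # \<alpha>s)) \<le> Suc (ninv short n (wperm \<alpha>s))"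
    using ninv_comp_simple(2)[of \<alpha> short n "wperm \<alpha>s"] n Cons.prems by simp
  moreover have "ninv short n (wperm \<alpha>s) \<le> length \<alpha>s" using Cons by simp
  ultimately show ?case by (simp del: wperm.simps)
qed

text \<open>A map other than the identity sends some simple root to a negative one, and composing
  with that reflection lowers \<open>ninv\<close> by one. As the reflection is an involution, it is
  put in front of the shorter word.\<close>

lemma reduced_word_exists:
  assumes n: "n \<ge> 1" "\<not> short \<Longrightarrow> n \<ge> 2" and s: "weyl short n s"
  shows "\<exists>\<alpha>s. set \<alpha>s \<subseteq> simples short n \<and> length \<alpha>s = ninv short n s \<and> wperm \<alpha>s = s"
  using s
proof (induction "ninv short n s" arbitrary: s)
  case 0
  have "0 \<le> s a + s b" if ab: "(a, b) \<in> simples short n" for a b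
  proof (rule ccontr)
    assume "\<not> ?thesis"
    thus False using ninv_comp_simple(1)[of "(a, b)" short n s] n ab 0 by (simp add: weyl_def)
  qed
  hence "s = id" using weyl_dominant_id[of short n s] 0 n by blast
  thus ?case using 0 by (intro exI[of _ "[]"]) simp
next
  case (Suc k)
  have "\<exists>a b. (a, b) \<in> simples short n \<and> s a + s b < 0"
  proof (rule ccontr)
    assume "\<not> ?thesis"
    hence "s = id" using weyl_dominant_id[of short n s] Suc.prems n by (meson not_less)
    thus False using ninv_wperm_le[of n short "[]"] n Suc.hyps by simp
  qed
  then obtain a b where ab: "(a, b) \<in> simples short n" "s a + s b < 0" by auto
  let ?s = "s \<circ> sref (a, b)"
  have P: "(a, b) \<in> sroots short (int n)" using simples_sroots[OF n] ab by blast
  have "k = ninv short n ?s"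
    using ninv_comp_simple(1)[of "(a, b)" short n s] n ab Suc by (simp add: weyl_def)
  then obtain \<alpha>s where \<alpha>s: "set \<alpha>s \<subseteq> simples short n" "length \<alpha>s = k" "wperm \<alpha>s = ?s"
    using Suc.hyps(1)[of ?s] weyl_comp[OF Suc.prems weyl_sref[OF P]] by auto
  have "wperm ((a, b) # \<alpha>s) = s"
    using sref_sref[of "(a, b)"] P by (auto simp: \<alpha>s(3) fun_eq_iff sroots_def)
  thus ?case using \<alpha>s ab Suc.hyps(2) by (intro exI[of _ "(a, b) # \<alpha>s"]) auto
qed

section \<open>Reflections as signed permutations\<close>

text \<open>The scalar product of v with e_a, hence odd in a. The label a = n + 1 - i sits at the
  0-based position i - 1 = n - a.\<close>

definition coord :: "nat \<Rightarrow> real vec \<Rightarrow> int \<Rightarrow> real" where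
  "coord n v a = (if a > 0 then v $ (n - nat a) else if a < 0 then - v $ (n - nat (- a)) else 0)"

text \<open>The action on coordinates reverses the order of composition.\<close>

definition act :: "nat \<Rightarrow> (int \<Rightarrow> int) \<Rightarrow> real vec \<Rightarrow> real vec" where
  "act n s = (\<lambda>v\<in>carrier_vec n. vec n (\<lambda>i. coord n v (s (int n - int i))))"

fun enc :: "nat \<Rightarrow> pos_root \<Rightarrow> int \<times> int" where
  "enc n (Short i) = (int n + 1 - int i, 0)"
| "enc n (Minus i j) = (int n + 1 - int i, int j - int n - 1)"
| "enc n (Plus i j) = (int n + 1 - int i, int n + 1 - int j)"

lemma coord_uminus: "coord n v (- a) = - coord n v a"
  by (simp add: coord_def)

lemma coord_act:
  assumes "sperm n s" "v \<in> carrier_vec n" "\<bar>a\<bar> \<le> int n"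
  shows "coord n (act n s v) a = coord n v (s a)"
proof -
  have *: "coord n (act n s v) a = coord n v (s a)" if "0 < a" "a \<le> int n" for a
    using that assms(2) by (simp add: coord_def[of n _ a] act_def nat_diff_distrib of_nat_diff)
  consider "0 < a" | "a = 0" | "0 < - a" by linarith
  thus ?thesis
  proof cases
    case 2 thus ?thesis using sperm_0[OF assms(1)] by (simp add: coord_def)
  next
    case 3 
    have "coord n (act n s v) (- a) = coord n v (s (- a))" using 3 assms(3) by (intro *) auto
    thus ?thesis by (simp add: coord_uminus sperm_uminus[OF assms(1)])
  qed (use * assms in auto)
qed

lemma act_carrier: "v \<in> carrier_vec n \<Longrightarrow> act n s v \<in> carrier_vec n"
  by (simp add: act_def)

lemma act_compose:
  assumes "sperm n s" "sperm n t"
  shows "compose (carrier_vec n) (act n t) (act n s) = act n (s \<circ> t)"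
proof
  fix v
  show "compose (carrier_vec n) (act n t) (act n s) v = act n (s \<circ> t) v"
  proof (cases "v \<in> carrier_vec n")
    case True
    have "act n t (act n s v) = act n (s \<circ> t) v"
    proof (rule eq_vecI)
      fix i assume "i < dim_vec (act n (s \<circ> t) v)"
      hence i: "i < n" using True by (simp add: act_def)
      have "\<bar>t (int n - int i)\<bar> \<le> int n" using sperm_abs_le[OF assms(2)] i by simp
      thus "act n t (act n s v) $ i = act n (s \<circ> t) v $ i"
        using i True act_carrier[OF True] coord_act[OF assms(1) True]
        by (simp add: act_def[of n t] act_def[of n "s \<circ> t"])
    qed (use True act_carrier[OF True] in \<open>simp add: act_def\<close>)
    thus ?thesis using True by (simp add: compose_def)
  qed (simp add: compose_def act_def)
qed

lemma act_id: "act n id = (\<lambda>v\<in>carrier_vec n. v)"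
proof
  fix v show "act n id v = (\<lambda>v\<in>carrier_vec n. v) v"
  proof (cases "v \<in> carrier_vec n")
    case True
    show ?thesis
    proof (rule eq_vecI)
      fix i assume "i < dim_vec ((\<lambda>v\<in>carrier_vec n. v) v)"
      hence "i < n" using True by simp
      moreover from this have "n - nat (int n - int i) = i" by linarith
      ultimately show "act n id v $ i = (\<lambda>v\<in>carrier_vec n. v) v $ i" 
        using True by (simp add: act_def coord_def)
    qed (use True in \<open>simp add: act_def\<close>)
  qed (simp add: act_def)
qed

lemma act_inj:
  assumes "act n s = act n t" "0 < a" "a \<le> int n" and that: "sperm n s" "sperm n t"
  shows "s a = t a"
proof -
  \<comment> \<open>A test vector whose coordinate at each label b is b itself, so the permuted
    coordinates reveal the permutation.\<close>
  define v where "v = vec n (\<lambda>i. real n - real i)"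
  have v: "v \<in> carrier_vec n" by (simp add: v_def)
  have *: "coord n v b = of_int b" if "\<bar>b\<bar> \<le> int n" for b
    using that by (auto simp: coord_def v_def of_nat_diff nat_le_iff)
  have "coord n v (s a) = coord n v (t a)"
    using coord_act[OF that(1) v, of a] coord_act[OF that(2) v, of a] assms by simp
  thus ?thesis using * sperm_abs_le[OF that(1), of a] sperm_abs_le[OF that(2), of a] assms by simp
qed

lemma ninv_act:
  assumes "act n s = act n t" "sperm n s" "sperm n t" shows "ninv short n s = ninv short n t"
proof -
  have eq: "s p = t p" if "\<bar>p\<bar> \<le> int n" for p
  proof -
    consider "0 < p" | "p = 0" | "0 < - p" by linarith
    thus ?thesis
    proof cases
      case 1 thus ?thesis using act_inj[OF assms(1) _ _ assms(2,3), of p] that by simp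
    next
      case 2 thus ?thesis using sperm_0[OF assms(2)] sperm_0[OF assms(3)] by simp
    next
      case 3 thus ?thesis
        using act_inj[OF assms(1) _ _ assms(2,3), of "- p"] that sperm_uminus[OF assms(2)]
          sperm_uminus[OF assms(3)] by simp
    qed
  qed
  have "{\<alpha> \<in> sroots short (int n). s (fst \<alpha>) + s (snd \<alpha>) < 0}
      = {\<alpha> \<in> sroots short (int n). t (fst \<alpha>) + t (snd \<alpha>) < 0}"
    by (intro Collect_cong conj_cong refl) (auto simp: sroots_def eq)
  thus ?thesis by (simp add: ninv_def)
qed

lemma word_prod_act:
  assumes "set \<alpha>s \<subseteq> sroots short (int n)"
  shows "word_prod n (map (\<lambda>\<alpha>. act n (sref \<alpha>)) \<alpha>s) = act n (wperm \<alpha>s)"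
  using assms
proof (induction \<alpha>s)
  case Nil show ?case using act_id[of n] by (simp add: word_prod_def id_def)
next
  case (Cons \<alpha> \<alpha>s)
  have "sperm n (wperm \<alpha>s)" "sperm n (sref \<alpha>)"
    using weyl_wperm[of \<alpha>s] sperm_sref[of \<alpha>] Cons.prems by (auto simp: weyl_def)
  hence comp: "compose (carrier_vec n) (act n (sref \<alpha>)) (act n (wperm \<alpha>s)) = act n (wperm \<alpha>s \<circ> sref \<alpha>)"
    by (rule act_compose)
  have IH: "word_prod n (map (\<lambda>\<alpha>. act n (sref \<alpha>)) \<alpha>s) = act n (wperm \<alpha>s)"
    using Cons by simp
  have "word_prod n (map (\<lambda>\<alpha>. act n (sref \<alpha>)) (\<alpha> # \<alpha>s))
      = compose (carrier_vec n) (act n (sref \<alpha>)) (word_prod n (map (\<lambda>\<alpha>. act n (sref \<alpha>)) \<alpha>s))"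
    by (simp add: word_prod_def)
  thus ?case by (simp only: IH comp wperm.simps(2))
qed

text \<open>A reduced word attains the bound and \<open>ninv_wperm_le\<close> excludes shorter ones.
  Words are compared as maps on vectors, and \<open>ninv_act\<close> transfers this to the number of
  inversions.\<close>

lemma word_length_eq_ninv:
  assumes n: "n \<ge> 1" "\<not> short \<Longrightarrow> n \<ge> 2" and s: "weyl short n s"
  shows "word_length n ((\<lambda>\<alpha>. act n (sref \<alpha>)) ` simples short n) (act n s) = ninv short n s"
  unfolding word_length_def
proof (rule Least_equality)
  note sub = simples_sroots[OF n]
  obtain \<alpha>s where \<alpha>s: "set \<alpha>s \<subseteq> simples short n" "length \<alpha>s = ninv short n s" "wperm \<alpha>s = s"
    using reduced_word_exists[of n short s] n s by auto
  show "\<exists>ws. length ws = ninv short n s \<and> set ws \<subseteq> (\<lambda>\<alpha>. act n (sref \<alpha>)) ` simples short n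
      \<and> word_prod n ws = act n s"
    using \<alpha>s word_prod_act[of \<alpha>s short n] sub
    by (intro exI[of _ "map (\<lambda>\<alpha>. act n (sref \<alpha>)) \<alpha>s"]) auto
  fix k
  assume "\<exists>ws. length ws = k \<and> set ws \<subseteq> (\<lambda>\<alpha>. act n (sref \<alpha>)) ` simples short n
      \<and> word_prod n ws = act n s"
  then obtain ws where ws: "length ws = k" "set ws \<subseteq> (\<lambda>\<alpha>. act n (sref \<alpha>)) ` simples short n"
    "word_prod n ws = act n s" by auto
  have "ws \<in> lists ((\<lambda>\<alpha>. act n (sref \<alpha>)) ` simples short n)" using ws by auto
  then obtain \<beta>s where \<beta>s: "\<beta>s \<in> lists (simples short n)" "ws = map (\<lambda>\<alpha>. act n (sref \<alpha>)) \<beta>s"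
    unfolding lists_image by auto
  have \<beta>sub: "set \<beta>s \<subseteq> simples short n" using \<beta>s by auto
  hence \<beta>P: "set \<beta>s \<subseteq> sroots short (int n)" using sub by blast
  hence "act n (wperm \<beta>s) = act n s" using word_prod_act[of \<beta>s short n] ws \<beta>s by simp
  hence "ninv short n (wperm \<beta>s) = ninv short n s"
    using weyl_wperm[OF \<beta>P] s by (intro ninv_act) (auto simp: weyl_def)
  thus "ninv short n s \<le> k"
    using ninv_wperm_le[of n short \<beta>s] n \<beta>sub ws \<beta>s by simp
qed

section \<open>Positive roots as pairs of labels, reflections on labels\<close>

lemma enc_bij: "bij_betw (enc n) (pos_roots ty n) (sroots (ty = TypeB) (int n))"
proof -
  have "inj_on (enc n) (pos_roots ty n)"
    by (rule inj_onI) (auto simp: pos_roots_def split: root_type.splits)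
  moreover have "enc n ` pos_roots ty n \<subseteq> sroots (ty = TypeB) (int n)"
    by (auto simp: pos_roots_def sroots_def split: root_type.splits)
  moreover have "sroots (ty = TypeB) (int n) \<subseteq> enc n ` pos_roots ty n"
  proof
    fix \<alpha> assume \<alpha>: "\<alpha> \<in> sroots (ty = TypeB) (int n)"
    obtain a b where ab: "\<alpha> = (a, b)" "\<bar>b\<bar> < a" "a \<le> int n" "ty = TypeB \<or> b \<noteq> 0"
      using \<alpha> by (auto simp: sroots_def)
    define i where "i = nat (int n + 1 - a)"
    define j where "j = nat (int n + 1 - \<bar>b\<bar>)"
    have ij: "1 \<le> i" "i < j" "j \<le> n \<or> b = 0" "i \<le> n" "int i = int n + 1 - a" "int j = int n + 1 - \<bar>b\<bar>"
      using ab by (auto simp: i_def j_def)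
    consider "b = 0" | "0 < b" | "b < 0" by linarith
    thus "\<alpha> \<in> enc n ` pos_roots ty n"
    proof cases
      case 1 
      thus ?thesis using ij ab by (intro image_eqI[of _ _ "Short i"]) (auto simp: pos_roots_def)
    next
      case 2 thus ?thesis using ij ab by (intro image_eqI[of _ _ "Plus i j"]) (auto simp: pos_roots_def)
    next
      case 3 thus ?thesis using ij ab by (intro image_eqI[of _ _ "Minus i j"]) (auto simp: pos_roots_def)
    qed
  qed
  ultimately show ?thesis by (auto simp: bij_betw_def)
qed

lemma enc_sroots: "\<alpha> \<in> pos_roots ty n \<Longrightarrow> enc n \<alpha> \<in> sroots (ty = TypeB) (int n)"
  using enc_bij by (metis bij_betwE)

lemma enc_simple_roots:
  assumes "n \<ge> 1" "ty = TypeD \<Longrightarrow> n \<ge> 2"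
  shows "enc n ` simple_roots ty n = simples (ty = TypeB) n"
proof -
  have "enc n ` {Minus i (i + 1) | i. 1 \<le> i \<and> i \<le> n - 1} = {(a, 1 - a) | a. 2 \<le> a \<and> a \<le> int n}"
  proof
    show "enc n ` {Minus i (i + 1) | i. 1 \<le> i \<and> i \<le> n - 1} \<subseteq> {(a, 1 - a) | a. 2 \<le> a \<and> a \<le> int n}"
      using assms by auto
    show "{(a, 1 - a) | a. 2 \<le> a \<and> a \<le> int n} \<subseteq> enc n ` {Minus i (i + 1) | i. 1 \<le> i \<and> i \<le> n - 1}"
    proof clarify
      fix a :: int assume a: "2 \<le> a" "a \<le> int n"
      have "(a, 1 - a) = enc n (Minus (nat (int n + 1 - a)) (nat (int n + 1 - a) + 1))" using a by simp
      thus "(a, 1 - a) \<in> enc n ` {Minus i (i + 1) | i. 1 \<le> i \<and> i \<le> n - 1}"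
        by (rule image_eqI) (use a in auto)
    qed
  qed
  thus ?thesis using assms
    by (cases ty) (auto simp: simple_roots_def simples_def image_Un)
qed

lemma scalar_prod_root_vec:
  assumes "\<alpha> \<in> pos_roots ty n" "v \<in> carrier_vec n"
  shows "v \<bullet> root_vec n \<alpha> = coord n v (fst (enc n \<alpha>)) + coord n v (snd (enc n \<alpha>))"
    and "root_vec n \<alpha> \<bullet> v = coord n v (fst (enc n \<alpha>)) + coord n v (snd (enc n \<alpha>))"
proof -
  have idx: "n - nat (int n + 1 - int i) = i - 1" if "1 \<le> i" "i \<le> n" for i
    using that by linarith
  have idx': "n - nat (- (int i - int n - 1)) = i - 1" if "1 \<le> i" "i \<le> n" for i
    using that by linarith
  show *: "v \<bullet> root_vec n \<alpha> = coord n v (fst (enc n \<alpha>)) + coord n v (snd (enc n \<alpha>))"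
    using assms idx idx'[simplified]
    by (auto simp: pos_roots_def eps_def coord_def scalar_prod_right_unit
        scalar_prod_add_distrib[of _ n] scalar_prod_minus_distrib[of _ n]
        split: root_type.splits)
  have "root_vec n \<alpha> \<in> carrier_vec n" by (cases \<alpha>) (auto simp: eps_def)
  thus "root_vec n \<alpha> \<bullet> v = coord n v (fst (enc n \<alpha>)) + coord n v (snd (enc n \<alpha>))"
    using * assms(2) comm_scalar_prod by metis
qed

lemma coord_eps:
  assumes "1 \<le> i" "i \<le> n" "0 < c" "c \<le> int n"
  shows "coord n (eps n i) c = (if c = int n + 1 - int i then 1 else 0)"
proof -
  have "n - nat c < n" "n - nat c = i - 1 \<longleftrightarrow> c = int n + 1 - int i" using assms by linarith+
  thus ?thesis using assms by (simp add: coord_def eps_def unit_vec_def)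
qed

lemma coord_root_vec:
  assumes "\<alpha> \<in> pos_roots ty n" "0 < c" "c \<le> int n"
  shows "coord n (root_vec n \<alpha>) c =
    (if c = fst (enc n \<alpha>) \<or> c = snd (enc n \<alpha>) then 1 else if c = - snd (enc n \<alpha>) then - 1 else 0)"
proof -
  have c: "n - nat c < n" using assms by linarith
  have lin: "coord n (eps n i + eps n j) c = coord n (eps n i) c + coord n (eps n j) c"
    "coord n (eps n i - eps n j) c = coord n (eps n i) c - coord n (eps n j) c" for i j
    using assms c by (simp_all add: coord_def eps_def)
  show ?thesis
  proof (cases \<alpha>)
    case (Short i)
    hence "1 \<le> i" "i \<le> n" using assms by (auto simp: pos_roots_def split: root_type.splits)
    thus ?thesis using assms(2,3) by (simp add: Short coord_eps)
  next
    case (Minus i j)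
    hence "1 \<le> i" "i < j" "j \<le> n" using assms by (auto simp: pos_roots_def split: root_type.splits)
    thus ?thesis using assms(2,3) by (simp add: Minus coord_eps lin)
  next
    case (Plus i j)
    hence "1 \<le> i" "i < j" "j \<le> n" using assms by (auto simp: pos_roots_def split: root_type.splits)
    thus ?thesis using assms(2,3) by (simp add: Plus coord_eps lin)
  qed
qed

text \<open>The factor \<open>2 / (\<beta> \<bullet> \<beta>)\<close> is 2 for a short and 1 for a
  long root; accordingly \<open>sref\<close> negates one label or exchanges two up to sign.\<close>

lemma reflection_act:
  assumes \<alpha>: "\<alpha> \<in> pos_roots ty n"
  shows "reflection n (root_vec n \<alpha>) = act n (sref (enc n \<alpha>))"
proof
  fix v
  obtain a b where ab: "enc n \<alpha> = (a, b)" by force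
  have P: "\<bar>b\<bar> < a" "a \<le> int n" using enc_sroots[OF \<alpha>] by (auto simp: ab sroots_def)
  have rc: "root_vec n \<alpha> \<in> carrier_vec n" by (cases \<alpha>) (auto simp: eps_def)
  show "reflection n (root_vec n \<alpha>) v = act n (sref (enc n \<alpha>)) v"
  proof (cases "v \<in> carrier_vec n")
    case True
    have nn: "root_vec n \<alpha> \<bullet> root_vec n \<alpha> = (if b = 0 then 1 else 2)"
    proof -
      consider "b = 0" | "b > 0" | "b < 0" by linarith
      thus ?thesis
      proof cases
        case 3
        have "coord n (root_vec n \<alpha>) (- b) = - 1"
          using coord_root_vec[OF \<alpha>, of "- b"] P 3 by (simp add: ab)
        thus ?thesis
          using scalar_prod_root_vec(1)[OF \<alpha> rc] coord_root_vec[OF \<alpha>, of a] P 3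
            coord_uminus[of n _ b] by (simp add: ab)
      qed (use scalar_prod_root_vec(1)[OF \<alpha> rc] coord_root_vec[OF \<alpha>, of a]
             coord_root_vec[OF \<alpha>, of b] P in \<open>simp_all add: ab coord_def[of _ _ 0]\<close>)
    qed
    have "v - (2 * (v \<bullet> root_vec n \<alpha>) / (root_vec n \<alpha> \<bullet> root_vec n \<alpha>)) \<cdot>\<^sub>v root_vec n \<alpha>
        = act n (sref (enc n \<alpha>)) v"
    proof (rule eq_vecI)
      fix i assume "i < dim_vec (act n (sref (enc n \<alpha>)) v)"
      hence i: "i < n" using True by (simp add: act_def)
      define c where "c = int n - int i"
      have c: "0 < c" "c \<le> int n" "n - nat c = i" using i by (auto simp: c_def)
      have vi: "v $ i = coord n v c" and ri: "root_vec n \<alpha> $ i = coord n (root_vec n \<alpha>) c"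
        using c by (simp_all add: coord_def)
      have "(v - (2 * (v \<bullet> root_vec n \<alpha>) / (root_vec n \<alpha> \<bullet> root_vec n \<alpha>)) \<cdot>\<^sub>v root_vec n \<alpha>) $ i
        = coord n v c - 2 * (coord n v a + coord n v b) / (if b = 0 then 1 else 2)
            * coord n (root_vec n \<alpha>) c"
        using i True rc by (simp add: vi ri nn scalar_prod_root_vec(1)[OF \<alpha> True] ab)
      also have "\<dots> = coord n v (sref (a, b) c)"
        using P c coord_uminus[of n v a] coord_uminus[of n v b]
        by (auto simp: coord_root_vec[OF \<alpha> c(1,2)] ab sref_def coord_def[of _ _ 0]
            add_divide_distrib diff_divide_distrib)
      also have "\<dots> = act n (sref (enc n \<alpha>)) v $ i"
        using i True by (simp add: act_def ab c_def)
      finally show "(v - (2 * (v \<bullet> root_vec n \<alpha>) / (root_vec n \<alpha> \<bullet> root_vec n \<alpha>)) \<cdot>\<^sub>v root_vec n \<alpha>) $ i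
        = act n (sref (enc n \<alpha>)) v $ i" .
    qed (use True rc in \<open>simp add: act_def\<close>)
    thus ?thesis using True by (simp add: reflection_def)
  qed (simp add: reflection_def act_def)
qed

section \<open>Length statistics of the involution\<close>

text \<open>For the lower bound on the reflection length: the unknowns will be coefficients of a
  combination of the roots in D, the equations its orthogonality to the roots of a shorter
  word.\<close>

lemma homogeneous_system_solution:
  fixes cs :: "('a \<Rightarrow> real) list"
  assumes "finite D" "length cs < card D"
  shows "\<exists>x. (\<exists>\<beta>\<in>D. x \<beta> \<noteq> 0) \<and> (\<forall>c\<in>set cs. (\<Sum>\<beta>\<in>D. c \<beta> * x \<beta>) = 0)"
  using assms
proof (induction cs arbitrary: D rule: length_induct)
  case (1 cs)
  show ?case
  proof (cases cs)
    case Nil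
    hence "D \<noteq> {}" using 1 by auto
    thus ?thesis using Nil by (intro exI[of _ "\<lambda>_. 1"]) auto
  next
    case (Cons c cs')
    show ?thesis
    proof (cases "\<forall>\<beta>\<in>D. c \<beta> = 0")
      case True
      have "length cs' < length cs" "length cs' < card D" using Cons 1 by auto
      then obtain x where "\<exists>\<beta>\<in>D. x \<beta> \<noteq> 0" "\<forall>c\<in>set cs'. (\<Sum>\<beta>\<in>D. c \<beta> * x \<beta>) = 0"
        using 1 by blast
      thus ?thesis using True Cons by (intro exI[of _ x]) auto
    next
      case False
      then obtain \<beta>0 where \<beta>0: "\<beta>0 \<in> D" "c \<beta>0 \<noteq> 0" by auto
      define D' where "D' = D - {\<beta>0}"
      have D': "D = insert \<beta>0 D'" "\<beta>0 \<notin> D'" "finite D'" using \<beta>0 1(2) by (auto simp: D'_def)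
      \<comment> \<open>Gaussian elimination: the pivot row \<open>c\<close> clears the unknown
        \<open>\<beta>0\<close> from \<open>e\<close>, and that unknown is recovered from
        \<open>c\<close> afterwards.\<close>
      define red where "red e \<beta> = e \<beta> - e \<beta>0 * c \<beta> / c \<beta>0" for e \<beta>
      have "length (map red cs') < length cs" "length (map red cs') < card D'"
        using Cons 1(3) D' by auto
      then obtain y where y: "\<exists>\<beta>\<in>D'. y \<beta> \<noteq> 0" "\<forall>e\<in>set (map red cs'). (\<Sum>\<beta>\<in>D'. e \<beta> * y \<beta>) = 0"
        using 1(1) D'(3) by blast
      define x where "x = y(\<beta>0 := - (\<Sum>\<beta>\<in>D'. c \<beta> * y \<beta>) / c \<beta>0)"
      have sum: "(\<Sum>\<beta>\<in>D. e \<beta> * x \<beta>) = (\<Sum>\<beta>\<in>D'. red e \<beta> * y \<beta>)" for e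
      proof -
        have "(\<Sum>\<beta>\<in>D'. e \<beta> * x \<beta>) = (\<Sum>\<beta>\<in>D'. e \<beta> * y \<beta>)"
          using D' by (intro sum.cong) (auto simp: x_def)
        moreover have "e \<beta>0 * x \<beta>0 = - (\<Sum>\<beta>\<in>D'. e \<beta>0 * c \<beta> / c \<beta>0 * y \<beta>)"
          by (simp add: x_def sum_distrib_left sum_divide_distrib mult.assoc)
        ultimately show ?thesis
          using D' by (simp add: red_def left_diff_distrib sum_subtractf)
      qed
      have "red c \<beta> = 0" for \<beta> using \<beta>0 by (simp add: red_def)
      hence "\<forall>e\<in>set cs. (\<Sum>\<beta>\<in>D. e \<beta> * x \<beta>) = 0"
        using y(2) by (simp add: sum Cons)
      moreover have "\<exists>\<beta>\<in>D. x \<beta> \<noteq> 0" using y(1) D' by (auto simp: x_def)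
      ultimately show ?thesis by blast
    qed
  qed
qed

lemma word_prod_fixes:
  assumes "v \<in> carrier_vec n" "\<forall>\<gamma>\<in>set \<gamma>s. \<gamma> \<in> carrier_vec n \<and> v \<bullet> \<gamma> = 0"
  shows "word_prod n (map (reflection n) \<gamma>s) v = v"
  using assms(2)
proof (induction \<gamma>s)
  case (Cons \<gamma> \<gamma>s)
  have "v - 0 \<cdot>\<^sub>v \<gamma> = v" using Cons.prems assms(1) by auto
  hence "reflection n \<gamma> v = v" using Cons.prems assms(1) by (simp add: reflection_def)
  thus ?case using Cons assms(1) by (simp add: word_prod_def compose_def)
qed (simp add: word_prod_def assms(1))

lemma sref_unmoved: "\<bar>p\<bar> \<noteq> \<bar>fst \<alpha>\<bar> \<Longrightarrow> \<bar>p\<bar> \<noteq> \<bar>snd \<alpha>\<bar> \<Longrightarrow> sref \<alpha> p = p"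
  by (cases \<alpha>) (auto simp: sref_def)

lemma wperm_unmoved:
  "\<forall>\<alpha>\<in>set \<alpha>s. \<bar>p\<bar> \<noteq> \<bar>fst \<alpha>\<bar> \<and> \<bar>p\<bar> \<noteq> \<bar>snd \<alpha>\<bar> \<Longrightarrow> wperm \<alpha>s p = p"
  by (induction \<alpha>s) (auto simp: sref_unmoved)

text \<open>Only the reflection in \<open>\<alpha>\<close> moves p, and it keeps p among its own
  labels, which the other reflections fix.\<close>

lemma wperm_disjoint:
  assumes "distinct \<alpha>s" "\<alpha> \<in> set \<alpha>s" "\<bar>p\<bar> \<in> {\<bar>fst \<alpha>\<bar>, \<bar>snd \<alpha>\<bar>}"
    and "\<forall>\<beta>\<in>set \<alpha>s. \<forall>\<gamma>\<in>set \<alpha>s. \<beta> \<noteq> \<gamma> \<longrightarrow> {\<bar>fst \<beta>\<bar>, \<bar>snd \<beta>\<bar>} \<inter> {\<bar>fst \<gamma>\<bar>, \<bar>snd \<gamma>\<bar>} = {}"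
  shows "wperm \<alpha>s p = sref \<alpha> p"
  using assms
proof (induction \<alpha>s)
  case (Cons \<beta> \<alpha>s)
  show ?case
  proof (cases "\<beta> = \<alpha>")
    case True
    have "\<bar>sref \<alpha> p\<bar> \<in> {\<bar>fst \<alpha>\<bar>, \<bar>snd \<alpha>\<bar>}"
      using Cons.prems(3) by (cases \<alpha>) (auto simp: sref_def)
    moreover have "{\<bar>fst \<alpha>\<bar>, \<bar>snd \<alpha>\<bar>} \<inter> {\<bar>fst \<gamma>\<bar>, \<bar>snd \<gamma>\<bar>} = {}" if "\<gamma> \<in> set \<alpha>s" for \<gamma>
      using Cons.prems(4)[rule_format, of \<alpha> \<gamma>] Cons.prems(1) that True by auto
    ultimately have "wperm \<alpha>s (sref \<alpha> p) = sref \<alpha> p" by (intro wperm_unmoved) blast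
    thus ?thesis using True by simp
  next
    case False
    hence "\<alpha> \<in> set \<alpha>s" using Cons.prems by simp
    hence "wperm \<alpha>s p = sref \<alpha> p" using Cons by simp
    moreover have "{\<bar>fst \<alpha>\<bar>, \<bar>snd \<alpha>\<bar>} \<inter> {\<bar>fst \<beta>\<bar>, \<bar>snd \<beta>\<bar>} = {}"
      using Cons.prems(4)[rule_format, of \<alpha> \<beta>] False \<open>\<alpha> \<in> set \<alpha>s\<close> by simp
    hence "sref \<beta> p = p" using Cons.prems(3) by (intro sref_unmoved) blast+
    ultimately show ?thesis by simp
  qed
qed simp

text \<open>Orthogonality alone leaves two ways of sharing a label: \<epsilon>_i - \<epsilon>_j with
  \<epsilon>_i + \<epsilon>_j, and two short roots, which share the label 0. The column condition
  excludes the first and the condition on row 0 the second; every other overlap gives inner product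
  1 or -1.\<close>

lemma rook_disjoint:
  assumes n: "n \<ge> 1" and orp: "orthogonal_rook_placement ty n D"
    and \<alpha>\<beta>: "\<alpha> \<in> D" "\<beta> \<in> D" "\<alpha> \<noteq> \<beta>" and e: "enc n \<alpha> = (a, b)" "enc n \<beta> = (c, d)"
  shows "{\<bar>a\<bar>, \<bar>b\<bar>} \<inter> {\<bar>c\<bar>, \<bar>d\<bar>} = {}"
proof -
  have D: "D \<subseteq> pos_roots ty n" "root_vec n \<alpha> \<bullet> root_vec n \<beta> = 0"
    and row: "\<And>i. i \<in> {- int n + 1..int n - 1} \<Longrightarrow> card (D \<inter> row_set ty n i) \<le> 1"
    and col: "\<And>j. j \<in> {1..n} \<Longrightarrow> card (D \<inter> col_set ty n j) \<le> 1"
    using orp \<alpha>\<beta> by (auto simp: orthogonal_rook_placement_def)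
  have fin: "finite D" using D(1) bij_betw_finite[OF enc_bij[of n ty]] finite_sroots finite_subset by blast
  have P: "\<alpha> \<in> pos_roots ty n" "\<beta> \<in> pos_roots ty n" using D \<alpha>\<beta> by auto
  have ab: "\<bar>b\<bar> < a" "a \<le> int n" "\<bar>d\<bar> < c" "c \<le> int n"
    using enc_sroots[OF P(1)] enc_sroots[OF P(2)] e by (auto simp: sroots_def)
  have one: "\<gamma> = \<delta>" if "card (D \<inter> S) \<le> 1" "\<gamma> \<in> D \<inter> S" "\<delta> \<in> D \<inter> S" for \<gamma> \<delta> S
    using that fin by (metis One_nat_def card_le_Suc0_iff_eq finite_Int)
  have ac: "a \<noteq> c"
  proof
    assume "a = c"
    hence "root_col \<alpha> = root_col \<beta>" using e by (cases \<alpha>; cases \<beta>) auto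
    moreover have "root_col \<beta> \<in> {1..n}" using P by (auto simp: pos_roots_def split: root_type.splits)
    ultimately show False
      using one[OF col[of "root_col \<beta>"], of \<alpha> \<beta>] \<alpha>\<beta> P by (auto simp: col_set_def)
  qed
  have bd: "\<not> (b = 0 \<and> d = 0)"
  proof
    assume "b = 0 \<and> d = 0"
    hence "root_row \<alpha> = 0" "root_row \<beta> = 0"
      using e P by (cases \<alpha>; cases \<beta>; auto simp: pos_roots_def split: root_type.splits)+
    moreover have "0 \<in> {- int n + 1..int n - 1}" using n by auto
    ultimately show False
      using one[OF row[of 0], of \<alpha> \<beta>] \<alpha>\<beta> P by (auto simp: row_set_def)
  qed
  have rc: "root_vec n \<alpha> \<in> carrier_vec n" by (cases \<alpha>) (auto simp: eps_def)
  have zero: "coord n (root_vec n \<alpha>) c + coord n (root_vec n \<alpha>) d = 0"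
    using scalar_prod_root_vec(1)[OF P(2) rc] D(2) e by simp
  have cv: "coord n (root_vec n \<alpha>) x = (if x = a \<or> x = b then 1 else if x = - b then - 1 else 0)"
    if "0 < x" "x \<le> int n" for x
    using coord_root_vec[OF P(1) that] e by simp
  have cc: "coord n (root_vec n \<alpha>) c = (if c = b then 1 else if c = - b then - 1 else 0)"
    using cv[of c] ab ac by auto
  have dd: "coord n (root_vec n \<alpha>) d = (if d = a \<or> d = b \<and> d \<noteq> 0 then 1 else if d = - a \<or> d = - b \<and> d \<noteq> 0 then - 1 else 0)"
  proof -
    consider "d = 0" | "0 < d" | "0 < - d" by linarith
    thus ?thesis
    proof cases
      case 1 thus ?thesis using ab by (simp add: coord_def)
    next
      case 2 thus ?thesis using cv[of d] ab by auto
    next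
      case 3
      have "coord n (root_vec n \<alpha>) d = - coord n (root_vec n \<alpha>) (- d)" by (simp add: coord_uminus)
      thus ?thesis using cv[of "- d"] 3 ab by auto
    qed
  qed
  show ?thesis
  proof (rule ccontr)
    assume "\<not> ?thesis"
    then consider "c = \<bar>b\<bar>" | "a = \<bar>d\<bar>" | "\<bar>b\<bar> = \<bar>d\<bar>" "c \<noteq> \<bar>b\<bar>" using ac ab by auto
    thus False
    proof cases
      case 1
      hence "coord n (root_vec n \<alpha>) d = 0" unfolding dd using ab by auto
      thus False using zero 1 ab unfolding cc by (simp add: abs_if split: if_splits)
    next
      case 2
      hence "coord n (root_vec n \<alpha>) c = 0" unfolding cc using ab by auto
      thus False using zero 2 ab unfolding dd by (simp add: abs_if split: if_splits)
    next
      case 3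
      hence "coord n (root_vec n \<alpha>) c = 0" unfolding cc using ab by auto
      moreover have "d \<noteq> 0" "d = b \<or> d = - b" using 3 bd by auto
      ultimately show False using zero unfolding dd by (auto split: if_splits)
    qed
  qed
qed

lemma rook_involution_wperm:
  assumes n: "n \<ge> 1" and orp: "orthogonal_rook_placement ty n (set \<beta>s)" and dist: "distinct \<beta>s"
  shows "rook_involution (ty = TypeB) (int n) (enc n ` set \<beta>s) (wperm (map (enc n) \<beta>s))"
proof -
  have D: "set \<beta>s \<subseteq> pos_roots ty n" using orp by (simp add: orthogonal_rook_placement_def)
  have sub: "enc n ` set \<beta>s \<subseteq> sroots (ty = TypeB) (int n)" using D enc_sroots by blast
  have inj: "inj_on (enc n) (set \<beta>s)"
    using enc_bij[of n ty] D by (meson bij_betw_def inj_on_subset)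
  have disj: "a = c \<and> b = d" if ab: "(a, b) \<in> enc n ` set \<beta>s" and cd: "(c, d) \<in> enc n ` set \<beta>s"
    and ne: "{\<bar>a\<bar>, \<bar>b\<bar>} \<inter> {\<bar>c\<bar>, \<bar>d\<bar>} \<noteq> {}" for a b c d
  proof (rule ccontr)
    assume neg: "\<not> ?thesis"
    obtain \<alpha> where \<alpha>: "\<alpha> \<in> set \<beta>s" "enc n \<alpha> = (a, b)" using ab by auto
    obtain \<beta> where \<beta>: "\<beta> \<in> set \<beta>s" "enc n \<beta> = (c, d)" using cd by auto
    note * = \<alpha>(1) \<beta>(1) \<alpha>(2) \<beta>(2)
    have "\<alpha> \<noteq> \<beta>" using * neg by auto
    thus False using rook_disjoint[OF n orp *(1,2) _ *(3,4)] ne by blast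
  qed
  have dist': "distinct (map (enc n) \<beta>s)" using dist inj by (simp add: distinct_map)
  have at: "wperm (map (enc n) \<beta>s) p = sref (a, b) p"
    if "(a, b) \<in> enc n ` set \<beta>s" "\<bar>p\<bar> \<in> {\<bar>a\<bar>, \<bar>b\<bar>}" for a b p
  proof (rule wperm_disjoint[OF dist'])
    show "\<forall>\<beta>\<in>set (map (enc n) \<beta>s). \<forall>\<gamma>\<in>set (map (enc n) \<beta>s). \<beta> \<noteq> \<gamma> \<longrightarrow>
        {\<bar>fst \<beta>\<bar>, \<bar>snd \<beta>\<bar>} \<inter> {\<bar>fst \<gamma>\<bar>, \<bar>snd \<gamma>\<bar>} = {}"
    proof (intro ballI impI)
      fix \<beta> \<gamma> assume m: "\<beta> \<in> set (map (enc n) \<beta>s)" "\<gamma> \<in> set (map (enc n) \<beta>s)" "\<beta> \<noteq> \<gamma>"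
      show "{\<bar>fst \<beta>\<bar>, \<bar>snd \<beta>\<bar>} \<inter> {\<bar>fst \<gamma>\<bar>, \<bar>snd \<gamma>\<bar>} = {}"
      proof (rule ccontr)
        assume "\<not> ?thesis"
        hence "fst \<beta> = fst \<gamma> \<and> snd \<beta> = snd \<gamma>"
          using disj[of "fst \<beta>" "snd \<beta>" "fst \<gamma>" "snd \<gamma>"] m(1,2) by simp
        thus False using m(3) by (simp add: prod_eq_iff)
      qed
    qed
  qed (use that in auto)
  have weyl: "sperm n (wperm (map (enc n) \<beta>s))"
    using weyl_wperm[of "map (enc n) \<beta>s"] sub by (simp add: weyl_def)
  show ?thesis
  proof
    show "wperm (map (enc n) \<beta>s) (- p) = - wperm (map (enc n) \<beta>s) p" for p
      using sperm_uminus[OF weyl] .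
    show "wperm (map (enc n) \<beta>s) a = - b \<and> wperm (map (enc n) \<beta>s) b = - a"
      if "(a, b) \<in> enc n ` set \<beta>s" "b \<noteq> 0" for a b
    proof -
      have "\<bar>b\<bar> < a" using that sub by (auto simp: sroots_def)
      thus ?thesis using at[OF that(1), of a] at[OF that(1), of b] that by (simp add: sref_def)
    qed
    show "wperm (map (enc n) \<beta>s) a = - a" if "(a, 0) \<in> enc n ` set \<beta>s" for a
    proof -
      have "0 < a" using that sub by (auto simp: sroots_def)
      thus ?thesis using at[OF that(1), of a] by (simp add: sref_def)
    qed
    show "wperm (map (enc n) \<beta>s) p = p"
      if "\<And>a b. (a, b) \<in> enc n ` set \<beta>s \<Longrightarrow> \<bar>p\<bar> \<noteq> \<bar>a\<bar> \<and> \<bar>p\<bar> \<noteq> \<bar>b\<bar>" for p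
    proof (rule wperm_unmoved, rule ballI)
      fix \<alpha> assume "\<alpha> \<in> set (map (enc n) \<beta>s)"
      hence "(fst \<alpha>, snd \<alpha>) \<in> enc n ` set \<beta>s" by simp
      from that[OF this] show "\<bar>p\<bar> \<noteq> \<bar>fst \<alpha>\<bar> \<and> \<bar>p\<bar> \<noteq> \<bar>snd \<alpha>\<bar>" .
    qed
    show "a = c \<and> b = d" if "(a, b) \<in> enc n ` set \<beta>s" "(c, d) \<in> enc n ` set \<beta>s"
      "{\<bar>a\<bar>, \<bar>b\<bar>} \<inter> {\<bar>c\<bar>, \<bar>d\<bar>} \<noteq> {}" for a b c d
      using disj that by blast
  qed (use sub in auto)
qed

lemma word_prod_reflections:
  assumes "set \<beta>s \<subseteq> pos_roots ty n"
  shows "word_prod n (map (\<lambda>\<beta>. reflection n (root_vec n \<beta>)) \<beta>s) = act n (wperm (map (enc n) \<beta>s))"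
proof -
  have "map (\<lambda>\<beta>. reflection n (root_vec n \<beta>)) \<beta>s = map (\<lambda>\<alpha>. act n (sref \<alpha>)) (map (enc n) \<beta>s)"
    using assms reflection_act by auto
  moreover have "set (map (enc n) \<beta>s) \<subseteq> sroots (ty = TypeB) (int n)"
    using assms enc_sroots by auto
  ultimately show ?thesis using word_prod_act by metis
qed

lemma l_stat_eq_ninv:
  assumes n: "n \<ge> 1" "ty = TypeD \<Longrightarrow> n \<ge> 2" and D: "set \<beta>s \<subseteq> pos_roots ty n"
  shows "l_stat ty n (word_prod n (map (\<lambda>\<beta>. reflection n (root_vec n \<beta>)) \<beta>s))
    = ninv (ty = TypeB) n (wperm (map (enc n) \<beta>s))"
proof -
  have B: "\<not> ty = TypeB \<Longrightarrow> n \<ge> 2" using n(2) by (cases ty) auto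
  have "simple_roots ty n \<subseteq> pos_roots ty n"
    using n by (auto simp: simple_roots_def pos_roots_def split: root_type.splits)
  hence "(\<lambda>\<alpha>. reflection n (root_vec n \<alpha>)) ` simple_roots ty n
      = (\<lambda>\<alpha>. act n (sref (enc n \<alpha>))) ` simple_roots ty n"
    using reflection_act by (intro image_cong) auto
  also have "\<dots> = (\<lambda>\<alpha>. act n (sref \<alpha>)) ` simples (ty = TypeB) n"
    using enc_simple_roots[OF n] by (metis image_image)
  finally have S: "(\<lambda>\<alpha>. reflection n (root_vec n \<alpha>)) ` simple_roots ty n
      = (\<lambda>\<alpha>. act n (sref \<alpha>)) ` simples (ty = TypeB) n" .
  have "weyl (ty = TypeB) n (wperm (map (enc n) \<beta>s))"
    by (rule weyl_wperm) (use D enc_sroots in auto)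
  from word_length_eq_ninv[OF n(1) B this] show ?thesis
    unfolding l_stat_def S word_prod_reflections[OF D] .
qed

text \<open>A word of k reflections fixes all vectors orthogonal to its k roots. For k < |D| the
  span of D contains such a nonzero vector, but the involution negates that span.\<close>

lemma s_stat_eq_card:
  assumes n: "n \<ge> 1" and orp: "orthogonal_rook_placement ty n (set \<beta>s)" and dist: "distinct \<beta>s"
  shows "s_stat ty n (word_prod n (map (\<lambda>\<beta>. reflection n (root_vec n \<beta>)) \<beta>s)) = card (set \<beta>s)"
  unfolding s_stat_def word_length_def
proof (rule Least_equality)
  have D: "set \<beta>s \<subseteq> pos_roots ty n" using orp by (simp add: orthogonal_rook_placement_def)
  show "\<exists>ws. length ws = card (set \<beta>s) \<and> set ws \<subseteq> reflection n ` roots ty n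
      \<and> word_prod n ws = word_prod n (map (\<lambda>\<beta>. reflection n (root_vec n \<beta>)) \<beta>s)"
    using D dist by (intro exI[of _ "map (\<lambda>\<beta>. reflection n (root_vec n \<beta>)) \<beta>s"])
      (auto simp: distinct_card roots_def)
  fix k
  assume "\<exists>ws. length ws = k \<and> set ws \<subseteq> reflection n ` roots ty n
      \<and> word_prod n ws = word_prod n (map (\<lambda>\<beta>. reflection n (root_vec n \<beta>)) \<beta>s)"
  then obtain ws where ws: "length ws = k" "set ws \<subseteq> reflection n ` roots ty n"
    "word_prod n ws = word_prod n (map (\<lambda>\<beta>. reflection n (root_vec n \<beta>)) \<beta>s)" by auto
  have "ws \<in> lists (reflection n ` roots ty n)" using ws by auto
  then obtain \<gamma>s where \<gamma>s: "\<gamma>s \<in> lists (roots ty n)" "ws = map (reflection n) \<gamma>s"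
    unfolding lists_image by auto
  have rc: "root_vec n \<alpha> \<in> carrier_vec n" for \<alpha> by (cases \<alpha>) (auto simp: eps_def)
  have \<gamma>c: "\<gamma> \<in> carrier_vec n" if "\<gamma> \<in> set \<gamma>s" for \<gamma>
    using that \<gamma>s(1) rc by (auto simp: roots_def)
  show "card (set \<beta>s) \<le> k"
  proof (rule ccontr)
    assume "\<not> ?thesis"
    hence "length (map (\<lambda>\<gamma> \<beta>. root_vec n \<beta> \<bullet> \<gamma>) \<gamma>s) < card (set \<beta>s)" using ws \<gamma>s by simp
    then obtain x where x: "\<exists>\<beta>\<in>set \<beta>s. x \<beta> \<noteq> 0"
      "\<forall>c\<in>set (map (\<lambda>\<gamma> \<beta>. root_vec n \<beta> \<bullet> \<gamma>) \<gamma>s). (\<Sum>\<beta>\<in>set \<beta>s. c \<beta> * x \<beta>) = 0"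
      using homogeneous_system_solution[of "set \<beta>s"] by blast
    \<comment> \<open>A combination of the roots of D that is orthogonal to all roots of the shorter
      word.\<close>
    define v where "v = vec n (\<lambda>i. \<Sum>\<beta>\<in>set \<beta>s. root_vec n \<beta> $ i * x \<beta>)"
    have v: "v \<in> carrier_vec n" by (simp add: v_def)
    have "v \<bullet> \<gamma> = 0" if "\<gamma> \<in> set \<gamma>s" for \<gamma>
    proof -
      have "v \<bullet> \<gamma> = (\<Sum>i<n. \<Sum>\<beta>\<in>set \<beta>s. root_vec n \<beta> $ i * x \<beta> * \<gamma> $ i)"
        using \<gamma>c[OF that] by (simp add: scalar_prod_def v_def sum_distrib_right lessThan_atLeast0)
      also have "\<dots> = (\<Sum>\<beta>\<in>set \<beta>s. \<Sum>i<n. root_vec n \<beta> $ i * x \<beta> * \<gamma> $ i)" by (rule sum.swap)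
      also have "\<dots> = (\<Sum>\<beta>\<in>set \<beta>s. (root_vec n \<beta> \<bullet> \<gamma>) * x \<beta>)"
        using \<gamma>c[OF that] by (intro sum.cong refl)
          (simp add: scalar_prod_def sum_distrib_left sum_distrib_right lessThan_atLeast0 mult_ac)
      also have "\<dots> = 0" using x(2) that by auto
      finally show ?thesis .
    qed
    hence fix1: "word_prod n ws v = v"
      using word_prod_fixes[OF v, of \<gamma>s] \<gamma>c \<gamma>s(2) by simp
    define s where "s = wperm (map (enc n) \<beta>s)"
    have sp: "sperm n s"
      using weyl_wperm[of "map (enc n) \<beta>s" "ty = TypeB" n] D enc_sroots by (auto simp: s_def weyl_def)
    have act_v: "act n s v = v"
      using fix1 ws(3) word_prod_reflections[OF D] by (simp add: s_def)
    interpret rook_involution "ty = TypeB" "int n" "enc n ` set \<beta>s" s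
      unfolding s_def by (rule rook_involution_wperm[OF n orp dist])
    \<comment> \<open>Members of D have disjoint labels, so the coordinate of v at a is
      \<open>x \<beta>\<close>. The involution takes it to its negative, yet it fixes v.\<close>
    have "x \<beta> = 0" if \<beta>: "\<beta> \<in> set \<beta>s" for \<beta>
    proof -
      obtain a b where e: "enc n \<beta> = (a, b)" by force
      have ab: "\<bar>b\<bar> < a" "a \<le> int n" using enc_sroots[of \<beta> ty n] \<beta> D e by (auto simp: sroots_def)
      have cs: "coord n v c = (\<Sum>\<beta>\<in>set \<beta>s. coord n (root_vec n \<beta>) c * x \<beta>)" if "0 < c" "c \<le> int n" for c
      proof -
        have "n - nat c < n" using that by linarith
        thus ?thesis using that by (simp add: coord_def v_def)
      qed
      have cv: "coord n v c = coord n (root_vec n \<beta>) c * x \<beta>"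
        if c: "0 < c" "c \<le> int n" "c = a \<or> c = \<bar>b\<bar>" for c
      proof -
        have "coord n (root_vec n \<gamma>) c = 0" if \<gamma>: "\<gamma> \<in> set \<beta>s" "\<gamma> \<noteq> \<beta>" for \<gamma>
        proof -
          obtain a' b' where e': "enc n \<gamma> = (a', b')" by force
          have "{\<bar>a\<bar>, \<bar>b\<bar>} \<inter> {\<bar>a'\<bar>, \<bar>b'\<bar>} = {}"
            using rook_disjoint[OF n orp \<beta> \<gamma>(1) _ e e'] \<gamma>(2) by blast
          moreover have "\<bar>c\<bar> \<in> {\<bar>a\<bar>, \<bar>b\<bar>}" using c ab by auto
          ultimately have "\<bar>c\<bar> \<noteq> \<bar>a'\<bar>" "\<bar>c\<bar> \<noteq> \<bar>b'\<bar>" by auto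
          moreover have "\<gamma> \<in> pos_roots ty n" using \<gamma> D by blast
          from coord_root_vec[OF this c(1,2)] have "coord n (root_vec n \<gamma>) c =
              (if c = a' \<or> c = b' then 1 else if c = - b' then - 1 else 0)" using e' by simp
          ultimately show ?thesis by auto
        qed
        thus ?thesis
          using cs[OF c(1,2)] \<beta> by (simp add: sum.remove[of "set \<beta>s" \<beta>])
      qed
      have \<beta>P: "\<beta> \<in> pos_roots ty n" using \<beta> D by blast
      have va: "coord n v a = x \<beta>" using cv[of a] ab coord_root_vec[OF \<beta>P, of a] e by simp
      have mem: "(a, b) \<in> enc n ` set \<beta>s" using \<beta> e by (metis imageI)
      have inv: "coord n v a = coord n v (s a)" using coord_act[OF sp v, of a] ab act_v by simp
      show ?thesis
      proof (cases "b = 0")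
        case True
        thus ?thesis using va inv s_short[of a] mem coord_uminus[of n v a] by simp
      next
        case False
        have "coord n v b = x \<beta>"
        proof (cases "b > 0")
          case True
          thus ?thesis using cv[of b] ab coord_root_vec[OF \<beta>P, of b] e by simp
        next
          case neg: False
          have "coord n v (- b) = - x \<beta>"
            using cv[of "- b"] ab coord_root_vec[OF \<beta>P, of "- b"] e neg False by simp
          thus ?thesis by (simp add: coord_uminus)
        qed
        moreover have "s a = - b" using s_long mem False by blast
        ultimately show ?thesis using va inv coord_uminus[of n v b] by simp
      qed
    qed
    thus False using x(1) by blast
  qed
qed

text \<open>The reversed numbering turns a larger column into a smaller first label, and a negative
  row means a positive second label.\<close>

lemma d_stat_enc:
  assumes orp: "orthogonal_rook_placement ty n D" and n: "n \<ge> 1"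
  shows "d_stat ty D = card {\<beta> \<in> enc n ` D. 0 < snd \<beta> \<and> (\<exists>a. (a, 0) \<in> enc n ` D \<and> fst \<beta> < a)}"
proof -
  have D: "D \<subseteq> pos_roots ty n" using orp by (simp add: orthogonal_rook_placement_def)
  have inj: "inj_on (enc n) D" using enc_bij[of n ty] D by (meson bij_betw_def inj_on_subset)
  have mem: "1 \<le> root_col \<beta> \<and> root_col \<beta> \<le> n \<and> fst (enc n \<beta>) = int n + 1 - int (root_col \<beta>)
      \<and> (0 < snd (enc n \<beta>) \<longleftrightarrow> root_row \<beta> < 0) \<and> (snd (enc n \<beta>) = 0 \<longleftrightarrow> \<beta> = Short (root_col \<beta>))"
    if "\<beta> \<in> D" for \<beta>
    using that D by (cases \<beta>) (auto simp: pos_roots_def split: root_type.splits)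
  have short: "(a, 0) \<in> enc n ` D \<longleftrightarrow> (\<exists>i. Short i \<in> D \<and> a = int n + 1 - int i)" for a
  proof
    assume "(a, 0) \<in> enc n ` D"
    then obtain \<beta> where "\<beta> \<in> D" "enc n \<beta> = (a, 0)" by auto
    thus "\<exists>i. Short i \<in> D \<and> a = int n + 1 - int i" using mem[of \<beta>] by (metis fst_conv snd_conv)
  next
    assume "\<exists>i. Short i \<in> D \<and> a = int n + 1 - int i"
    thus "(a, 0) \<in> enc n ` D" by (metis enc.simps(1) imageI)
  qed
  show ?thesis
  proof (cases "\<exists>i. Short i \<in> D")
    case True
    then obtain i where i: "Short i \<in> D" by auto
    have "ty = TypeB" using i D by (cases ty) (auto simp: pos_roots_def)
    have uniq: "j = i" if "Short j \<in> D" for j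
      using rook_disjoint[OF n orp that i _ enc.simps(1) enc.simps(1)] by auto
    have the: "(THE i. Short i \<in> D) = i" using i by (rule the_equality) (rule uniq)
    have ex: "(\<exists>a. (a, 0) \<in> enc n ` D \<and> f < a) \<longleftrightarrow> f < int n + 1 - int i" for f
      unfolding short using i uniq by blast
    have "{\<beta> \<in> enc n ` D. 0 < snd \<beta> \<and> (\<exists>a. (a, 0) \<in> enc n ` D \<and> fst \<beta> < a)}
        = enc n ` {\<beta> \<in> D. 0 < snd (enc n \<beta>) \<and> fst (enc n \<beta>) < int n + 1 - int i}"
      unfolding ex by blast
    also have "{\<beta> \<in> D. 0 < snd (enc n \<beta>) \<and> fst (enc n \<beta>) < int n + 1 - int i}
        = {\<beta> \<in> D. root_col \<beta> > i \<and> root_row \<beta> < 0}"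
    proof (rule Collect_cong, rule conj_cong, rule refl)
      fix \<beta> assume "\<beta> \<in> D"
      from mem[OF this] show "(0 < snd (enc n \<beta>) \<and> fst (enc n \<beta>) < int n + 1 - int i)
          = (root_col \<beta> > i \<and> root_row \<beta> < 0)" by auto
    qed
    finally have "{\<beta> \<in> enc n ` D. 0 < snd \<beta> \<and> (\<exists>a. (a, 0) \<in> enc n ` D \<and> fst \<beta> < a)}
        = enc n ` {\<beta> \<in> D. root_col \<beta> > i \<and> root_row \<beta> < 0}" .
    moreover have "inj_on (enc n) {\<beta> \<in> D. root_col \<beta> > i \<and> root_row \<beta> < 0}"
      using inj by (rule inj_on_subset) auto
    ultimately show ?thesis using True \<open>ty = TypeB\<close> by (simp add: d_stat_def the card_image)
  next
    case False
    thus ?thesis unfolding short by (simp add: d_stat_def)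
  qed
qed

section \<open>Unipotent isometries and the Cayley correspondence\<close>

lemma mult_mat_index:
  assumes "A \<in> carrier_mat m m" "B \<in> carrier_mat m m" "i < m" "j < m"
  shows "(A * B) $$ (i, j) = (\<Sum>k<m. A $$ (i, k) * B $$ (k, j))"
  using assms by (simp add: scalar_prod_def lessThan_atLeast0)

text \<open>The adjoint for the symmetric form with matrix \<open>(\<delta>\<^bsub>i, m-1-j\<^esub>)\<close>, that is, the transpose in the antidiagonal.\<close>

definition astr :: "nat \<Rightarrow> 'a mat \<Rightarrow> 'a mat" where
  "astr m x = mat m m (\<lambda>(r, c). x $$ (m - 1 - c, m - 1 - r))"

lemma astr_carrier [simp]: "astr m x \<in> carrier_mat m m"
  by (simp add: astr_def)

lemma astr_index: "r < m \<Longrightarrow> c < m \<Longrightarrow> astr m x $$ (r, c) = x $$ (m - 1 - c, m - 1 - r)"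
  by (simp add: astr_def)

lemma astr_astr: "x \<in> carrier_mat m m \<Longrightarrow> astr m (astr m x) = x"
  by (rule eq_matI) (auto simp: astr_def)

lemma astr_mult:
  fixes x y :: "'a::comm_ring_1 mat"
  assumes "x \<in> carrier_mat m m" "y \<in> carrier_mat m m"
  shows "astr m (x * y) = astr m y * astr m x"
proof (rule eq_matI)
  fix r c assume "r < dim_row (astr m y * astr m x)" "c < dim_col (astr m y * astr m x)"
  hence rc: "r < m" "c < m" by (auto simp: astr_def)
  have "astr m (x * y) $$ (r, c) = (\<Sum>k<m. x $$ (m - 1 - c, k) * y $$ (k, m - 1 - r))"
    using rc assms by (simp add: astr_index mult_mat_index[OF assms] del: index_mult_mat(1))
  also have "\<dots> = (\<Sum>k<m. x $$ (m - 1 - c, m - Suc k) * y $$ (m - Suc k, m - 1 - r))"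
    by (rule sum.nat_diff_reindex[symmetric])
  also have "\<dots> = (astr m y * astr m x) $$ (r, c)"
    using rc by (simp add: mult_mat_index[of _ m] astr_index mult.commute del: index_mult_mat(1))
  finally show "astr m (x * y) $$ (r, c) = (astr m y * astr m x) $$ (r, c)" .
qed (auto simp: astr_def)

lemma astr_add: "x \<in> carrier_mat m m \<Longrightarrow> y \<in> carrier_mat m m \<Longrightarrow> astr m (x + y) = astr m x + astr m y"
  by (rule eq_matI) (auto simp: astr_def)

lemma astr_minus: "x \<in> carrier_mat m m \<Longrightarrow> y \<in> carrier_mat m m \<Longrightarrow> astr m (x - y) = astr m x - astr m y"
  by (rule eq_matI) (auto simp: astr_def)

lemma astr_smult: "x \<in> carrier_mat m m \<Longrightarrow> astr m (k \<cdot>\<^sub>m x) = k \<cdot>\<^sub>m astr m x"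
  by (rule eq_matI) (auto simp: astr_def)

lemma astr_one: "astr m (1\<^sub>m m) = 1\<^sub>m m"
  by (rule eq_matI) (auto simp: astr_def one_mat_def)

section \<open>Triangular, skew and isometric matrices\<close>

definition lows :: "nat \<Rightarrow> 'a::zero mat set" where
  "lows m = {x \<in> carrier_mat m m. \<forall>r<m. \<forall>c<m. r < c \<longrightarrow> x $$ (r, c) = 0}"

definition slows :: "nat \<Rightarrow> 'a::zero mat set" where
  "slows m = {x \<in> carrier_mat m m. \<forall>r<m. \<forall>c<m. r \<le> c \<longrightarrow> x $$ (r, c) = 0}"

definition ulows :: "nat \<Rightarrow> 'a::{zero,one} mat set" where
  "ulows m = {x \<in> lows m. \<forall>r<m. x $$ (r, r) = 1}"

text \<open>For m = \<open>mdim ty n\<close> and 2 invertible this is u, see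
  \<open>lie_u_skews\<close>.\<close>

definition skews :: "nat \<Rightarrow> 'a::{zero,uminus} mat set" where
  "skews m = {x \<in> slows m. astr m x = - x}"

text \<open>The unipotent isometries of the antidiagonal form, which will turn out to be U.\<close>

definition isoms :: "nat \<Rightarrow> 'a::semiring_1 mat set" where
  "isoms m = {g \<in> ulows m. astr m g * g = 1\<^sub>m m}"

lemma lows_carrier: "x \<in> lows m \<Longrightarrow> x \<in> carrier_mat m m"
  and slows_carrier: "x \<in> slows m \<Longrightarrow> x \<in> carrier_mat m m"
  and slows_lows: "x \<in> slows m \<Longrightarrow> x \<in> lows m"
  by (auto simp: lows_def slows_def)

lemma ulows_lows: "x \<in> ulows m \<Longrightarrow> x \<in> lows m"
  and ulows_carrier: "x \<in> ulows m \<Longrightarrow> x \<in> carrier_mat m m"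
  by (auto simp: ulows_def lows_def)

lemma skews_slows: "x \<in> skews m \<Longrightarrow> x \<in> slows m"
  and skews_carrier: "x \<in> skews m \<Longrightarrow> x \<in> carrier_mat m m"
  and skews_astr: "x \<in> skews m \<Longrightarrow> astr m x = - x"
  by (auto simp: skews_def slows_def)

lemma isoms_ulows: "x \<in> isoms m \<Longrightarrow> x \<in> ulows m"
  and isoms_carrier: "x \<in> isoms m \<Longrightarrow> x \<in> carrier_mat m m"
  and isoms_astr: "x \<in> isoms m \<Longrightarrow> astr m x * x = 1\<^sub>m m"
  by (auto simp: isoms_def ulows_def lows_def)

lemma lows_mult:
  fixes x y :: "'a::semiring_0 mat"
  assumes "x \<in> lows m" "y \<in> lows m" shows "x * y \<in> lows m"
proof -
  have c: "x \<in> carrier_mat m m" "y \<in> carrier_mat m m" using assms lows_carrier by auto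
  have "(x * y) $$ (i, j) = 0" if "i < m" "j < m" "i < j" for i j
  proof -
    have "x $$ (i, k) * y $$ (k, j) = 0" if "k < m" for k
    proof (cases "i < k")
      case True thus ?thesis using assms(1) that \<open>i < m\<close> by (simp add: lows_def)
    next
      case False thus ?thesis using assms(2) that \<open>j < m\<close> \<open>i < j\<close> by (simp add: lows_def)
    qed
    thus ?thesis using that c by (simp add: scalar_prod_def)
  qed
  thus ?thesis using c by (auto simp: lows_def)
qed

lemma lows_mult_diag:
  fixes x y :: "'a::semiring_0 mat"
  assumes "x \<in> lows m" "y \<in> lows m" "i < m"
  shows "(x * y) $$ (i, i) = x $$ (i, i) * y $$ (i, i)"
proof -
  have c: "x \<in> carrier_mat m m" "y \<in> carrier_mat m m" using assms lows_carrier by auto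
  have "(x * y) $$ (i, i) = (\<Sum>k\<in>{0..<m}. x $$ (i, k) * y $$ (k, i))"
    using c assms by (simp add: scalar_prod_def)
  also have "\<dots> = (\<Sum>k\<in>{i}. x $$ (i, k) * y $$ (k, i))"
  proof (rule sum.mono_neutral_right)
    show "\<forall>k\<in>{0..<m} - {i}. x $$ (i, k) * y $$ (k, i) = 0"
    proof
      fix k assume k: "k \<in> {0..<m} - {i}"
      show "x $$ (i, k) * y $$ (k, i) = 0"
      proof (cases "i < k")
        case True thus ?thesis using assms k by (simp add: lows_def)
      next
        case False thus ?thesis using assms k by (simp add: lows_def)
      qed
    qed
  qed (use assms in auto)
  finally show ?thesis by simp
qed

lemma slows_iff: "x \<in> slows m \<longleftrightarrow> x \<in> lows m \<and> (\<forall>r<m. x $$ (r, r) = 0)"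
  by (auto simp: lows_def slows_def le_less)

lemma slows_mult_left: "x \<in> slows m \<Longrightarrow> y \<in> lows m \<Longrightarrow> x * y \<in> slows m" for x y :: "'a::semiring_0 mat"
  using lows_mult[of x m y] lows_mult_diag[of x m y] by (auto simp: slows_iff simp del: index_mult_mat(1))

lemma slows_mult_right: "x \<in> lows m \<Longrightarrow> y \<in> slows m \<Longrightarrow> x * y \<in> slows m" for x y :: "'a::semiring_0 mat"
  using lows_mult[of x m y] lows_mult_diag[of x m y] by (auto simp: slows_iff simp del: index_mult_mat(1))

lemma ulows_mult: "x \<in> ulows m \<Longrightarrow> y \<in> ulows m \<Longrightarrow> x * y \<in> ulows m" for x y :: "'a::semiring_1 mat"
  using lows_mult[of x m y] lows_mult_diag[of x m y] by (auto simp: ulows_def simp del: index_mult_mat(1))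

lemma slows_add: "x \<in> slows m \<Longrightarrow> y \<in> slows m \<Longrightarrow> x + y \<in> slows m" for x y :: "'a::monoid_add mat"
  by (auto simp: slows_def)

lemma slows_minus: "x \<in> slows m \<Longrightarrow> y \<in> slows m \<Longrightarrow> x - y \<in> slows m" for x y :: "'a::group_add mat"
  by (auto simp: slows_def)

lemma slows_smult: "x \<in> slows m \<Longrightarrow> k \<cdot>\<^sub>m x \<in> slows m" for x :: "'a::semiring_0 mat"
  by (auto simp: slows_def)

lemma lows_astr: "x \<in> lows m \<Longrightarrow> astr m x \<in> lows m"
  by (auto simp: lows_def astr_index)

lemma ulows_astr: "x \<in> ulows m \<Longrightarrow> astr m x \<in> ulows m"
  by (auto simp: ulows_def lows_astr astr_index)

lemma one_add_slows: "x \<in> slows m \<Longrightarrow> 1\<^sub>m m + x \<in> ulows m" for x :: "'a::semiring_1 mat"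
  by (auto simp: ulows_def lows_def slows_def)

lemma finite_carrier_mat: "finite (carrier_mat m k :: 'a::finite mat set)"
proof -
  have "carrier_mat m k \<subseteq> (\<lambda>f. mat m k f) ` (({..<m} \<times> {..<k}) \<rightarrow>\<^sub>E UNIV :: (nat \<times> nat \<Rightarrow> 'a) set)"
  proof
    fix x :: "'a mat" assume x: "x \<in> carrier_mat m k"
    hence "x = mat m k (restrict (\<lambda>p. x $$ p) ({..<m} \<times> {..<k}))" by (intro eq_matI) auto
    thus "x \<in> (\<lambda>f. mat m k f) ` (({..<m} \<times> {..<k}) \<rightarrow>\<^sub>E UNIV)" 
      by (intro image_eqI[of x "mat m k" "restrict (\<lambda>p. x $$ p) ({..<m} \<times> {..<k})"]) auto
  qed
  thus ?thesis by (rule finite_subset) (intro finite_imageI finite_PiE; simp)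
qed

lemma finite_ulows: "finite (ulows m :: 'a::{finite,zero,one} mat set)"
  by (rule finite_subset[OF _ finite_carrier_mat[of m m]]) (auto dest: ulows_carrier)

lemma finite_slows: "finite (slows m :: 'a::{finite,zero} mat set)"
  by (rule finite_subset[OF _ finite_carrier_mat[of m m]]) (auto dest: slows_carrier)

text \<open>Determinant 1 gives some inverse. That it is again unitriangular follows by counting:
  multiplication by A is an injective self-map of a finite set, so it reaches the unit
  matrix.\<close>

lemma ulows_inverse:
  fixes A :: "'q::{field,finite} mat"
  assumes A: "A \<in> ulows m"
  shows "\<exists>B\<in>ulows m. A * B = 1\<^sub>m m \<and> B * A = 1\<^sub>m m"
proof -
  have Ac: "A \<in> carrier_mat m m" using A ulows_carrier by auto
  have "det A = prod_list (diag_mat A)"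
    using A by (intro det_lower_triangular[OF _ Ac]) (auto simp: ulows_def lows_def)
  also have "\<dots> = 1"
    using A Ac by (auto simp: prod_list_diag_prod ulows_def)
  finally have "A \<in> Units (ring_mat TYPE('q) m ())" by (intro det_non_zero_imp_unit[OF Ac]) simp
  then obtain C where C: "C \<in> carrier_mat m m" "A * C = 1\<^sub>m m" "C * A = 1\<^sub>m m"
    by (auto simp: Units_def ring_mat_simps)
  have inj: "inj_on (\<lambda>h. A * h) (ulows m)"
  proof (rule inj_onI)
    fix h k assume hk: "h \<in> ulows m" "k \<in> ulows m" "A * h = A * k"
    have c: "h \<in> carrier_mat m m" "k \<in> carrier_mat m m" using hk ulows_carrier by blast+
    have "h = C * (A * h)" "k = C * (A * k)"
      using assoc_mult_mat[OF C(1) Ac c(1)] assoc_mult_mat[OF C(1) Ac c(2)] C(3) c by simp_all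
    thus "h = k" using hk(3) by simp
  qed
  have "(\<lambda>h. A * h) ` ulows m = ulows m"
    by (rule endo_inj_surj[OF finite_ulows _ inj]) (auto intro: ulows_mult A)
  moreover have "1\<^sub>m m \<in> (ulows m :: 'q mat set)" by (auto simp: ulows_def lows_def)
  ultimately obtain B where B: "B \<in> ulows m" "A * B = 1\<^sub>m m" by (metis imageE)
  have Bc: "B \<in> carrier_mat m m" using B ulows_carrier by blast
  have "B = (C * A) * B" using C Bc by simp
  also have "\<dots> = C * (A * B)" using C Bc Ac by (intro assoc_mult_mat) auto
  also have "\<dots> = C" using B C by simp
  finally show ?thesis using B C by auto
qed

text \<open>The Cayley correspondence \<open>g = (1 - x) (1 + x)\<^sup>-\<^sup>1\<close>, written symmetrically.\<close>

definition cayley :: "nat \<Rightarrow> 'q::field mat \<Rightarrow> 'q mat \<Rightarrow> bool" where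
  "cayley m x g \<longleftrightarrow> (1\<^sub>m m + x) * (1\<^sub>m m + g) = 2 \<cdot>\<^sub>m 1\<^sub>m m \<and> (1\<^sub>m m + g) * (1\<^sub>m m + x) = 2 \<cdot>\<^sub>m 1\<^sub>m m"

lemma cayley_sym: "cayley m x g \<longleftrightarrow> cayley m g x"
  by (auto simp: cayley_def)

lemma cayley_unique:
  fixes g :: "'q::field mat"
  assumes two: "(2::'q) \<noteq> 0" and c: "x \<in> carrier_mat m m" "g \<in> carrier_mat m m" "h \<in> carrier_mat m m"
    and "cayley m x g" "cayley m x h"
  shows "g = h"
proof -
  let ?A = "1\<^sub>m m + x" and ?B = "1\<^sub>m m + g" and ?C = "1\<^sub>m m + h"
  have "?B * (?A * ?C) = (?B * ?A) * ?C" using c by (intro assoc_mult_mat[symmetric]) auto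
  hence "?B * (2 \<cdot>\<^sub>m 1\<^sub>m m) = (2 \<cdot>\<^sub>m 1\<^sub>m m) * ?C" using assms by (simp add: cayley_def)
  moreover have "?B * (2 \<cdot>\<^sub>m 1\<^sub>m m) = 2 \<cdot>\<^sub>m ?B"
    using c mult_smult_distrib[of ?B m m "1\<^sub>m m" m 2] by simp
  moreover have "(2 \<cdot>\<^sub>m 1\<^sub>m m) * ?C = 2 \<cdot>\<^sub>m ?C"
    using c mult_smult_assoc_mat[of "1\<^sub>m m" m m ?C m 2] by simp
  ultimately have eq: "2 \<cdot>\<^sub>m ?B = 2 \<cdot>\<^sub>m ?C" by simp
  show "g = h"
  proof (rule eq_matI)
    fix i j assume "i < dim_row h" "j < dim_col h"
    hence ij: "i < m" "j < m" using c by auto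
    have "(2 \<cdot>\<^sub>m ?B) $$ (i, j) = (2 \<cdot>\<^sub>m ?C) $$ (i, j)" using eq by simp
    thus "g $$ (i, j) = h $$ (i, j)" using ij c two by (simp add: distrib_left)
  qed (use c in auto)
qed

lemma cayley_ex:
  fixes x :: "'q::{field,finite} mat"
  assumes x: "x \<in> slows m"
  shows "\<exists>g\<in>ulows m. cayley m x g"
proof -
  let ?A = "1\<^sub>m m + x"
  obtain B where B: "B \<in> ulows m" "?A * B = 1\<^sub>m m" "B * ?A = 1\<^sub>m m"
    using ulows_inverse[OF one_add_slows[OF x]] by auto
  have c: "?A \<in> carrier_mat m m" "B \<in> carrier_mat m m" using slows_carrier[OF x] ulows_carrier[OF B(1)] by auto
  define g where "g = 2 \<cdot>\<^sub>m B - 1\<^sub>m m"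
  have g1: "1\<^sub>m m + g = 2 \<cdot>\<^sub>m B" using c by (intro eq_matI) (auto simp: g_def)
  have "g \<in> ulows m" using B c by (auto simp: g_def ulows_def lows_def)
  moreover have "?A * (2 \<cdot>\<^sub>m B) = 2 \<cdot>\<^sub>m 1\<^sub>m m" using mult_smult_distrib[OF c] B by simp
  moreover have "(2 \<cdot>\<^sub>m B) * ?A = 2 \<cdot>\<^sub>m 1\<^sub>m m" using mult_smult_assoc_mat[OF c(2,1)] B by simp
  ultimately show ?thesis by (intro bexI[of _ g]) (simp_all add: cayley_def g1)
qed

lemma cayley_ex':
  fixes g :: "'q::{field,finite} mat"
  assumes g: "g \<in> ulows m" and two: "(2::'q) \<noteq> 0"
  shows "\<exists>x\<in>slows m. cayley m x g"
proof -
  \<comment> \<open>Half of 1 + g is again unitriangular, and its inverse is the desired 1 +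
    x.\<close>
  define h where "h = (1 / 2) \<cdot>\<^sub>m (1\<^sub>m m + g)"
  have gc: "g \<in> carrier_mat m m" using g ulows_carrier by auto
  have "h \<in> ulows m" using g two gc by (auto simp: h_def ulows_def lows_def)
  then obtain B where B: "B \<in> ulows m" "h * B = 1\<^sub>m m" "B * h = 1\<^sub>m m" using ulows_inverse by blast
  have c: "h \<in> carrier_mat m m" "B \<in> carrier_mat m m" using gc ulows_carrier[OF B(1)] by (auto simp: h_def)
  define x where "x = B - 1\<^sub>m m"
  have x1: "1\<^sub>m m + x = B" using c by (intro eq_matI) (auto simp: x_def)
  have g1: "1\<^sub>m m + g = 2 \<cdot>\<^sub>m h" using gc two by (intro eq_matI) (auto simp: h_def)
  have "x \<in> slows m" using B c by (auto simp: x_def ulows_def lows_def slows_def le_less)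
  moreover have "B * (2 \<cdot>\<^sub>m h) = 2 \<cdot>\<^sub>m 1\<^sub>m m" using mult_smult_distrib[OF c(2,1)] B by simp
  moreover have "(2 \<cdot>\<^sub>m h) * B = 2 \<cdot>\<^sub>m 1\<^sub>m m" using mult_smult_assoc_mat[OF c] B by simp
  ultimately show ?thesis by (intro bexI[of _ x]) (simp_all add: cayley_def g1 x1)
qed

lemma smult_two_one:
  fixes X :: "'q::field mat"
  assumes "X \<in> carrier_mat m m"
  shows "X * (2 \<cdot>\<^sub>m 1\<^sub>m m) = 2 \<cdot>\<^sub>m X" "(2 \<cdot>\<^sub>m 1\<^sub>m m) * X = 2 \<cdot>\<^sub>m X"
  using assms mult_smult_distrib[of X m m "1\<^sub>m m" m 2] mult_smult_assoc_mat[of "1\<^sub>m m" m m X m 2] by auto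

lemma smult_two_cancel:
  fixes X Y :: "'q::field mat"
  assumes "(2::'q) \<noteq> 0" "X \<in> carrier_mat m m" "Y \<in> carrier_mat m m" "2 \<cdot>\<^sub>m X = 2 \<cdot>\<^sub>m Y"
  shows "X = Y"
proof (rule eq_matI)
  fix i j assume "i < dim_row Y" "j < dim_col Y"
  hence "2 * X $$ (i, j) = 2 * Y $$ (i, j)"
    using arg_cong[OF assms(4), of "\<lambda>M. M $$ (i, j)"] assms(2,3) by simp
  thus "X $$ (i, j) = Y $$ (i, j)" using assms(1) by simp
qed (use assms in auto)

text \<open>With A = 1 + x, B = 1 + g and adjoints A', B', the two conditions read
  \<open>B' * B = B' + B\<close> and A + A' = 2. As A B = 2, multiplying by A' and A, or by B' and
  B, on the left and right turns one into the other.\<close>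

lemma cayley_isoms_iff:
  fixes x g :: "'q::field mat"
  assumes two: "(2::'q) \<noteq> 0" and c: "x \<in> carrier_mat m m" "g \<in> carrier_mat m m" and cay: "cayley m x g"
  shows "astr m g * g = 1\<^sub>m m \<longleftrightarrow> astr m x = - x"
proof -
  define A B A' B' where defs: "A = 1\<^sub>m m + x" "B = 1\<^sub>m m + g" "A' = 1\<^sub>m m + astr m x" "B' = 1\<^sub>m m + astr m g"
  have cc: "A \<in> carrier_mat m m" "B \<in> carrier_mat m m" "A' \<in> carrier_mat m m" "B' \<in> carrier_mat m m"
    using c by (auto simp: defs)
  have st: "astr m A = A'" "astr m B = B'" using c by (simp_all add: defs astr_add astr_one)
  have AB: "A * B = 2 \<cdot>\<^sub>m 1\<^sub>m m" "B * A = 2 \<cdot>\<^sub>m 1\<^sub>m m" using cay by (auto simp: cayley_def defs)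
  have AB': "B' * A' = 2 \<cdot>\<^sub>m 1\<^sub>m m" "A' * B' = 2 \<cdot>\<^sub>m 1\<^sub>m m"
    using astr_mult[OF cc(1,2)] astr_mult[OF cc(2,1)] unfolding st AB by (simp_all add: astr_smult astr_one)
  have e1: "astr m g * g = 1\<^sub>m m \<longleftrightarrow> B' * B = B' + B"
  proof -
    have "B' * B = (1\<^sub>m m + g) + (astr m g + astr m g * g)"
      unfolding defs using c
        add_mult_distrib_mat[of "1\<^sub>m m" m m "astr m g" "1\<^sub>m m + g" m]
        mult_add_distrib_mat[of "astr m g" m m "1\<^sub>m m" m g]
        right_mult_one_mat[OF astr_carrier[of m g]] by simp
    moreover have "(1\<^sub>m m + g) + (astr m g + G) = B' + B \<longleftrightarrow> G = 1\<^sub>m m"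
      if G: "G \<in> carrier_mat m m" for G
    proof
      assume eq: "(1\<^sub>m m + g) + (astr m g + G) = B' + B"
      show "G = 1\<^sub>m m"
      proof (rule eq_matI)
        fix i j assume ij: "i < dim_row (1\<^sub>m m)" "j < dim_col (1\<^sub>m m)"
        have "((1\<^sub>m m + g) + (astr m g + G)) $$ (i, j) = (B' + B) $$ (i, j)" by (simp only: eq)
        thus "G $$ (i, j) = 1\<^sub>m m $$ (i, j)"
          using ij G c carrier_matD[OF astr_carrier[of m g]] by (simp add: defs algebra_simps)
      qed (use G in auto)
    next
      assume "G = 1\<^sub>m m"
      thus "(1\<^sub>m m + g) + (astr m g + G) = B' + B"
        using c carrier_matD[OF astr_carrier[of m g]] by (intro eq_matI) (auto simp: defs)
    qed
    moreover have "astr m g * g \<in> carrier_mat m m" using c mult_carrier_mat[OF astr_carrier] by blast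
    ultimately show ?thesis by simp
  qed
  have e2: "astr m x = - x \<longleftrightarrow> A + A' = 2 \<cdot>\<^sub>m 1\<^sub>m m"
  proof
    assume "astr m x = - x"
    thus "A + A' = 2 \<cdot>\<^sub>m 1\<^sub>m m" using c by (intro eq_matI) (auto simp: defs)
  next
    assume eq: "A + A' = 2 \<cdot>\<^sub>m 1\<^sub>m m"
    show "astr m x = - x"
    proof (rule eq_matI)
      fix i j assume ij: "i < dim_row (- x)" "j < dim_col (- x)"
      have "(A + A') $$ (i, j) = (2 \<cdot>\<^sub>m 1\<^sub>m m) $$ (i, j)" by (simp only: eq)
      thus "astr m x $$ (i, j) = (- x) $$ (i, j)"
        using ij c carrier_matD[OF astr_carrier[of m x]]
        by (auto simp: defs eq_neg_iff_add_eq_0 add.commute split: if_splits)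
    qed (use c carrier_matD[OF astr_carrier[of m x]] in auto)
  qed
  show ?thesis unfolding e1 e2
  proof
    assume eq: "B' * B = B' + B"
    have "A' * (B' * B) * A = (A' * B') * (B * A)"
      using cc by (simp add: assoc_mult_mat[of _ m m _ m _ m])
    also have "\<dots> = 2 \<cdot>\<^sub>m (2 \<cdot>\<^sub>m 1\<^sub>m m)" by (simp add: AB AB' smult_two_one[of _ m])
    finally have "2 \<cdot>\<^sub>m (2 \<cdot>\<^sub>m 1\<^sub>m m) = A' * (B' + B) * A" by (simp add: eq)
    also have "\<dots> = (A' * B') * A + A' * (B * A)"
      using cc by (simp add: assoc_mult_mat[of _ m m _ m _ m] add_mult_distrib_mat[of _ m m]
          mult_add_distrib_mat[of _ m m])
    also have "\<dots> = 2 \<cdot>\<^sub>m (A + A')"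
      using cc by (simp add: AB AB' smult_two_one add_smult_distrib_left_mat[of _ m m])
    finally show "A + A' = 2 \<cdot>\<^sub>m 1\<^sub>m m" using smult_two_cancel[OF two, of "2 \<cdot>\<^sub>m 1\<^sub>m m" m "A + A'"] cc by simp
  next
    assume eq: "A + A' = 2 \<cdot>\<^sub>m 1\<^sub>m m"
    have "2 \<cdot>\<^sub>m (B' * B) = B' * (A + A') * B"
      using cc by (simp add: eq smult_two_one mult_smult_assoc_mat[of _ m m])
    also have "\<dots> = B' * (A * B) + (B' * A') * B"
      using cc by (simp add: assoc_mult_mat[of _ m m _ m _ m] add_mult_distrib_mat[of _ m m]
          mult_add_distrib_mat[of _ m m])
    also have "\<dots> = 2 \<cdot>\<^sub>m (B' + B)"
      using cc by (simp add: AB AB' smult_two_one add_smult_distrib_left_mat[of _ m m])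
    finally show "B' * B = B' + B" using smult_two_cancel[OF two, of "B' * B" m "B' + B"] cc by simp
  qed
qed

section \<open>Orbits and radicals\<close>

lemma mult_square_carrier [simp]:
  "A \<in> carrier_mat m m \<Longrightarrow> B \<in> carrier_mat m m \<Longrightarrow> A * B \<in> carrier_mat m m"
  by (rule mult_carrier_mat)

lemma astr_dim [simp]: "dim_row (astr m x) = m" "dim_col (astr m x) = m"
  by (simp_all add: astr_def)

lemma restrict_eq_iff: "restrict f A = restrict g A \<longleftrightarrow> (\<forall>x\<in>A. f x = g x)"
  by (metis restrict_apply' restrict_ext)

lemma skews_conj:
  fixes A z :: "'q::comm_ring_1 mat"
  assumes A: "A \<in> lows m" and z: "z \<in> skews m"
  shows "astr m A * z * A \<in> skews m"
proof -
  have c: "A \<in> carrier_mat m m" "z \<in> carrier_mat m m" using A z lows_carrier skews_carrier by auto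
  have "astr m (astr m A * z * A) = astr m A * (astr m z * A)"
    using c by (simp add: astr_mult[of _ m] astr_astr)
  also have "\<dots> = - (astr m A * z * A)"
    using c by (simp add: skews_astr[OF z] assoc_mult_mat[of _ m m _ m _ m])
  finally show ?thesis
    using slows_mult_left[OF slows_mult_right[OF lows_astr[OF A] skews_slows[OF z]] A]
    by (simp add: skews_def)
qed

lemma skews_commutator:
  fixes x z :: "'q::comm_ring_1 mat"
  assumes x: "x \<in> skews m" and z: "z \<in> skews m"
  shows "x * z - z * x \<in> skews m"
proof -
  have c: "x \<in> carrier_mat m m" "z \<in> carrier_mat m m" using x z skews_carrier by auto
  have "x * z - z * x \<in> slows m"
    using x z skews_slows slows_lows by (intro slows_minus slows_mult_left) auto
  moreover have "astr m (x * z - z * x) = z * x - x * z"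
    using c by (simp add: astr_minus astr_mult[of _ m] skews_astr[OF x] skews_astr[OF z])
  moreover have "z * x - x * z = - (x * z - z * x)" using c by (intro eq_matI) auto
  ultimately show ?thesis by (simp add: skews_def)
qed

definition linform :: "nat \<Rightarrow> ('q::field mat \<Rightarrow> 'q) \<Rightarrow> bool" where
  "linform m f \<longleftrightarrow> (\<forall>x\<in>skews m. \<forall>y\<in>skews m. f (x + y) = f x + f y) \<and> (\<forall>c. \<forall>x\<in>skews m. f (c \<cdot>\<^sub>m x) = c * f x)"

definition rad :: "nat \<Rightarrow> ('q::field mat \<Rightarrow> 'q) \<Rightarrow> 'q mat set" where
  "rad m f = {x \<in> skews m. \<forall>z\<in>skews m. f (x * z - z * x) = 0}"

lemma skews_smult: "x \<in> skews m \<Longrightarrow> k \<cdot>\<^sub>m x \<in> skews m" for x :: "'q::comm_ring_1 mat"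
  unfolding skews_def using slows_smult[of x m k] by (auto simp: astr_smult slows_carrier intro!: eq_matI)

lemma isoms_right_inverse: "g \<in> isoms m \<Longrightarrow> g * astr m g = 1\<^sub>m m" for g :: "'q::field mat"
  by (rule mat_mult_left_right_inverse[of "astr m g" m g]) (auto simp: isoms_carrier isoms_astr)

lemma isoms_astr_closed: "g \<in> isoms m \<Longrightarrow> astr m g \<in> isoms m" for g :: "'q::field mat"
  using isoms_right_inverse[of g m] ulows_astr[of g m]
  by (simp add: isoms_def astr_astr ulows_carrier)

lemma isoms_mult:
  fixes g h :: "'q::field mat"
  assumes "g \<in> isoms m" "h \<in> isoms m"
  shows "g * h \<in> isoms m"
proof -
  have c: "g \<in> carrier_mat m m" "h \<in> carrier_mat m m" using assms isoms_carrier by auto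
  have "astr m (g * h) * (g * h) = astr m h * ((astr m g * g) * h)"
    using c by (simp add: astr_mult[of _ m] assoc_mult_mat[of _ m m _ m _ m])
  also have "\<dots> = 1\<^sub>m m" using c assms by (simp add: isoms_astr)
  finally show ?thesis using assms ulows_mult[of g m h] by (simp add: isoms_def)
qed

lemma finite_isoms: "finite (isoms m :: 'q::{field,finite} mat set)"
  by (rule finite_subset[OF _ finite_ulows[of m]]) (auto dest: isoms_ulows)

lemma finite_skews: "finite (skews m :: 'q::{field,finite} mat set)"
  by (rule finite_subset[OF _ finite_slows[of m]]) (auto dest: skews_slows)

text \<open>With \<open>A = 1 + x\<close> one has \<open>g A = A g = A\<^sup>*\<close>. Every element of \<open>\<uu>\<close> is of the form \<open>A\<^sup>* z A\<close>,
  and \<open>g\<^sup>-\<^sup>1 (A\<^sup>* z A) g = A z A\<^sup>* = A\<^sup>* z A + 2 [x, z]\<close>.\<close>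

lemma cayley_stabilizer_iff:
  fixes x g :: "'q::{field,finite} mat"
  assumes two: "(2::'q) \<noteq> 0" and f: "linform m f"
    and x: "x \<in> skews m" and g: "g \<in> isoms m" and cay: "cayley m x g"
  shows "(\<forall>y\<in>skews m. f (astr m g * y * g) = f y) \<longleftrightarrow> x \<in> rad m f"
proof -
  define A A' where defs: "A = 1\<^sub>m m + x" "A' = 1\<^sub>m m - x"
  have xc: "x \<in> carrier_mat m m" and gc: "g \<in> carrier_mat m m" using x g skews_carrier isoms_carrier by auto
  have c: "A \<in> carrier_mat m m" "A' \<in> carrier_mat m m" using xc by (auto simp: defs)
  have Au: "A \<in> ulows m" using one_add_slows[OF skews_slows[OF x]] by (simp add: defs)
  have st: "astr m A = A'"
    using xc by (simp add: defs astr_add astr_one skews_astr[OF x]) (auto intro!: eq_matI)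
  hence st': "astr m A' = A" using astr_astr c by metis
  have gA: "g * A = A'" "A * g = A'"
  proof -
    have "(1\<^sub>m m + g) * A = A + g * A"
      using c gc add_mult_distrib_mat[of "1\<^sub>m m" m m g A m] by simp
    moreover have "A * (1\<^sub>m m + g) = A + A * g"
      using c gc mult_add_distrib_mat[of A m m "1\<^sub>m m" m g] by simp
    ultimately have *: "A + g * A = 2 \<cdot>\<^sub>m 1\<^sub>m m" "A + A * g = 2 \<cdot>\<^sub>m 1\<^sub>m m"
      using cay by (simp_all add: cayley_def defs)
    have uniq: "Y = A'" if "A + Y = 2 \<cdot>\<^sub>m 1\<^sub>m m" "Y \<in> carrier_mat m m" for Y
    proof (rule eq_matI)
      fix i j assume ij: "i < dim_row A'" "j < dim_col A'"
      have "(A + Y) $$ (i, j) = (2 \<cdot>\<^sub>m 1\<^sub>m m) $$ (i, j)" using that by simp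
      thus "Y $$ (i, j) = A' $$ (i, j)"
        using ij that(2) xc by (auto simp: defs algebra_simps split: if_splits)
    qed (use that c in auto)
    show "g * A = A'" "A * g = A'" using uniq[OF *(1)] uniq[OF *(2)] c gc by simp_all
  qed
  have gA': "A' * astr m g = A" "astr m g * A' = A"
    using astr_mult[OF gc c(1)] astr_mult[OF c(1) gc] st st' gA by auto
  have conj: "astr m g * (A' * z * A) * g = A * z * A'" if z: "z \<in> carrier_mat m m" for z
  proof -
    have "astr m g * (A' * z * A) * g = (astr m g * A') * z * (A * g)"
      using c gc z by (simp add: assoc_mult_mat[of _ m m _ m _ m])
    thus ?thesis by (simp add: gA gA')
  qed
  have key: "A * z * A' = A' * z * A + 2 \<cdot>\<^sub>m (x * z - z * x)" if z: "z \<in> carrier_mat m m" for z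
  proof -
    define p q r where pqr: "p = x * z" "q = z * x" "r = x * z * x"
    have pc: "p \<in> carrier_mat m m" "q \<in> carrier_mat m m" "r \<in> carrier_mat m m" using xc z by (auto simp: pqr)
    have "A * z = z + p" using xc z add_mult_distrib_mat[of "1\<^sub>m m" m m x z m] by (simp add: defs pqr)
    moreover have "(z + p) * A' = (z + p) - (z + p) * x"
      using xc z pc mult_minus_distrib_mat[of "z + p" m m "1\<^sub>m m" m x] by (simp add: defs)
    moreover have "(z + p) * x = q + r"
      using xc z pc add_mult_distrib_mat[of z m m p x m] by (simp add: pqr)
    ultimately have 1: "A * z * A' = (z + p) - (q + r)" by simp
    have "A' * z = z - p" using xc z minus_mult_distrib_mat[of "1\<^sub>m m" m m x z m] by (simp add: defs pqr)
    moreover have "(z - p) * A = (z - p) + (z - p) * x"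
      using xc z pc mult_add_distrib_mat[of "z - p" m m "1\<^sub>m m" m x] minus_carrier_mat[OF pc(1), of z] by (simp add: defs)
    moreover have "(z - p) * x = q - r"
      using xc z pc minus_mult_distrib_mat[of z m m p x m] by (simp add: pqr)
    ultimately have 2: "A' * z * A = (z - p) + (q - r)" by simp
    have "(z + p) - (q + r) = (z - p) + (q - r) + 2 \<cdot>\<^sub>m (p - q)"
      using z pc by (intro eq_matI) (auto simp: algebra_simps)
    thus ?thesis using 1 2 by (simp add: pqr)
  qed
  \<comment> \<open>Since \<open>skews m\<close> is finite, injectivity suffices to write each of
    its elements as \<open>A' * z * A\<close>.\<close>
  have inj: "inj_on (\<lambda>z. A' * z * A) (skews m)"
  proof (rule inj_onI)
    fix y z assume yz: "y \<in> skews m" "z \<in> skews m" "A' * y * A = A' * z * A"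
    have yzc: "y \<in> carrier_mat m m" "z \<in> carrier_mat m m" using yz skews_carrier by auto
    obtain B where B: "B \<in> ulows m" "A * B = 1\<^sub>m m" using ulows_inverse[OF Au] by auto
    have Bc: "B \<in> carrier_mat m m" using B ulows_carrier by blast
    have BA': "astr m B * A' = 1\<^sub>m m" using astr_mult[OF c(1) Bc] B st by (simp add: astr_one)
    have red: "astr m B * (A' * w * A) * B = w" if w: "w \<in> carrier_mat m m" for w
    proof -
      have "astr m B * (A' * w * A) * B = (astr m B * A') * w * (A * B)"
        using c Bc w by (simp add: assoc_mult_mat[of _ m m _ m _ m])
      thus ?thesis using w by (simp add: BA' B)
    qed
    have "y = astr m B * (A' * y * A) * B" using red[OF yzc(1)] by (rule sym)
    also have "\<dots> = astr m B * (A' * z * A) * B" by (simp only: yz(3))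
    also have "\<dots> = z" by (rule red[OF yzc(2)])
    finally show "y = z" .
  qed
  have surj: "(\<lambda>z. A' * z * A) ` skews m = skews m"
    by (rule endo_inj_surj[OF finite_skews _ inj]) (use skews_conj[OF ulows_lows[OF Au]] st in auto)
  have "(\<forall>y\<in>skews m. f (astr m g * y * g) = f y) \<longleftrightarrow>
      (\<forall>y\<in>(\<lambda>z. A' * z * A) ` skews m. f (astr m g * y * g) = f y)" by (simp only: surj)
  also have "\<dots> \<longleftrightarrow> (\<forall>z\<in>skews m. f (x * z - z * x) = 0)"
  proof (unfold ball_simps, rule ball_cong[OF refl])
    fix z :: "'q mat" assume z: "z \<in> skews m"
    have zc: "z \<in> carrier_mat m m" using z skews_carrier by blast
    have "f (A * z * A') = f (A' * z * A) + 2 * f (x * z - z * x)"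
      using f skews_conj[OF ulows_lows[OF Au] z] skews_commutator[OF x z]
        skews_smult[OF skews_commutator[OF x z], of 2]
      unfolding key[OF zc] by (simp add: linform_def st)
    thus "f (astr m g * (A' * z * A) * g) = f (A' * z * A) \<longleftrightarrow> f (x * z - z * x) = 0"
      using two by (simp add: conj[OF zc])
  qed
  finally show ?thesis using x by (simp add: rad_def)
qed

text \<open>Used twice: with trivial predicates it shows that isometries and skew matrices are
  equally many, with the stabiliser and the radical that those are. Only a bijection is needed, not
  a homomorphism.\<close>

lemma card_cayley:
  fixes P Q :: "'q::{field,finite} mat \<Rightarrow> bool"
  assumes two: "(2::'q) \<noteq> 0"
    and PQ: "\<And>x g. x \<in> skews m \<Longrightarrow> g \<in> isoms m \<Longrightarrow> cayley m x g \<Longrightarrow> P g \<longleftrightarrow> Q x"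
  shows "card {g \<in> isoms m. P g} = card {x \<in> skews m. Q x}"
proof -
  have ex: "\<exists>x\<in>skews m. cayley m x g" if g: "g \<in> isoms m" for g :: "'q mat"
  proof -
    obtain x where x: "x \<in> slows m" "cayley m x g"
      using cayley_ex'[OF isoms_ulows[OF g] two] by blast
    hence "astr m x = - x"
      using cayley_isoms_iff[OF two slows_carrier[OF x(1)] isoms_carrier[OF g] x(2)] isoms_astr[OF g] by simp
    thus ?thesis using x by (auto simp: skews_def)
  qed
  have ex': "\<exists>g\<in>isoms m. cayley m x g" if x: "x \<in> skews m" for x :: "'q mat"
  proof -
    obtain g where g: "g \<in> ulows m" "cayley m x g"
      using cayley_ex[OF skews_slows[OF x]] by blast
    hence "astr m g * g = 1\<^sub>m m"
      using cayley_isoms_iff[OF two skews_carrier[OF x] ulows_carrier[OF g(1)] g(2)] skews_astr[OF x] by simp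
    thus ?thesis using g by (auto simp: isoms_def)
  qed
  define X where "X g = (SOME x. x \<in> skews m \<and> cayley m x g)" for g :: "'q mat"
  have X: "X g \<in> skews m \<and> cayley m (X g) g" if "g \<in> isoms m" for g
    unfolding X_def using someI_ex[of "\<lambda>x. x \<in> skews m \<and> cayley m x g"] ex[OF that] by blast
  have "bij_betw X {g \<in> isoms m. P g} {x \<in> skews m. Q x}"
    unfolding bij_betw_def
  proof
    show "inj_on X {g \<in> isoms m. P g}"
    proof (rule inj_onI)
      fix g h assume gh: "g \<in> {g \<in> isoms m. P g}" "h \<in> {g \<in> isoms m. P g}" "X g = X h"
      show "g = h"
        by (rule cayley_unique[OF two, of "X g" m]) (use gh X[of g] X[of h] in \<open>auto dest: skews_carrier isoms_carrier\<close>)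
    qed
    show "X ` {g \<in> isoms m. P g} = {x \<in> skews m. Q x}"
    proof
      show "X ` {g \<in> isoms m. P g} \<subseteq> {x \<in> skews m. Q x}" using X PQ by blast
      show "{x \<in> skews m. Q x} \<subseteq> X ` {g \<in> isoms m. P g}"
      proof
        fix x assume x: "x \<in> {x \<in> skews m. Q x}"
        then obtain g where g: "g \<in> isoms m" "cayley m x g" using ex' by blast
        have "X g = x"
          by (rule cayley_unique[OF two, of g m])
            (use g x X[OF g(1)] cayley_sym in \<open>auto dest: skews_carrier isoms_carrier\<close>)
        thus "x \<in> X ` {g \<in> isoms m. P g}" using g x PQ by blast
      qed
    qed
  qed
  thus ?thesis by (rule bij_betw_same_card)
qed

lemma card_isoms: "(2::'q) \<noteq> 0 \<Longrightarrow> card (isoms m :: 'q mat set) = card (skews m :: 'q::{field,finite} mat set)"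
  using card_cayley[of m "\<lambda>_. True" "\<lambda>_. True"] by simp

text \<open>Orbit and stabiliser: the fibre of the orbit map through h is h times the stabiliser of
  f, because conjugation by h permutes \<open>skews m\<close>.\<close>

lemma card_orbit_rad:
  fixes f :: "'q::{field,finite} mat \<Rightarrow> 'q"
  assumes two: "(2::'q) \<noteq> 0" and f: "linform m f"
  defines "F \<equiv> \<lambda>g. \<lambda>y\<in>skews m. f (astr m g * y * g)"
  shows "card (F ` isoms m) * card (rad m f) = card (skews m :: 'q mat set)"
proof -
  let ?S = "{g \<in> isoms m. \<forall>y\<in>skews m. f (astr m g * y * g) = f y}"
  have S: "card ?S = card (rad m f)"
    using card_cayley[OF two, of m "\<lambda>g. \<forall>y\<in>skews m. f (astr m g * y * g) = f y" "\<lambda>x. x \<in> rad m f"]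
      cayley_stabilizer_iff[OF two f] by (simp add: rad_def)
  have conj: "astr m g * y * g \<in> skews m" if "g \<in> isoms m" "y \<in> skews m" for g y :: "'q mat"
    using skews_conj[OF ulows_lows[OF isoms_ulows[OF that(1)]] that(2)] .
  have comp: "astr m (h * k) * y * (h * k) = astr m k * (astr m h * y * h) * k"
    if "h \<in> carrier_mat m m" "k \<in> carrier_mat m m" "y \<in> carrier_mat m m" for h k y :: "'q mat"
    using that by (simp add: astr_mult[of _ m] assoc_mult_mat[of _ m m _ m _ m])
  have fib: "card {g \<in> isoms m. F g = F h} = card ?S" if h: "h \<in> isoms m" for h
  proof -
    have hc: "h \<in> carrier_mat m m" using isoms_carrier h by blast
    have h': "astr m h \<in> isoms m" using isoms_astr_closed h by blast
    have hh: "h * (astr m h * g) = g" "astr m h * (h * g) = g" if "g \<in> carrier_mat m m" for g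
    proof -
      have "h * (astr m h * g) = (h * astr m h) * g" "astr m h * (h * g) = (astr m h * h) * g"
        using hc that by (simp_all add: assoc_mult_mat[of _ m m _ m _ m])
      thus "h * (astr m h * g) = g" "astr m h * (h * g) = g"
        using that isoms_right_inverse[OF h] isoms_astr[OF h] by simp_all
    qed
    have iff: "F (h * k) = F h \<longleftrightarrow> k \<in> ?S" if k: "k \<in> isoms m" for k
    proof -
      have kc: "k \<in> carrier_mat m m" using isoms_carrier k by blast
      have surj: "(\<lambda>y. astr m h * y * h) ` skews m = skews m"
      proof (rule endo_inj_surj[OF finite_skews])
        show "inj_on (\<lambda>y. astr m h * y * h) (skews m)"
        proof (rule inj_onI)
          fix y z assume yz: "y \<in> skews m" "z \<in> skews m" "astr m h * y * h = astr m h * z * h"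
          have r: "h * (astr m h * w * h) * astr m h = w" if w: "w \<in> skews m" for w
          proof -
            have wc: "w \<in> carrier_mat m m" using w skews_carrier by blast
            have "h * (astr m h * w * h) * astr m h = (h * astr m h) * w * (h * astr m h)"
              using hc wc by (simp add: assoc_mult_mat[of _ m m _ m _ m])
            thus ?thesis using wc isoms_right_inverse[OF h] by simp
          qed
          have "y = h * (astr m h * y * h) * astr m h" using r[OF yz(1)] by (rule sym)
          also have "\<dots> = h * (astr m h * z * h) * astr m h" by (simp only: yz(3))
          also have "\<dots> = z" by (rule r[OF yz(2)])
          finally show "y = z" .
        qed
      qed (rule image_subsetI, rule conj[OF h])
      have "F (h * k) = F h \<longleftrightarrow> (\<forall>y\<in>skews m. f (astr m (h * k) * y * (h * k)) = f (astr m h * y * h))"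
        unfolding F_def by (rule restrict_eq_iff)
      also have "\<dots> \<longleftrightarrow> (\<forall>y\<in>skews m. f (astr m k * (astr m h * y * h) * k) = f (astr m h * y * h))"
        by (intro ball_cong refl) (simp add: comp[OF hc kc skews_carrier])
      also have "\<dots> \<longleftrightarrow> (\<forall>y\<in>(\<lambda>y. astr m h * y * h) ` skews m. f (astr m k * y * k) = f y)"
        by (simp only: ball_simps)
      also have "\<dots> \<longleftrightarrow> k \<in> ?S" unfolding surj using k by simp
      finally show ?thesis .
    qed
    have "bij_betw (\<lambda>k. h * k) ?S {g \<in> isoms m. F g = F h}"
    proof (rule bij_betw_byWitness[where f' = "\<lambda>g. astr m h * g"])
      show "(\<lambda>k. h * k) ` ?S \<subseteq> {g \<in> isoms m. F g = F h}"
        using iff isoms_mult[OF h] by blast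
      show "(\<lambda>g. astr m h * g) ` {g \<in> isoms m. F g = F h} \<subseteq> ?S"
      proof (rule image_subsetI)
        fix g assume g: "g \<in> {g \<in> isoms m. F g = F h}"
        hence k: "astr m h * g \<in> isoms m" using isoms_mult[OF h'] by blast
        have "h * (astr m h * g) = g" using hh(1) isoms_carrier g by blast
        thus "astr m h * g \<in> ?S" using iff[OF k] g by simp
      qed
    qed (use hh isoms_carrier in blast)+
    thus ?thesis by (rule bij_betw_same_card[symmetric])
  qed
  have "card (isoms m :: 'q mat set) = (\<Sum>w\<in>F ` isoms m. card {g \<in> isoms m. F g = w})"
    using sum.image_gen[OF finite_isoms[where 'q = 'q and m = m], of "\<lambda>_. 1::nat" F] by simp
  also have "\<dots> = (\<Sum>w\<in>F ` isoms m. card ?S)" by (rule sum.cong) (auto simp: fib)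
  finally show ?thesis using S card_isoms[OF two, of m] by simp
qed

section \<open>The exponential map\<close>

text \<open>Each factor moves at least one diagonal further down; in particular the m-th power is
  0.\<close>

lemma slows_pow_zero:
  fixes x :: "'q::comm_ring_1 mat"
  assumes x: "x \<in> slows m" and "r < m" "c < m" "r < c + k"
  shows "(x ^\<^sub>m k) $$ (r, c) = 0"
  using assms(2-4)
proof (induction k arbitrary: r c)
  case 0
  have "x \<in> carrier_mat m m" using x slows_carrier by blast
  thus ?case using 0 by (auto simp: one_mat_def)
next
  case (Suc k)
  have xc: "x \<in> carrier_mat m m" using x slows_carrier by blast
  have "(x ^\<^sub>m k) $$ (r, l) * x $$ (l, c) = 0" if l: "l < m" for l
  proof (cases "l \<le> c")
    case True
    thus ?thesis using x l Suc.prems by (simp add: slows_def)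
  next
    case False
    thus ?thesis using Suc.IH[of r l] Suc.prems l by simp
  qed
  hence "(\<Sum>l<m. (x ^\<^sub>m k) $$ (r, l) * x $$ (l, c)) = 0" by simp
  thus ?case using mult_mat_index[of "x ^\<^sub>m k" m x r c] xc Suc.prems by simp
qed

lemma pow_mat_add: "x \<in> carrier_mat m m \<Longrightarrow> x ^\<^sub>m i * x ^\<^sub>m j = x ^\<^sub>m (i + j)" for x :: "'q::comm_ring_1 mat"
proof (induction j)
  case 0 thus ?case using right_mult_one_mat[of "x ^\<^sub>m i" m m] by simp
next
  case (Suc j)
  have "x ^\<^sub>m i * (x ^\<^sub>m j * x) = (x ^\<^sub>m i * x ^\<^sub>m j) * x"
    using Suc.prems by (intro assoc_mult_mat[symmetric, of _ m m _ m _ m]) auto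
  thus ?case using Suc by simp
qed

lemma pow_mat_uminus:
  fixes x :: "'q::comm_ring_1 mat"
  assumes x: "x \<in> carrier_mat m m"
  shows "(- x) ^\<^sub>m k = (- 1) ^ k \<cdot>\<^sub>m (x ^\<^sub>m k)"
proof (induction k)
  case 0 show ?case using x by (intro eq_matI) auto
next
  case (Suc k)
  have "(- x) ^\<^sub>m Suc k = ((- 1) ^ k \<cdot>\<^sub>m (x ^\<^sub>m k)) * (- x)" using Suc by simp
  also have "\<dots> = (- 1) ^ k \<cdot>\<^sub>m (x ^\<^sub>m k * (- x))"
    using x by (intro mult_smult_assoc_mat[of _ m m _ m]) auto
  also have "x ^\<^sub>m k * (- x) = - (x ^\<^sub>m Suc k)" using x by simp
  also have "(- 1) ^ k \<cdot>\<^sub>m (- (x ^\<^sub>m Suc k)) = (- 1) ^ Suc k \<cdot>\<^sub>m (x ^\<^sub>m Suc k)"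
    using x by (intro eq_matI) (auto simp del: index_mult_mat(1))
  finally show ?case .
qed

lemma pow_mat_Suc_left: "x \<in> carrier_mat m m \<Longrightarrow> x * x ^\<^sub>m k = x ^\<^sub>m Suc k" for x :: "'q::comm_ring_1 mat"
  using pow_mat_add[of x m 1 k] by simp

lemma astr_pow:
  fixes x :: "'q::comm_ring_1 mat"
  assumes x: "x \<in> carrier_mat m m"
  shows "astr m (x ^\<^sub>m k) = astr m x ^\<^sub>m k"
proof (induction k)
  case 0 thus ?case using x astr_one by simp
next
  case (Suc k)
  have "astr m (x ^\<^sub>m Suc k) = astr m x * astr m x ^\<^sub>m k"
    using x Suc by (simp add: astr_mult[of _ m])
  thus ?case using pow_mat_Suc_left[OF astr_carrier] by simp
qed

lemma mat_exp_index:
  "r < m \<Longrightarrow> c < m \<Longrightarrow> mat_exp m x $$ (r, c) = (\<Sum>i<m. (x ^\<^sub>m i) $$ (r, c) / of_nat (fact i))"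
  by (simp add: mat_exp_def)

lemma mat_exp_carrier: "mat_exp m x \<in> carrier_mat m m"
  by (simp add: mat_exp_def)

lemma mat_exp_ulows: assumes x: "x \<in> slows m" shows "mat_exp m x \<in> ulows m"
proof -
  have xc: "x \<in> carrier_mat m m" using x slows_carrier by blast
  have "mat_exp m x $$ (r, c) = 0" if "r < c" "r < m" "c < m" for r c
    using that slows_pow_zero[OF x that(2,3)] by (simp add: mat_exp_index)
  moreover have "mat_exp m x $$ (r, r) = 1" if r: "r < m" for r
  proof -
    have "mat_exp m x $$ (r, r) = (\<Sum>i\<in>{0}. (x ^\<^sub>m i) $$ (r, r) / of_nat (fact i))"
      unfolding mat_exp_index[OF r r] using r slows_pow_zero[OF x r r]
      by (intro sum.mono_neutral_right) auto
    thus ?thesis using r xc by simp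
  qed
  ultimately show ?thesis using mat_exp_carrier[of m x] by (auto simp: ulows_def lows_def)
qed

lemma of_nat_fact_neq_0:
  assumes "CHAR('q::{field,finite}) \<ge> m" "k < m"
  shows "(of_nat (fact k) :: 'q) \<noteq> 0"
proof
  assume "(of_nat (fact k) :: 'q) = 0"
  hence "CHAR('q) dvd fact k" by (simp only: of_nat_eq_0_iff_char_dvd)
  moreover have "prime CHAR('q)" using assms by (intro prime_CHAR_semidom) auto
  ultimately have "CHAR('q) \<le> k" by (simp add: prime_dvd_fact_iff)
  thus False using assms by simp
qed

lemma two_neq_0: assumes "CHAR('q::field) \<ge> 3" shows "(2 :: 'q) \<noteq> 0"
proof
  assume "(2 :: 'q) = 0"
  hence "(of_nat 2 :: 'q) = 0" by simp
  hence "CHAR('q) dvd 2" by (simp only: of_nat_eq_0_iff_char_dvd)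
  hence "CHAR('q) \<le> 2" by (rule dvd_imp_le) simp
  thus False using assms by simp
qed

text \<open>Grouping the double sum by total degree k leaves an alternating sum of binomial
  coefficients, which vanishes for k > 0.\<close>

lemma mat_exp_uminus_mult:
  fixes x :: "'q::{field,finite} mat"
  assumes char: "CHAR('q) \<ge> m" and x: "x \<in> slows m"
  shows "mat_exp m (- x) * mat_exp m x = 1\<^sub>m m"
proof (rule eq_matI)
  fix r c assume "r < dim_row (1\<^sub>m m)" "c < dim_col (1\<^sub>m m)"
  hence rc: "r < m" "c < m" by auto
  have xc: "x \<in> carrier_mat m m" using x slows_carrier by blast
  let ?a = "\<lambda>k. (x ^\<^sub>m k) $$ (r, c)"
  define G :: "nat \<Rightarrow> nat \<Rightarrow> 'q" where
    "G i j = (- 1) ^ i / (of_nat (fact i) * of_nat (fact j)) * ?a (i + j)" for i j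
  have f: "(of_nat (fact k) :: 'q) \<noteq> 0" if "k < m" for k using of_nat_fact_neq_0[OF char that] .
  have neg: "((- x) ^\<^sub>m i) $$ (r, k) = (- 1) ^ i * (x ^\<^sub>m i) $$ (r, k)" if "k < m" for i k
    using rc that xc pow_carrier_mat[OF xc, of i] by (simp add: pow_mat_uminus[OF xc])
  have "(mat_exp m (- x) * mat_exp m x) $$ (r, c)
      = (\<Sum>k<m. (\<Sum>i<m. (- 1) ^ i * (x ^\<^sub>m i) $$ (r, k) / of_nat (fact i))
          * (\<Sum>j<m. (x ^\<^sub>m j) $$ (k, c) / of_nat (fact j)))"
    using rc by (simp add: mult_mat_index[OF mat_exp_carrier mat_exp_carrier rc] mat_exp_index neg
        del: index_mult_mat(1))
  also have "\<dots> = (\<Sum>k<m. \<Sum>i<m. \<Sum>j<m. (- 1) ^ i / (of_nat (fact i) * of_nat (fact j))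
          * ((x ^\<^sub>m i) $$ (r, k) * (x ^\<^sub>m j) $$ (k, c)))"
    unfolding sum_product by (intro sum.cong refl) simp
  also have "\<dots> = (\<Sum>i<m. \<Sum>k<m. \<Sum>j<m. (- 1) ^ i / (of_nat (fact i) * of_nat (fact j))
          * ((x ^\<^sub>m i) $$ (r, k) * (x ^\<^sub>m j) $$ (k, c)))"
    by (rule sum.swap)
  also have "\<dots> = (\<Sum>i<m. \<Sum>j<m. \<Sum>k<m. (- 1) ^ i / (of_nat (fact i) * of_nat (fact j))
          * ((x ^\<^sub>m i) $$ (r, k) * (x ^\<^sub>m j) $$ (k, c)))"
    by (intro sum.cong refl sum.swap)
  also have "\<dots> = (\<Sum>i<m. \<Sum>j<m. G i j)"
  proof (intro sum.cong refl)
    fix i j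
    have "(\<Sum>k<m. (x ^\<^sub>m i) $$ (r, k) * (x ^\<^sub>m j) $$ (k, c)) = ?a (i + j)"
      using mult_mat_index[OF pow_carrier_mat[OF xc] pow_carrier_mat[OF xc] rc, of i j] pow_mat_add[OF xc, of i j]
      by simp
    thus "(\<Sum>k<m. (- 1) ^ i / (of_nat (fact i) * of_nat (fact j))
          * ((x ^\<^sub>m i) $$ (r, k) * (x ^\<^sub>m j) $$ (k, c))) = G i j"
      unfolding G_def sum_distrib_left[symmetric] by simp
  qed
  also have "\<dots> = (\<Sum>(i, j)\<in>{..<m} \<times> {..<m}. G i j)" by (rule sum.cartesian_product)
  \<comment> \<open>Nilpotency removes the terms of total degree m or more, so truncating both
    series costs nothing.\<close>
  also have "\<dots> = (\<Sum>(i, j)\<in>{(i, j). i + j < m}. G i j)"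
  proof (rule sum.mono_neutral_right)
    have G0: "G i j = 0" if "\<not> i + j < m" for i j
      using slows_pow_zero[OF x rc, of "i + j"] rc that by (simp add: G_def)
    show "\<forall>p\<in>{..<m} \<times> {..<m} - {(i, j). i + j < m}. (case p of (i, j) \<Rightarrow> G i j) = 0"
    proof
      fix p assume "p \<in> {..<m} \<times> {..<m} - {(i, j). i + j < m}"
      thus "(case p of (i, j) \<Rightarrow> G i j) = 0" using G0[of "fst p" "snd p"] by (cases p) simp
    qed
  qed auto
  also have "\<dots> = (\<Sum>k<m. \<Sum>i\<le>k. G i (k - i))" by (rule sum.triangle_reindex)
  also have "\<dots> = (\<Sum>k<m. if k = 0 then ?a 0 else 0)"
  proof (rule sum.cong[OF refl])
    fix k assume k: "k \<in> {..<m}"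
    \<comment> \<open>As k < m, the factorials are invertible, and 1 / (i! (k - i)!) is a binomial
      coefficient divided by k!.\<close>
    have "(\<Sum>i\<le>k. G i (k - i)) = (\<Sum>i\<le>k. (- 1) ^ i * of_nat (k choose i)) * (?a k / of_nat (fact k))"
      unfolding sum_distrib_right
    proof (rule sum.cong[OF refl])
      fix i assume i: "i \<in> {..k}"
      have "(of_nat (fact i) * of_nat (fact (k - i)) * of_nat (k choose i) :: 'q) = of_nat (fact k)"
        using binomial_fact_lemma[of i k] i by (metis atMost_iff of_nat_mult)
      moreover have "(of_nat (fact i) :: 'q) \<noteq> 0" "(of_nat (fact (k - i)) :: 'q) \<noteq> 0" "(of_nat (fact k) :: 'q) \<noteq> 0"
        using f i k by auto
      ultimately have "1 / (of_nat (fact i) * of_nat (fact (k - i))) = (of_nat (k choose i) / of_nat (fact k) :: 'q)"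
        by (simp only: frac_eq_eq mult_eq_0_iff de_Morgan_disj simp_thms mult_1 mult.commute)
      hence "(- 1) ^ i * (1 / (of_nat (fact i) * of_nat (fact (k - i)))) * ?a k
          = (- 1) ^ i * (of_nat (k choose i) / of_nat (fact k)) * ?a k" by (simp only:)
      thus "G i (k - i) = (- 1) ^ i * of_nat (k choose i) * (?a k / of_nat (fact k))"
        using i by (simp add: G_def)
    qed
    thus "(\<Sum>i\<le>k. G i (k - i)) = (if k = 0 then ?a 0 else 0)"
      using choose_alternating_sum[of k, where 'a = 'q] by (cases "k = 0") auto
  qed
  also have "\<dots> = 1\<^sub>m m $$ (r, c)" using rc xc by (simp add: sum.delta)
  finally show "(mat_exp m (- x) * mat_exp m x) $$ (r, c) = 1\<^sub>m m $$ (r, c)" .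
qed (simp_all add: mat_exp_def)

text \<open>The adjoint reverses products, hence respects powers of a single matrix, so it takes exp
  x to the exponential of its adjoint - x.\<close>

lemma mat_exp_isoms:
  fixes x :: "'q::{field,finite} mat"
  assumes "CHAR('q) \<ge> m" "x \<in> skews m"
  shows "mat_exp m x \<in> isoms m"
proof -
  have xc: "x \<in> carrier_mat m m" using assms skews_carrier by blast
  have "astr m (mat_exp m x) = mat_exp m (- x)"
  proof (rule eq_matI)
    fix r c assume "r < dim_row (mat_exp m (- x))" "c < dim_col (mat_exp m (- x))"
    hence rc: "r < m" "c < m" by (auto simp: mat_exp_def)
    have "(x ^\<^sub>m i) $$ (m - 1 - c, m - 1 - r) = ((- x) ^\<^sub>m i) $$ (r, c)" for i
      using arg_cong[OF astr_pow[OF xc, of i], of "\<lambda>M. M $$ (r, c)"] rc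
      by (simp only: skews_astr[OF assms(2)] astr_index)
    thus "astr m (mat_exp m x) $$ (r, c) = mat_exp m (- x) $$ (r, c)"
      using rc by (simp add: astr_index mat_exp_index)
  qed (simp_all add: mat_exp_def)
  thus ?thesis
    using mat_exp_uminus_mult[OF assms(1) skews_slows[OF assms(2)]] mat_exp_ulows[OF skews_slows[OF assms(2)]]
    by (simp add: isoms_def)
qed

text \<open>An entry on diagonal r - c of a product of k + 1 factors uses k + 1 steps of size at
  least 1, so each step is at most r - c - k < d.\<close>

lemma pow_mat_agree:
  fixes x y :: "'q::comm_ring_1 mat"
  assumes x: "x \<in> slows m" and y: "y \<in> slows m"
    and eq: "\<And>r c. r < m \<Longrightarrow> c < m \<Longrightarrow> r < c + d \<Longrightarrow> x $$ (r, c) = y $$ (r, c)"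
    and rc: "r < m" "c < m" "r < c + d + k"
  shows "(x ^\<^sub>m Suc k) $$ (r, c) = (y ^\<^sub>m Suc k) $$ (r, c)"
  using rc
proof (induction k arbitrary: r c)
  case 0
  have "x \<in> carrier_mat m m" "y \<in> carrier_mat m m" using x y slows_carrier by blast+
  thus ?case using eq 0 by simp
next
  case (Suc k)
  have c: "x \<in> carrier_mat m m" "y \<in> carrier_mat m m" using x y slows_carrier by blast+
  have "(x ^\<^sub>m Suc k) $$ (r, l) * x $$ (l, c) = (y ^\<^sub>m Suc k) $$ (r, l) * y $$ (l, c)" if l: "l < m" for l
  proof -
    consider "l \<le> c" | "r < l + Suc k" | "c < l" "l + Suc k \<le> r" by linarith
    thus ?thesis
    proof cases
      case 1 thus ?thesis using x y l Suc.prems by (simp add: slows_def)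
    next
      case 2 thus ?thesis
        using slows_pow_zero[OF x Suc.prems(1) l 2] slows_pow_zero[OF y Suc.prems(1) l 2] by simp
    next
      case 3 thus ?thesis using Suc.IH[of r l] eq[of l c] Suc.prems l by simp
    qed
  qed
  hence "(\<Sum>l<m. (x ^\<^sub>m Suc k) $$ (r, l) * x $$ (l, c)) = (\<Sum>l<m. (y ^\<^sub>m Suc k) $$ (r, l) * y $$ (l, c))"
    by (intro sum.cong) auto
  thus ?case
    using mult_mat_index[OF pow_carrier_mat[OF c(1)] c(1) Suc.prems(1,2), of "Suc k"]
      mult_mat_index[OF pow_carrier_mat[OF c(2)] c(2) Suc.prems(1,2), of "Suc k"]
    by (simp only: pow_mat.simps)
qed

text \<open>Induction on diagonals: the terms of degree at least 2 only involve diagonals nearer to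
  the main one, so the linear term can be recovered from the exponential.\<close>

lemma mat_exp_inj:
  fixes x y :: "'q::{field,finite} mat"
  assumes x: "x \<in> slows m" and y: "y \<in> slows m" and eq: "mat_exp m x = mat_exp m y"
  shows "x = y"
proof -
  have c: "x \<in> carrier_mat m m" "y \<in> carrier_mat m m" using x y slows_carrier by blast+
  have agree: "\<forall>r<m. \<forall>c<m. r < c + d \<longrightarrow> x $$ (r, c) = y $$ (r, c)" for d
  proof (induction d)
    case 0 thus ?case using x y by (auto simp: slows_def)
  next
    case (Suc d)
    show ?case
    proof (intro allI impI)
      fix r c assume rc: "r < m" "c < m" "r < c + Suc d"
      show "x $$ (r, c) = y $$ (r, c)"
      proof (cases "r \<le> c")
        case True thus ?thesis using x y rc by (simp add: slows_def)
      next
        case False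
        let ?t = "\<lambda>x i. (x ^\<^sub>m i) $$ (r, c) / of_nat (fact i) :: 'q"
        have m: "1 \<in> {..<m}" using False rc by auto
        have "?t x i = ?t y i" if i: "i \<in> {..<m} - {1}" for i
        proof (cases i)
          case 0 thus ?thesis using c rc by simp
        next
          case (Suc k)
          hence "r < c + d + k" using i rc by auto
          hence "(x ^\<^sub>m Suc k) $$ (r, c) = (y ^\<^sub>m Suc k) $$ (r, c)"
            using Suc.IH rc by (intro pow_mat_agree[OF x y, of d]) auto
          thus ?thesis using Suc by simp
        qed
        hence "(\<Sum>i\<in>{..<m} - {1}. ?t x i) = (\<Sum>i\<in>{..<m} - {1}. ?t y i)" by (rule sum.cong[OF refl])
        moreover have "(\<Sum>i<m. ?t x i) = (\<Sum>i<m. ?t y i)"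
          using arg_cong[OF eq, of "\<lambda>M. M $$ (r, c)"] rc by (simp only: mat_exp_index)
        ultimately have "?t x 1 = ?t y 1"
          using sum.remove[OF finite_lessThan m, of "?t x"] sum.remove[OF finite_lessThan m, of "?t y"] by simp
        thus ?thesis using c rc by simp
      qed
    qed
  qed
  have "x $$ (r, c) = y $$ (r, c)" if "r < m" "c < m" for r c
    using agree[of m] that by auto
  thus ?thesis using c by (intro eq_matI) auto
qed

text \<open>Surjectivity by counting, which replaces a logarithm: exp is injective, and by the
  Cayley transform source and target have the same size.\<close>

lemma mat_exp_image:
  assumes "CHAR('q::{field,finite}) \<ge> m" "(2::'q) \<noteq> 0"
  shows "mat_exp m ` (skews m :: 'q mat set) = isoms m"
proof (rule card_subset_eq[OF finite_isoms])
  show "mat_exp m ` (skews m :: 'q mat set) \<subseteq> isoms m" using mat_exp_isoms[OF assms(1)] by blast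
  have "inj_on (mat_exp m) (skews m :: 'q mat set)"
    using mat_exp_inj skews_slows by (intro inj_onI) blast
  thus "card (mat_exp m ` (skews m :: 'q mat set)) = card (isoms m :: 'q mat set)"
    using card_isoms[OF assms(2), of m] by (simp add: card_image)
qed

section \<open>Root matrices and the commutator form\<close>

locale root_matrices =
  fixes ty :: root_type and n m :: nat
  assumes n1: "n \<ge> 1" and nD: "ty = TypeD \<Longrightarrow> n \<ge> 2" and m_def: "m = mdim ty n"
begin

abbreviation P :: "(int \<times> int) set" where "P \<equiv> sroots (ty = TypeB) (int n)"

definition idx :: "int set" where
  "idx = {v. \<bar>v\<bar> \<le> int n \<and> (ty = TypeB \<or> v \<noteq> 0)}"

text \<open>Rows and columns are labelled by \<open>idx\<close> in decreasing order, so the label \<open>v\<close> belongs to \<open>e\<^sub>v\<close>.\<close>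

definition posn :: "int \<Rightarrow> nat" where
  "posn v = (if v > 0 then n - nat v else if v = 0 then n else m - 1 - (n - nat (- v)))"

text \<open>The entry of the root vector of e_a + e_b at labels u and v: one elementary matrix sits
  at (-b, a), the negative one at its antidiagonal mirror image (-a, b).\<close>

definition rent :: "int \<times> int \<Rightarrow> int \<Rightarrow> int \<Rightarrow> 'q::field" where
  "rent \<alpha> u v = (if u = - snd \<alpha> \<and> v = fst \<alpha> then 1 else 0) - (if u = - fst \<alpha> \<and> v = snd \<alpha> then 1 else 0)"

definition rmat :: "int \<times> int \<Rightarrow> 'q::field mat" where
  "rmat \<alpha> = mat m m (\<lambda>(r, c).
     (if r = posn (- snd \<alpha>) \<and> c = posn (fst \<alpha>) then 1 else 0)
     - (if r = posn (- fst \<alpha>) \<and> c = posn (snd \<alpha>) then 1 else 0))"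

definition comb :: "(int \<times> int) set \<Rightarrow> (int \<times> int \<Rightarrow> 'q::field) \<Rightarrow> 'q mat" where
  "comb S A = mat m m (\<lambda>(r, c). \<Sum>\<gamma>\<in>S. A \<gamma> * rmat \<gamma> $$ (r, c))"

definition coef :: "'q::field mat \<Rightarrow> int \<times> int \<Rightarrow> 'q" where
  "coef x \<alpha> = x $$ (posn (- snd \<alpha>), posn (fst \<alpha>))"

lemma m_cases: "ty = TypeB \<and> m = 2 * n + 1 \<or> ty = TypeD \<and> m = 2 * n"
  by (cases ty) (auto simp: m_def mdim_def)

lemma m_ge_3: "m \<ge> 3"
  using m_cases n1 nD by auto

lemma posn_less: "v \<in> idx \<Longrightarrow> posn v < m"
  using m_cases n1 unfolding idx_def posn_def by auto

lemma posn_less_iff: "u \<in> idx \<Longrightarrow> v \<in> idx \<Longrightarrow> posn u < posn v \<longleftrightarrow> v < u"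
  using m_cases n1 unfolding idx_def posn_def by (elim disjE) auto

lemma posn_eq_iff: "u \<in> idx \<Longrightarrow> v \<in> idx \<Longrightarrow> posn u = posn v \<longleftrightarrow> u = v"
  using posn_less_iff[of u v] posn_less_iff[of v u] by linarith

lemma posn_le_iff: "u \<in> idx \<Longrightarrow> v \<in> idx \<Longrightarrow> posn u \<le> posn v \<longleftrightarrow> v \<le> u"
  using posn_less_iff[of v u] by linarith

lemma posn_uminus: "v \<in> idx \<Longrightarrow> posn (- v) = m - 1 - posn v"
  using m_cases n1 unfolding idx_def posn_def by (elim disjE) auto

lemma idx_uminus: "v \<in> idx \<Longrightarrow> - v \<in> idx"
  by (auto simp: idx_def)

lemma finite_idx: "finite idx"
  by (rule finite_subset[of _ "{- int n..int n}"]) (auto simp: idx_def)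

lemma posn_image: "posn ` idx = {..<m}"
proof (rule card_subset_eq)
  show "posn ` idx \<subseteq> {..<m}" using posn_less by auto
  have "card (posn ` idx) = card idx"
    using posn_eq_iff by (intro card_image inj_onI) blast
  also have "card idx = m"
  proof (cases "ty = TypeB")
    case True
    hence "idx = {- int n..int n}" unfolding idx_def by auto
    thus ?thesis using m_cases True by simp
  next
    case False
    hence "idx = {- int n..int n} - {0}" unfolding idx_def by auto
    moreover have "card ({- int n..int n} - {0}) = 2 * n" by (subst card_Diff_singleton) auto
    ultimately show ?thesis using m_cases False by simp
  qed
  finally show "card (posn ` idx) = card {..<m}" by simp
qed simp

lemma posn_bij: "bij_betw posn idx {..<m}"
  using posn_image posn_eq_iff by (auto simp: bij_betw_def intro!: inj_onI)

lemma mat_eqI_idx: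
  assumes "x \<in> carrier_mat m m" "y \<in> carrier_mat m m"
    and "\<And>u v. u \<in> idx \<Longrightarrow> v \<in> idx \<Longrightarrow> x $$ (posn u, posn v) = y $$ (posn u, posn v)"
  shows "x = y"
proof (rule eq_matI)
  fix r c assume "r < dim_row y" "c < dim_col y"
  hence "r \<in> posn ` idx" "c \<in> posn ` idx" using assms(2) posn_image by auto
  thus "x $$ (r, c) = y $$ (r, c)" using assms(3) by blast
qed (use assms in auto)

lemma P_idx: "(a, b) \<in> P \<Longrightarrow> a \<in> idx \<and> b \<in> idx \<and> - a \<in> idx \<and> - b \<in> idx"
  by (auto simp: sroots_def idx_def)

lemma rmat_carrier [simp]: "rmat \<alpha> \<in> carrier_mat m m"
  by (simp add: rmat_def)

lemma rmat_index:
  assumes "\<alpha> \<in> P" "u \<in> idx" "v \<in> idx"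
  shows "rmat \<alpha> $$ (posn u, posn v) = rent \<alpha> u v"
proof -
  have "fst \<alpha> \<in> idx" "snd \<alpha> \<in> idx" "- fst \<alpha> \<in> idx" "- snd \<alpha> \<in> idx"
    using P_idx[of "fst \<alpha>" "snd \<alpha>"] assms(1) by auto
  thus ?thesis using assms(2,3) by (simp add: rmat_def rent_def posn_less posn_eq_iff)
qed

lemma comb_carrier [simp]: "comb S A \<in> carrier_mat m m"
  by (simp add: comb_def)

lemma comb_index:
  fixes A :: "int \<times> int \<Rightarrow> 'q::field"
  assumes S: "S \<subseteq> P" and uv: "u \<in> idx" "v \<in> idx"
  shows "comb S A $$ (posn u, posn v) =
    (if (v, - u) \<in> S then A (v, - u) else 0) - (if (- u, v) \<in> S then A (- u, v) else 0)"
proof -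
  have fin: "finite S" using S finite_sroots finite_subset by blast
  have "comb S A $$ (posn u, posn v) = (\<Sum>\<gamma>\<in>S. A \<gamma> * rent \<gamma> u v)"
    using uv S by (auto simp: comb_def posn_less rmat_index intro!: sum.cong)
  also have "\<dots> = (\<Sum>\<gamma>\<in>S. (if \<gamma> = (v, - u) then A \<gamma> else 0) - (if \<gamma> = (- u, v) then A \<gamma> else 0))"
  proof (rule sum.cong[OF refl])
    fix \<gamma> :: "int \<times> int"
    have "(u = - snd \<gamma> \<and> v = fst \<gamma>) = (\<gamma> = (v, - u))" "(u = - fst \<gamma> \<and> v = snd \<gamma>) = (\<gamma> = (- u, v))"
      by (cases \<gamma>; force)+
    thus "A \<gamma> * rent \<gamma> u v = (if \<gamma> = (v, - u) then A \<gamma> else 0) - (if \<gamma> = (- u, v) then A \<gamma> else 0)"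
      unfolding rent_def by (simp only: right_diff_distrib if_distrib[of "\<lambda>x. A \<gamma> * x"] mult_1_right mult_zero_right)
  qed
  also have "\<dots> = (if (v, - u) \<in> S then A (v, - u) else 0) - (if (- u, v) \<in> S then A (- u, v) else 0)"
    using fin by (simp add: sum_subtractf sum.delta)
  finally show ?thesis .
qed

lemma comb_skews:
  fixes A :: "int \<times> int \<Rightarrow> 'q::field"
  assumes S: "S \<subseteq> P"
  shows "comb S A \<in> skews m"
proof -
  have nP: "(v, - u) \<notin> S" "(- u, v) \<notin> S" if "v \<le> u" for u v
    using that S by (auto simp: sroots_def)
  have "comb S A \<in> slows m"
  proof -
    have "comb S A $$ (r, c) = 0" if rc: "r < m" "c < m" "r \<le> c" for r c
    proof -
      obtain u v where uv: "u \<in> idx" "v \<in> idx" "r = posn u" "c = posn v"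
        using rc posn_image by (metis imageE lessThan_iff)
      hence "v \<le> u" using rc posn_le_iff by simp
      thus ?thesis using nP[of v u] by (simp add: uv comb_index[OF S uv(1,2)])
    qed
    thus ?thesis by (auto simp: slows_def)
  qed
  moreover have "astr m (comb S A) = - comb S A"
  proof (rule mat_eqI_idx)
    fix u v assume uv: "u \<in> idx" "v \<in> idx"
    have "astr m (comb S A) $$ (posn u, posn v) = comb S A $$ (posn (- v), posn (- u))"
      using uv by (simp add: astr_index posn_less posn_uminus)
    also have "\<dots> = - (comb S A $$ (posn u, posn v))"
      using comb_index[OF S uv, of A] comb_index[OF S idx_uminus[OF uv(2)] idx_uminus[OF uv(1)], of A] by simp
    also have "\<dots> = (- comb S A) $$ (posn u, posn v)"
      using posn_less uv carrier_matD[OF comb_carrier[of S A]] by simp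
    finally show "astr m (comb S A) $$ (posn u, posn v) = (- comb S A) $$ (posn u, posn v)" .
  qed simp_all
  ultimately show ?thesis by (simp add: skews_def)
qed

lemma coef_comb: assumes S: "S \<subseteq> P" and \<alpha>: "\<alpha> \<in> S" shows "coef (comb S A) \<alpha> = A \<alpha>"
proof -
  obtain a b where ab: "\<alpha> = (a, b)" by force
  have P: "(a, b) \<in> P" using S \<alpha> ab by auto
  hence "(b, a) \<notin> P" by (auto simp: sroots_def)
  hence "(b, a) \<notin> S" using S by blast
  thus ?thesis using comb_index[OF S, of "- b" a A] P_idx[OF P] \<alpha> by (simp add: coef_def ab)
qed

text \<open>Below the diagonal, reflection in the antidiagonal pairs the two positions of each root
  vector. On the antidiagonal an entry equals its own negative, so it is 0 because 2 is
  nonzero.\<close>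

lemma comb_coef:
  fixes x :: "'q::field mat"
  assumes two: "(2::'q) \<noteq> 0" and x: "x \<in> skews m"
  shows "comb P (coef x) = x"
proof (rule mat_eqI_idx)
  fix u v assume uv: "u \<in> idx" "v \<in> idx"
  have xc: "x \<in> carrier_mat m m" using x skews_carrier by blast
  have skew: "x $$ (posn (- v), posn (- u)) = - x $$ (posn u, posn v)"
  proof -
    have "astr m x $$ (posn u, posn v) = (- x) $$ (posn u, posn v)" by (simp only: skews_astr[OF x])
    thus ?thesis using uv xc by (simp add: astr_index posn_less posn_uminus)
  qed
  have uvP: "(v, - u) \<in> P \<longleftrightarrow> \<bar>u\<bar> < v" "(- u, v) \<in> P \<longleftrightarrow> \<bar>v\<bar> < - u"
    using uv by (auto simp: sroots_def idx_def)
  consider "\<bar>u\<bar> < v" | "\<bar>v\<bar> < - u" | "v \<le> u" | "v = - u" "\<not> \<bar>u\<bar> < v" "\<not> \<bar>v\<bar> < - u" by linarith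
  hence "(if (v, - u) \<in> P then coef x (v, - u) else 0) - (if (- u, v) \<in> P then coef x (- u, v) else 0)
      = x $$ (posn u, posn v)"
  proof cases
    case 1
    thus ?thesis unfolding uvP by (simp add: coef_def)
  next
    case 2
    thus ?thesis unfolding uvP by (simp add: coef_def skew)
  next
    case 3
    hence "x $$ (posn u, posn v) = 0"
      using skews_slows[OF x] uv posn_le_iff posn_less by (auto simp: slows_def)
    moreover have "\<not> \<bar>u\<bar> < v" "\<not> \<bar>v\<bar> < - u" using 3 by linarith+
    ultimately show ?thesis unfolding uvP by simp
  next
    case 4
    hence "x $$ (posn u, posn v) = - x $$ (posn u, posn v)" using skew by simp
    hence "2 * x $$ (posn u, posn v) = 0" by (metis add.right_inverse mult_2)
    thus ?thesis using 4 two unfolding uvP by simp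
  qed
  thus "comb P (coef x) $$ (posn u, posn v) = x $$ (posn u, posn v)"
    by (simp add: comb_index[OF subset_refl uv])
qed (use x skews_carrier in auto)

lemma rmat_comb: assumes "\<alpha> \<in> P" shows "rmat \<alpha> = comb P (\<lambda>\<gamma>. if \<gamma> = \<alpha> then 1 else 0)"
  using assms finite_sroots by (intro eq_matI) (auto simp: comb_def rmat_def if_distrib[of "\<lambda>x. x * _"] sum.delta cong: if_cong)

lemma rmat_skews: "\<alpha> \<in> P \<Longrightarrow> rmat \<alpha> \<in> skews m"
  using comb_skews[OF subset_refl] by (simp add: rmat_comb)

lemma root_mat_rmat:
  assumes "\<alpha> \<in> pos_roots ty n"
  shows "root_mat ty n \<alpha> = rmat (enc n \<alpha>)"
proof -
  have I: "idx_pos ty n (int i) = posn (int n + 1 - int i)" "idx_pos ty n (- int i) = posn (int i - int n - 1)"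
    if "1 \<le> i" "i \<le> n" for i
    using that m_cases by (auto simp: idx_pos_def posn_def m_def[symmetric])
  have Z: "idx_pos ty n 0 = posn 0" by (simp add: idx_pos_def posn_def)
  consider i where "\<alpha> = Short i" "1 \<le> i" "i \<le> n"
    | i j where "\<alpha> = Minus i j" "1 \<le> i" "i < j" "j \<le> n"
    | i j where "\<alpha> = Plus i j" "1 \<le> i" "i < j" "j \<le> n"
    using assms by (auto simp: pos_roots_def split: root_type.splits)
  thus ?thesis
  proof cases
    case 1 thus ?thesis
      by (intro eq_matI) (auto simp: rmat_def elem_mat_def m_def[symmetric] I Z diff_diff_eq)
  next
    case (2 i j) thus ?thesis
      by (intro eq_matI) (auto simp: rmat_def elem_mat_def m_def[symmetric] I diff_diff_eq)
  next
    case (3 i j) thus ?thesis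
      by (intro eq_matI) (auto simp: rmat_def elem_mat_def m_def[symmetric] I diff_diff_eq)
  qed
qed

text \<open>Replaces the span of the root vectors by matrix equations, which is the form to which
  the Cayley transform applies.\<close>

lemma lie_u_skews:
  assumes two: "(2::'q::field) \<noteq> 0"
  shows "lie_u ty n = (skews m :: 'q mat set)"
proof
  have bij: "bij_betw (enc n) (pos_roots ty n) P" by (rule enc_bij)
  have sum: "(\<Sum>\<alpha>\<in>pos_roots ty n. A (enc n \<alpha>) * root_mat ty n \<alpha> $$ (r, c)) = (\<Sum>\<gamma>\<in>P. A \<gamma> * rmat \<gamma> $$ (r, c))"
    for A :: "int \<times> int \<Rightarrow> 'q" and r c
  proof -
    have "(\<Sum>\<alpha>\<in>pos_roots ty n. A (enc n \<alpha>) * root_mat ty n \<alpha> $$ (r, c))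
        = (\<Sum>\<alpha>\<in>pos_roots ty n. A (enc n \<alpha>) * rmat (enc n \<alpha>) $$ (r, c))"
      by (rule sum.cong[OF refl]) (simp add: root_mat_rmat)
    also have "\<dots> = (\<Sum>\<gamma>\<in>P. A \<gamma> * rmat \<gamma> $$ (r, c))"
      by (rule sum.reindex_bij_betw[OF bij])
    finally show ?thesis .
  qed
  show "lie_u ty n \<subseteq> (skews m :: 'q mat set)"
  proof
    fix x :: "'q mat" assume "x \<in> lie_u ty n"
    then obtain a where x: "x = mat m m (\<lambda>(r, c). \<Sum>\<alpha>\<in>pos_roots ty n. a \<alpha> * root_mat ty n \<alpha> $$ (r, c))"
      by (auto simp: lie_u_def m_def)
    define A where "A = a \<circ> inv_into (pos_roots ty n) (enc n)"
    have A: "a \<alpha> = A (enc n \<alpha>)" if "\<alpha> \<in> pos_roots ty n" for \<alpha>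
      using bij that by (simp add: A_def bij_betw_def)
    have "x = comb P A" unfolding x comb_def sum[symmetric]
      by (intro eq_matI) (auto intro!: sum.cong simp: A)
    thus "x \<in> skews m" using comb_skews[OF subset_refl] by simp
  qed
  show "(skews m :: 'q mat set) \<subseteq> lie_u ty n"
  proof
    fix x :: "'q mat" assume "x \<in> skews m"
    hence "x = comb P (coef x)" using comb_coef[OF two] by simp
    also have "\<dots> = mat m m (\<lambda>(r, c). \<Sum>\<alpha>\<in>pos_roots ty n. (coef x \<circ> enc n) \<alpha> * root_mat ty n \<alpha> $$ (r, c))"
      unfolding comb_def sum[symmetric] by simp
    finally show "x \<in> lie_u ty n" unfolding lie_u_def m_def by blast
  qed
qed

lemma skews_add: "x \<in> skews m \<Longrightarrow> y \<in> skews m \<Longrightarrow> x + y \<in> (skews m :: 'q::field mat set)"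
proof -
  assume xy: "x \<in> skews m" "y \<in> skews m"
  hence c: "x \<in> carrier_mat m m" "y \<in> carrier_mat m m" using skews_carrier by auto
  have "astr m (x + y) = - (x + y)"
    using c by (simp add: astr_add skews_astr[OF xy(1)] skews_astr[OF xy(2)]) (intro eq_matI; auto)
  thus ?thesis using slows_add[OF skews_slows[OF xy(1)] skews_slows[OF xy(2)]] by (simp add: skews_def)
qed

lemma linform_comb:
  fixes f :: "'q::field mat \<Rightarrow> 'q"
  assumes f: "linform m f" and S: "S \<subseteq> P"
  shows "f (comb S A) = (\<Sum>\<gamma>\<in>S. A \<gamma> * f (rmat \<gamma>))"
proof -
  have "finite S" using S finite_sroots finite_subset by blast
  thus ?thesis using S
  proof (induction S)
    case empty
    have "comb {} A = 0 \<cdot>\<^sub>m comb {} A" by (intro eq_matI) (auto simp: comb_def)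
    hence "f (comb {} A) = 0 * f (comb {} A)"
      using f comb_skews[of "{}" A] unfolding linform_def by (metis empty_subsetI)
    thus ?case by simp
  next
    case (insert \<alpha> S)
    have "comb (insert \<alpha> S) A = A \<alpha> \<cdot>\<^sub>m rmat \<alpha> + comb S A"
      using insert.hyps by (intro eq_matI) (auto simp: comb_def rmat_def)
    moreover have "rmat \<alpha> \<in> (skews m :: 'q mat set)" "comb S A \<in> skews m"
      using insert.prems rmat_skews comb_skews by blast+
    ultimately have "f (comb (insert \<alpha> S) A) = A \<alpha> * f (rmat \<alpha>) + f (comb S A)"
      using f skews_smult[of "rmat \<alpha>" m "A \<alpha>"] unfolding linform_def by simp
    thus ?case using insert by simp
  qed
qed

lemma linform_commutator:
  fixes f :: "'q::field mat \<Rightarrow> 'q"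
  assumes f: "linform m f" and z: "z \<in> skews m"
  shows "linform m (\<lambda>x. f (x * z - z * x))" "linform m (\<lambda>x. f (z * x - x * z))"
proof -
  have zc: "z \<in> carrier_mat m m" using z skews_carrier by blast
  note comm = skews_commutator[OF _ z] skews_commutator[OF z]
  have 1: "(x + y) * z - z * (x + y) = (x * z - z * x) + (y * z - z * y)"
    and 2: "z * (x + y) - (x + y) * z = (z * x - x * z) + (z * y - y * z)"
    if "x \<in> skews m" "y \<in> skews m" for x y
  proof -
    have c: "x \<in> carrier_mat m m" "y \<in> carrier_mat m m" using that skews_carrier by auto
    have *: "(x + y) * z = x * z + y * z" "z * (x + y) = z * x + z * y"
      using c zc add_mult_distrib_mat[of x m m y z m] mult_add_distrib_mat[of z m m x m y] by auto
    show "(x + y) * z - z * (x + y) = (x * z - z * x) + (y * z - z * y)"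
      "z * (x + y) - (x + y) * z = (z * x - x * z) + (z * y - y * z)"
      unfolding * using c zc by (intro eq_matI; simp del: index_mult_mat(1))+
  qed
  have 3: "(k \<cdot>\<^sub>m x) * z - z * (k \<cdot>\<^sub>m x) = k \<cdot>\<^sub>m (x * z - z * x)"
    and 4: "z * (k \<cdot>\<^sub>m x) - (k \<cdot>\<^sub>m x) * z = k \<cdot>\<^sub>m (z * x - x * z)"
    if "x \<in> skews m" for x k
  proof -
    have c: "x \<in> carrier_mat m m" using that skews_carrier by auto
    have *: "(k \<cdot>\<^sub>m x) * z = k \<cdot>\<^sub>m (x * z)" "z * (k \<cdot>\<^sub>m x) = k \<cdot>\<^sub>m (z * x)"
      using c zc mult_smult_assoc_mat[of x m m z m k] mult_smult_distrib[of z m m x m k] by auto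
    show "(k \<cdot>\<^sub>m x) * z - z * (k \<cdot>\<^sub>m x) = k \<cdot>\<^sub>m (x * z - z * x)"
      "z * (k \<cdot>\<^sub>m x) - (k \<cdot>\<^sub>m x) * z = k \<cdot>\<^sub>m (z * x - x * z)"
      unfolding * using c zc by (intro eq_matI; simp add: right_diff_distrib del: index_mult_mat(1))+
  qed
  show "linform m (\<lambda>x. f (x * z - z * x))" "linform m (\<lambda>x. f (z * x - x * z))"
    using f comm by (auto simp: linform_def 1 2 3 4)
qed

lemma card_skews:
  assumes two: "(2::'q::{field,finite}) \<noteq> 0"
  shows "card (skews m :: 'q mat set) = CARD('q) ^ card P"
proof -
  have "bij_betw (comb P) (P \<rightarrow>\<^sub>E UNIV) (skews m :: 'q mat set)"
  proof (rule bij_betw_byWitness[where f' = "\<lambda>x. restrict (coef x) P"])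
    show "\<forall>A\<in>P \<rightarrow>\<^sub>E UNIV. restrict (coef (comb P A)) P = A"
      using coef_comb[OF subset_refl] by (fastforce simp: fun_eq_iff PiE_def extensional_def)
    show "\<forall>x\<in>skews m. comb P (restrict (coef x) P) = (x :: 'q mat)"
    proof
      fix x :: "'q mat" assume "x \<in> skews m"
      moreover have "comb P (restrict (coef x) P) = comb P (coef x)"
        unfolding comb_def by (intro eq_matI) (auto intro!: sum.cong)
      ultimately show "comb P (restrict (coef x) P) = x" using comb_coef[OF two] by simp
    qed
  qed (use comb_skews[OF subset_refl] in auto)
  hence "card (P \<rightarrow>\<^sub>E (UNIV :: 'q set)) = card (skews m :: 'q mat set)" by (rule bij_betw_same_card)
  thus ?thesis by (simp add: card_funcsetE finite_sroots)
qed

text \<open>In coordinates for the root vectors the radical is the kernel of the matrix of the form,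
  since by linearity z may be restricted to root vectors.\<close>

lemma card_rad:
  fixes f :: "'q::{field,finite} mat \<Rightarrow> 'q"
  assumes two: "(2::'q) \<noteq> 0" and f: "linform m f"
  shows "card (rad m f) = card (coeff_kernel P (\<lambda>\<alpha> \<gamma>. f (rmat \<alpha> * rmat \<gamma> - rmat \<gamma> * rmat \<alpha>)))"
proof -
  let ?B = "\<lambda>\<alpha> \<gamma>. f (rmat \<alpha> * rmat \<gamma> - rmat \<gamma> * rmat \<alpha>)"
  have iff: "comb P A \<in> rad m f \<longleftrightarrow> (\<forall>\<gamma>\<in>P. (\<Sum>\<alpha>\<in>P. A \<alpha> * ?B \<alpha> \<gamma>) = 0)" for A
  proof -
    have x: "comb P A \<in> skews m" by (rule comb_skews[OF subset_refl])
    have val: "f (comb P A * rmat \<gamma> - rmat \<gamma> * comb P A) = (\<Sum>\<alpha>\<in>P. A \<alpha> * ?B \<alpha> \<gamma>)" if "\<gamma> \<in> P" for \<gamma>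
      using linform_comb[OF linform_commutator(1)[OF f rmat_skews[OF that]] subset_refl] .
    have "(\<forall>z\<in>skews m. f (comb P A * z - z * comb P A) = 0)
        \<longleftrightarrow> (\<forall>\<gamma>\<in>P. f (comb P A * rmat \<gamma> - rmat \<gamma> * comb P A) = 0)"
    proof
      assume *: "\<forall>\<gamma>\<in>P. f (comb P A * rmat \<gamma> - rmat \<gamma> * comb P A) = 0"
      show "\<forall>z\<in>skews m. f (comb P A * z - z * comb P A) = 0"
      proof
        fix z :: "'q mat" assume "z \<in> skews m"
        hence z: "z = comb P (coef z)" using comb_coef[OF two] by simp
        show "f (comb P A * z - z * comb P A) = 0"
          by (subst (1 2) z, subst linform_comb[OF linform_commutator(2)[OF f x] subset_refl])
            (simp add: *)
      qed
    qed (use rmat_skews in blast)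
    thus ?thesis using x val by (simp add: rad_def)
  qed
  have "bij_betw (comb P) (coeff_kernel P ?B) (rad m f)"
  proof (rule bij_betw_byWitness[where f' = "\<lambda>x. restrict (coef x) P"])
    have r: "comb P (restrict (coef x) P) = comb P (coef x)" for x :: "'q mat"
      unfolding comb_def by (intro eq_matI) (auto intro!: sum.cong)
    show "\<forall>A\<in>coeff_kernel P ?B. restrict (coef (comb P A)) P = A"
      using coef_comb[OF subset_refl] by (fastforce simp: coeff_kernel_def fun_eq_iff PiE_def extensional_def)
    show *: "\<forall>x\<in>rad m f. comb P (restrict (coef x) P) = x"
      using comb_coef[OF two] by (simp add: r rad_def)
    show "comb P ` coeff_kernel P ?B \<subseteq> rad m f" using iff by (auto simp: coeff_kernel_def)
    show "(\<lambda>x. restrict (coef x) P) ` rad m f \<subseteq> coeff_kernel P ?B"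
    proof (rule image_subsetI)
      fix x assume x: "x \<in> rad m f"
      hence "comb P (restrict (coef x) P) \<in> rad m f" using * by simp
      thus "restrict (coef x) P \<in> coeff_kernel P ?B" unfolding iff coeff_kernel_def by simp
    qed
  qed
  thus ?thesis by (rule bij_betw_same_card[symmetric])
qed

section \<open>Commutators of root vectors\<close>

lemma rmat_mult_index:
  assumes \<alpha>: "(a, b) \<in> P" and \<gamma>: "\<gamma> \<in> P" and cd: "(c, d) \<in> P"
  shows "(rmat (a, b) * rmat \<gamma>) $$ (posn (- d), posn c) =
    (if d = b then rent \<gamma> a c else 0) - (if d = a then rent \<gamma> b c else (0::'q::field))"
proof -
  have I: "a \<in> idx" "b \<in> idx" "- d \<in> idx" "c \<in> idx" using P_idx[OF \<alpha>] P_idx[OF cd] by auto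
  have ab: "a \<noteq> b" using \<alpha> by (auto simp: sroots_def)
  have "(rmat (a, b) * rmat \<gamma>) $$ (posn (- d), posn c)
      = (\<Sum>k<m. rmat (a, b) $$ (posn (- d), k) * (rmat \<gamma> $$ (k, posn c) :: 'q))"
    by (rule mult_mat_index) (simp_all add: I posn_less)
  also have "\<dots> = (\<Sum>w\<in>idx. rmat (a, b) $$ (posn (- d), posn w) * (rmat \<gamma> $$ (posn w, posn c) :: 'q))"
    by (rule sum.reindex_bij_betw[OF posn_bij, symmetric])
  also have "\<dots> = (\<Sum>w\<in>idx. rent (a, b) (- d) w * rent \<gamma> w c)"
    by (rule sum.cong[OF refl]) (simp add: rmat_index[OF \<alpha>] rmat_index[OF \<gamma>] I)
  also have "\<dots> = (\<Sum>w\<in>{a, b}. rent (a, b) (- d) w * rent \<gamma> w c)"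
    using I finite_idx by (intro sum.mono_neutral_right) (auto simp: rent_def)
  also have "\<dots> = (if d = b then rent \<gamma> a c else 0) - (if d = a then rent \<gamma> b c else 0)"
    using ab by (auto simp: rent_def[of "(a, b)"])
  finally show ?thesis .
qed

text \<open>The sum of (a, b) and (a', b') is a root when one label of each cancels: a with b', a'
  with b, or b with b', where the remaining a and a' may come in either order. All other products of
  entries contradict |b| < a, |b'| < a' or |d| < c.\<close>

lemma rook_term:
  assumes \<alpha>: "(a, b) \<in> P" and \<gamma>: "(a', b') \<in> P" and cd: "(c, d) \<in> P"
  shows "coef (rmat (a, b) * rmat (a', b') - rmat (a', b') * rmat (a, b)) (c, d) =
    ((if d = b \<and> c = a' \<and> a = - b' then 1 else 0) - (if d = a \<and> c = a' \<and> b = - b' then 1 else 0)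
      - (if d = b' \<and> c = a \<and> a' = - b then 1 else 0) + (if d = a' \<and> c = a \<and> b = - b' then 1 else 0) :: 'q::field)"
proof -
  have ord: "\<bar>b\<bar> < a" "\<bar>b'\<bar> < a'" "\<bar>d\<bar> < c" using \<alpha> \<gamma> cd by (auto simp: sroots_def)
  have I: "posn (- d) < m" "posn c < m" using P_idx[OF cd] posn_less by auto
  have dims: "dim_row (rmat \<beta> :: 'q mat) = m" "dim_col (rmat \<beta> :: 'q mat) = m" for \<beta>
    by (simp_all add: rmat_def)
  have rent: "rent (x, y) u v = (if u = - y \<and> v = x then 1 else (0::'q))"
    if "\<not> (u = - x \<and> v = y)" for x y u v
    using that by (simp add: rent_def)
  have "\<not> (a = - a')" "\<not> (a' = - a)" using ord by linarith+
  hence r1: "rent (a', b') a c = (if a = - b' \<and> c = a' then 1 else (0::'q))"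
    and r2: "rent (a, b) a' c = (if a' = - b \<and> c = a then 1 else (0::'q))"
    by (simp_all add: rent)
  have "d = a \<Longrightarrow> \<not> (b = - a' \<and> c = b')" "d = a' \<Longrightarrow> \<not> (b' = - a \<and> c = b)" using ord by linarith+
  hence r3: "(if d = a then rent (a', b') b c else 0) = (if d = a \<and> b = - b' \<and> c = a' then 1 else (0::'q))"
    and r4: "(if d = a' then rent (a, b) b' c else 0) = (if d = a' \<and> b' = - b \<and> c = a then 1 else (0::'q))"
    using rent[of b a' c b'] rent[of b' a c b]
    by presburger+
  have sw: "b' = - b \<longleftrightarrow> b = - b'" by linarith
  have "coef (rmat (a, b) * rmat (a', b') - rmat (a', b') * rmat (a, b)) (c, d)
      = (rmat (a, b) * rmat (a', b')) $$ (posn (- d), posn c) - (rmat (a', b') * rmat (a, b) :: 'q mat) $$ (posn (- d), posn c)"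
    using I by (simp add: coef_def dims del: index_mult_mat(1))
  thus ?thesis
    unfolding rmat_mult_index[OF \<alpha> \<gamma> cd] rmat_mult_index[OF \<gamma> \<alpha> cd] r1 r2 r3 r4 sw
    by (simp add: conj_ac if_bool_eq_conj)
qed

end

context rook_involution
begin

text \<open>Adjacency in the shape of the four terms of \<open>rook_term\<close>; further orders of
  the matched labels contradict the ordering inside the pairs.\<close>

lemma adj_iff:
  assumes \<alpha>: "(a, b) \<in> sroots short n" and \<gamma>: "(a', b') \<in> sroots short n"
  shows "adj (a, b) (a', b') \<longleftrightarrow> (\<exists>\<beta>\<in>D. snd \<beta> = b \<and> fst \<beta> = a' \<and> a = - b'
    \<or> snd \<beta> = a \<and> fst \<beta> = a' \<and> b = - b' \<or> snd \<beta> = b' \<and> fst \<beta> = a \<and> a' = - b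
    \<or> snd \<beta> = a' \<and> fst \<beta> = a \<and> b = - b')"
proof -
  have ord: "\<bar>b\<bar> < a" "\<bar>b'\<bar> < a'" using \<alpha> \<gamma> by (auto simp: sroots_def)
  have no: "(x, y) \<notin> D" if "x \<le> \<bar>y\<bar>" for x y using D_D[of x y] that by auto
  have "a' = - b \<Longrightarrow> b' \<le> \<bar>a\<bar>" "b' = - a \<Longrightarrow> b \<le> \<bar>a'\<bar>" using ord by linarith+
  hence no': "a' = - b \<Longrightarrow> (b', a) \<notin> D" "b' = - a \<Longrightarrow> (b, a') \<notin> D" using no by blast+
  have sw: "b' = - b \<longleftrightarrow> b = - b'" "b' = - a \<longleftrightarrow> a = - b'" by linarith+
  have 1: "mt a a' \<and> b' = - b \<longleftrightarrow> ((a', a) \<in> D \<or> (a, a') \<in> D) \<and> b = - b'"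
    unfolding mt_def sw by blast
  have 2: "mt a b' \<and> a' = - b \<longleftrightarrow> (a, b') \<in> D \<and> a' = - b"
    using no'(1) unfolding mt_def by blast
  have 3: "mt b a' \<and> b' = - a \<longleftrightarrow> (a', b) \<in> D \<and> a = - b'"
    using no'(2) unfolding mt_def sw by blast
  have 4: "\<not> (mt b b' \<and> a' = - a)" using ord by linarith
  have ex: "(\<exists>\<beta>\<in>D. snd \<beta> = y \<and> fst \<beta> = x \<and> Q) \<longleftrightarrow> (x, y) \<in> D \<and> Q" for x y Q
    by (metis fst_conv snd_conv prod.collapse)
  show ?thesis unfolding adj.simps 1 2 3 bex_disj_distrib ex using 4 by blast
qed

end

text \<open>At most one term survives and it is 1 or -1, so no characteristic can make the sum
  vanish.\<close>

lemma exclusive_signs_eq_0_iff: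
  assumes "\<not> (p \<and> q)" "\<not> (p \<and> r)" "\<not> (p \<and> t)" "\<not> (q \<and> r)" "\<not> (q \<and> t)" "\<not> (r \<and> t)"
  shows "(if p then 1 else 0) - (if q then 1 else 0) - (if r then 1 else 0) + (if t then 1 else 0) = (0::'q::field)
    \<longleftrightarrow> \<not> (p \<or> q \<or> r \<or> t)"
  using assms by auto

context root_matrices
begin

text \<open>\<open>\<alpha>\<close> and \<open>\<gamma>\<close> determine the member of D that can
  be their sum, so at most one term of the sum over D is nonzero. Hence whether it vanishes depends
  on D and not on \<open>\<xi>\<close>.\<close>

lemma rook_commutator_adj:
  fixes \<xi> :: "int \<times> int \<Rightarrow> 'q::field"
  assumes rook: "rook_involution (ty = TypeB) (int n) D s"
    and \<xi>: "\<And>\<beta>. \<beta> \<in> D \<Longrightarrow> \<xi> \<beta> \<noteq> 0" and \<alpha>: "\<alpha> \<in> P" and \<gamma>: "\<gamma> \<in> P"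
  shows "(\<Sum>\<beta>\<in>D. \<xi> \<beta> * coef (rmat \<alpha> * rmat \<gamma> - rmat \<gamma> * rmat \<alpha>) \<beta>) \<noteq> 0
    \<longleftrightarrow> rook_involution.adj D \<alpha> \<gamma>"
proof -
  interpret rook_involution "ty = TypeB" "int n" D s by (rule rook)
  obtain a b where ab: "\<alpha> = (a, b)" by force
  obtain a' b' where ab': "\<gamma> = (a', b')" by force
  have ord: "\<bar>b\<bar> < a" "\<bar>b'\<bar> < a'" using \<alpha> \<gamma> by (auto simp: sroots_def ab ab')
  let ?M = "rmat \<alpha> * rmat \<gamma> - rmat \<gamma> * rmat \<alpha> :: 'q mat"
  define C where "C \<beta> \<longleftrightarrow> snd \<beta> = b \<and> fst \<beta> = a' \<and> a = - b' \<or> snd \<beta> = a \<and> fst \<beta> = a' \<and> b = - b'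
    \<or> snd \<beta> = b' \<and> fst \<beta> = a \<and> a' = - b \<or> snd \<beta> = a' \<and> fst \<beta> = a \<and> b = - b'" for \<beta>
  have adj: "adj \<alpha> \<gamma> \<longleftrightarrow> (\<exists>\<beta>\<in>D. C \<beta>)"
    unfolding ab ab' C_def using \<alpha> \<gamma> by (intro adj_iff) (simp_all only: ab ab')
  have tm: "coef ?M \<beta> = 0 \<longleftrightarrow> \<not> C \<beta>" if \<beta>: "\<beta> \<in> D" for \<beta>
  proof -
    obtain c d where cd: "\<beta> = (c, d)" by force
    have cdP: "(c, d) \<in> P" "\<bar>d\<bar> < c" using \<beta> D_sub by (auto simp: cd sroots_def)
    let ?c1 = "d = b \<and> c = a' \<and> a = - b'" and ?c2 = "d = a \<and> c = a' \<and> b = - b'"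
      and ?c3 = "d = b' \<and> c = a \<and> a' = - b" and ?c4 = "d = a' \<and> c = a \<and> b = - b'"
    have ex: "\<not> (?c1 \<and> ?c2)" "\<not> (?c1 \<and> ?c3)" "\<not> (?c1 \<and> ?c4)" "\<not> (?c2 \<and> ?c3)" "\<not> (?c2 \<and> ?c4)" "\<not> (?c3 \<and> ?c4)"
      using ord cdP(2) by (intro notI; elim conjE; linarith)+
    have "coef ?M \<beta> = (if ?c1 then 1 else 0) - (if ?c2 then 1 else 0) - (if ?c3 then 1 else 0) + (if ?c4 then 1 else 0)"
      unfolding ab ab' cd by (rule rook_term) (use \<alpha> \<gamma> cdP(1) ab ab' in simp_all)
    moreover have "C \<beta> \<longleftrightarrow> ?c1 \<or> ?c2 \<or> ?c3 \<or> ?c4" by (simp add: C_def cd)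
    ultimately show ?thesis
      using exclusive_signs_eq_0_iff[OF ex, where 'q = 'q] by (simp only:)
  qed
  have unique: "\<beta> = \<beta>'" if "\<beta> \<in> D" "\<beta>' \<in> D" "C \<beta>" "C \<beta>'" for \<beta> \<beta>'
  proof -
    have "\<bar>snd \<beta>\<bar> < fst \<beta>" "\<bar>snd \<beta>'\<bar> < fst \<beta>'" using that D_sub by (auto simp: sroots_def)
    hence ineqs: "snd \<beta> < fst \<beta>" "- snd \<beta> < fst \<beta>" "snd \<beta>' < fst \<beta>'" "- snd \<beta>' < fst \<beta>'"
      "b < a" "- b < a" "b' < a'" "- b' < a'"
      using ord by linarith+
    have "fst \<beta> = fst \<beta>' \<and> snd \<beta> = snd \<beta>'"
      using that(3,4) ineqs unfolding C_def by (elim disjE conjE; intro conjI; linarith)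
    thus ?thesis by (simp add: prod_eq_iff)
  qed
  have fin: "finite D" using D_sub finite_sroots finite_subset by blast
  show ?thesis
  proof (cases "\<exists>\<beta>\<in>D. C \<beta>")
    case True
    then obtain \<beta> where \<beta>: "\<beta> \<in> D" "C \<beta>" by auto
    have "(\<Sum>\<beta>\<in>D. \<xi> \<beta> * coef ?M \<beta>) = (\<Sum>\<beta>\<in>{\<beta>}. \<xi> \<beta> * coef ?M \<beta>)"
    proof (rule sum.mono_neutral_right[OF fin])
      show "\<forall>\<beta>'\<in>D - {\<beta>}. \<xi> \<beta>' * coef ?M \<beta>' = 0"
        using unique[OF \<beta>(1) _ \<beta>(2)] tm by (metis Diff_iff mult_zero_right singletonI)
    qed (use \<beta> in auto)
    also have "\<dots> \<noteq> 0" using \<xi>[OF \<beta>(1)] tm[OF \<beta>(1)] \<beta>(2) by simp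
    finally show ?thesis using True adj by simp
  next
    case False
    hence "(\<Sum>\<beta>\<in>D. \<xi> \<beta> * coef ?M \<beta>) = 0" using tm by (intro sum.neutral) auto
    thus ?thesis using False adj by simp
  qed
qed

text \<open>Resolves the definite description: reading off a coefficient is a form with the required
  values, and a form is determined by its values on root vectors.\<close>

lemma dual_basis_coef:
  fixes x :: "'q::field mat"
  assumes two: "(2::'q) \<noteq> 0" and \<beta>: "\<beta> \<in> pos_roots ty n" and x: "x \<in> skews m"
  shows "dual_basis ty n \<beta> x = coef x (enc n \<beta>)"
proof -
  note lu = lie_u_skews[OF two]
  have e: "enc n \<alpha> \<in> P" if "\<alpha> \<in> pos_roots ty n" for \<alpha> using that enc_sroots by blast
  have inj: "enc n \<alpha> = enc n \<beta> \<longleftrightarrow> \<alpha> = \<beta>" if "\<alpha> \<in> pos_roots ty n" for \<alpha>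
    using enc_bij[of n ty] that \<beta> by (auto simp: bij_betw_def dest: inj_onD)
  have idx: "posn (- snd \<gamma>) < m" "posn (fst \<gamma>) < m" if "\<gamma> \<in> P" for \<gamma>
    using P_idx[of "fst \<gamma>" "snd \<gamma>"] that posn_less by auto
  define f where "f = (\<lambda>x\<in>lie_u ty n. coef x (enc n \<beta>) :: 'q)"
  have f: "f \<in> lie_u_dual ty n"
  proof -
    have "coef (x + y) (enc n \<beta>) = coef x (enc n \<beta>) + coef y (enc n \<beta>)"
      "coef (c \<cdot>\<^sub>m x) (enc n \<beta>) = c * coef x (enc n \<beta>)"
      if "x \<in> skews m" "y \<in> skews m" for x y :: "'q mat" and c
      using skews_carrier[OF that(1)] skews_carrier[OF that(2)] idx[OF e[OF \<beta>]] by (auto simp: coef_def)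
    thus ?thesis by (simp add: lie_u_dual_def f_def lu skews_add skews_smult)
  qed
  have fd: "f (root_mat ty n \<alpha>) = (if \<alpha> = \<beta> then 1 else 0)" if \<alpha>: "\<alpha> \<in> pos_roots ty n" for \<alpha>
  proof -
    have "coef (rmat (enc n \<alpha>) :: 'q mat) (enc n \<beta>) = (if enc n \<beta> = enc n \<alpha> then 1 else 0)"
      unfolding rmat_comb[OF e[OF \<alpha>]] using e[OF \<beta>] by (rule coef_comb[OF subset_refl])
    moreover have "f (root_mat ty n \<alpha>) = coef (rmat (enc n \<alpha>)) (enc n \<beta>)"
      by (simp add: f_def lu root_mat_rmat[OF \<alpha>] rmat_skews[OF e[OF \<alpha>]])
    moreover have "enc n \<beta> = enc n \<alpha> \<longleftrightarrow> \<alpha> = \<beta>" 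
      by (rule trans[OF eq_commute inj[OF \<alpha>]])
    ultimately show ?thesis by (simp only:)
  qed
  have "dual_basis ty n \<beta> = f" unfolding dual_basis_def
  proof (rule the_equality)
    fix g :: "'q mat \<Rightarrow> 'q"
    assume g: "g \<in> lie_u_dual ty n \<and> (\<forall>\<alpha>\<in>pos_roots ty n. g (root_mat ty n \<alpha>) = (if \<alpha> = \<beta> then 1 else 0))"
    show "g = f"
    proof (rule extensionalityI[of _ "lie_u ty n"])
      fix x :: "'q mat" assume "x \<in> lie_u ty n"
      hence "x \<in> skews m" by (simp add: lu)
      hence x: "comb P (coef x) = x" by (rule comb_coef[OF two])
      have lin: "linform m g" "linform m f" using g f by (auto simp: linform_def lie_u_dual_def lu)
      have "g (rmat \<gamma>) = f (rmat \<gamma>)" if \<gamma>: "\<gamma> \<in> P" for \<gamma>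
      proof -
        have "\<gamma> \<in> enc n ` pos_roots ty n" using \<gamma> bij_betw_imp_surj_on[OF enc_bij[of n ty]] by simp
        then obtain \<alpha> where \<alpha>: "\<alpha> \<in> pos_roots ty n" "\<gamma> = enc n \<alpha>" by blast
        have "g (root_mat ty n \<alpha>) = f (root_mat ty n \<alpha>)" using g fd[OF \<alpha>(1)] \<alpha>(1) by simp
        thus ?thesis by (simp only: root_mat_rmat[OF \<alpha>(1)] \<alpha>(2))
      qed
      hence "g (comb P (coef x)) = f (comb P (coef x))"
        unfolding linform_comb[OF lin(1) subset_refl] linform_comb[OF lin(2) subset_refl]
        by (intro sum.cong) auto
      thus "g x = f x" by (simp only: x)
    qed (use g in \<open>auto simp: lie_u_dual_def f_def\<close>)
  qed (use f fd in auto)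
  thus ?thesis using x by (simp add: f_def lu)
qed

lemma inv_isoms:
  fixes g :: "'q::field mat"
  assumes g: "g \<in> isoms m"
  shows "inv\<^bsub>ring_mat TYPE('q) m ()\<^esub> g = astr m g"
proof -
  interpret ring "ring_mat TYPE('q) m ()" by (rule ring_mat)
  show ?thesis
    using inv_unique'[of g "astr m g"] isoms_carrier[OF g] isoms_astr[OF g] isoms_right_inverse[OF g]
    by (simp add: ring_mat_simps)
qed

text \<open>The orbit size times the size of the radical and q ^ k times that size are both q to the
  number of positive roots, so the radical cancels. \<open>\<zeta>\<close> is \<open>\<xi>\<close>
  carried over to pairs of labels.\<close>

lemma card_rook_orbit:
  fixes \<xi> :: "pos_root \<Rightarrow> 'q::{field,finite}"
  assumes char: "CHAR('q) \<ge> m" and orp: "orthogonal_rook_placement ty n (set \<beta>s)" and dist: "distinct \<beta>s"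
    and \<xi>: "\<And>\<beta>. \<beta> \<in> set \<beta>s \<Longrightarrow> \<xi> \<beta> \<noteq> 0"
  shows "\<exists>k. card (rook_orbit ty n (set \<beta>s) \<xi>) = CARD('q) ^ k
    \<and> k + card (set \<beta>s) + 2 * d_stat ty (set \<beta>s) = ninv (ty = TypeB) n (wperm (map (enc n) \<beta>s))"
proof -
  define D where "D = set \<beta>s"
  have two: "(2::'q) \<noteq> 0" using two_neq_0[where 'q = 'q] char m_ge_3 by simp
  note lu = lie_u_skews[OF two]
  have Dp: "D \<subseteq> pos_roots ty n" using orp by (simp add: orthogonal_rook_placement_def D_def)
  have inj: "inj_on (enc n) D" using enc_bij[of n ty] Dp by (meson bij_betw_def inj_on_subset)
  have rook: "rook_involution (ty = TypeB) (int n) (enc n ` D) (wperm (map (enc n) \<beta>s))"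
    unfolding D_def by (rule rook_involution_wperm[OF n1 orp dist])
  interpret rook_involution "ty = TypeB" "int n" "enc n ` D" "wperm (map (enc n) \<beta>s)" by (rule rook)
  define \<zeta> where "\<zeta> = \<xi> \<circ> inv_into D (enc n)"
  have \<zeta>: "\<zeta> (enc n \<beta>) = \<xi> \<beta>" if "\<beta> \<in> D" for \<beta> using inj that by (simp add: \<zeta>_def)
  define f where "f = rook_form ty n D \<xi>"
  have fval: "f x = (\<Sum>\<beta>\<in>enc n ` D. \<zeta> \<beta> * coef x \<beta>)" if x: "x \<in> skews m" for x
  proof -
    have "f x = (\<Sum>\<beta>\<in>D. \<xi> \<beta> * dual_basis ty n \<beta> x)" using x by (simp add: f_def rook_form_def lu)
    also have "\<dots> = (\<Sum>\<beta>\<in>D. \<zeta> (enc n \<beta>) * coef x (enc n \<beta>))"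
      using Dp by (intro sum.cong refl) (simp add: \<zeta> dual_basis_coef[OF two _ x] subset_iff)
    also have "\<dots> = (\<Sum>\<beta>\<in>enc n ` D. \<zeta> \<beta> * coef x \<beta>)" by (simp add: sum.reindex[OF inj])
    finally show ?thesis .
  qed
  have idx: "posn (- snd \<gamma>) < m" "posn (fst \<gamma>) < m" if "\<gamma> \<in> enc n ` D" for \<gamma>
    using P_idx[of "fst \<gamma>" "snd \<gamma>"] that D_sub posn_less by auto
  have lin: "linform m f"
  proof -
    have "coef (x + y) \<beta> = coef x \<beta> + coef y \<beta>" "coef (c \<cdot>\<^sub>m x) \<beta> = c * coef x \<beta>"
      if "x \<in> skews m" "y \<in> skews m" "\<beta> \<in> enc n ` D" for x y :: "'q mat" and c \<beta>
      using skews_carrier[OF that(1)] skews_carrier[OF that(2)] idx[OF that(3)] by (auto simp: coef_def)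
    thus ?thesis
      by (simp add: linform_def fval skews_add skews_smult distrib_left sum.distrib sum_distrib_left mult.left_commute)
  qed
  have orbit: "rook_orbit ty n D \<xi> = (\<lambda>g. \<lambda>y\<in>skews m. f (astr m g * y * g)) ` isoms m"
  proof -
    have "group_U ty n = (isoms m :: 'q mat set)"
      unfolding group_U_def lu m_def[symmetric] by (rule mat_exp_image[OF char two])
    moreover have "coadj ty n g f = (\<lambda>y\<in>skews m. f (astr m g * y * g))" if "g \<in> isoms m" for g
      using inv_isoms[OF that] by (simp add: coadj_def lu m_def)
    ultimately show ?thesis unfolding rook_orbit_def coadj_orbit_def f_def[symmetric] by simp
  qed
  have 1: "card (rook_orbit ty n D \<xi>) * card (rad m f) = CARD('q) ^ card P"
    unfolding orbit using card_orbit_rad[OF two lin] card_skews[OF two] by simp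
  let ?B = "\<lambda>\<alpha> \<gamma>. f (rmat \<alpha> * rmat \<gamma> - rmat \<gamma> * rmat \<alpha>)"
  have B: "?B \<alpha> \<gamma> \<noteq> 0 \<longleftrightarrow> adj \<alpha> \<gamma>" if "\<alpha> \<in> P" "\<gamma> \<in> P" for \<alpha> \<gamma>
    unfolding fval[OF skews_commutator[OF rmat_skews[OF that(1)] rmat_skews[OF that(2)]]]
    by (rule rook_commutator_adj[OF rook _ that]) (use \<zeta> \<xi> in \<open>auto simp: D_def\<close>)
  obtain k where k: "card (coeff_kernel P ?B) * CARD('q) ^ k = CARD('q) ^ card P"
    "k + card (enc n ` D) + 2 * card {\<beta> \<in> enc n ` D. 0 < snd \<beta> \<and> (\<exists>a. (a, 0) \<in> enc n ` D \<and> fst \<beta> < a)}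
      = card inversions"
    using card_kernel[of ?B] B by blast
  have "card (rook_orbit ty n D \<xi>) = CARD('q) ^ k"
  proof -
    have "card (rad m f) > 0" using 1 by (metis mult_0_right neq0_conv power_eq_0_iff zero_less_card_finite less_irrefl)
    moreover have "card (rook_orbit ty n D \<xi>) * card (rad m f) = CARD('q) ^ k * card (rad m f)"
      using 1 k(1) card_rad[OF two lin] by (simp add: mult.commute)
    ultimately show ?thesis by simp
  qed
  moreover have "card inversions = ninv (ty = TypeB) n (wperm (map (enc n) \<beta>s))"
    by (simp add: inversions_def ninv_def)
  moreover have "d_stat ty D = card {\<beta> \<in> enc n ` D. 0 < snd \<beta> \<and> (\<exists>a. (a, 0) \<in> enc n ` D \<and> fst \<beta> < a)}"
    using d_stat_enc[OF orp n1] by (simp add: D_def)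
  ultimately show ?thesis using k(2) card_image[OF inj] by (auto simp: D_def)
qed

end

theorem theorem5p5:
  fixes ty :: root_type and n :: nat
    and D :: "pos_root set" and \<beta>s :: "pos_root list"
    and \<sigma> :: "real vec \<Rightarrow> real vec"
    and \<xi> :: "pos_root \<Rightarrow> 'q::{field,finite}"
  assumes "n \<ge> 1" and "ty = TypeD \<Longrightarrow> n \<ge> 2"
    and "CHAR('q) \<ge> mdim ty n"
    and "orthogonal_rook_placement ty n D"
    and "D = set \<beta>s" and "distinct \<beta>s"
    and "\<sigma> = word_prod n (map (\<lambda>\<beta>. reflection n (root_vec n \<beta>)) \<beta>s)"
    and "\<And>\<beta>. \<beta> \<in> D \<Longrightarrow> \<xi> \<beta> \<noteq> 0"
  shows "orbit_dim (rook_orbit ty n D \<xi>)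
           = real (l_stat ty n \<sigma>) - real (s_stat ty n \<sigma>) - 2 * real (d_stat ty D)
         \<and> (\<forall>\<xi>' :: pos_root \<Rightarrow> 'q. (\<forall>\<beta>\<in>D. \<xi>' \<beta> \<noteq> 0) \<longrightarrow>
              orbit_dim (rook_orbit ty n D \<xi>') = orbit_dim (rook_orbit ty n D \<xi>))"
proof -
  interpret root_matrices ty n "mdim ty n"
    by unfold_locales (fact assms(1), fact assms(2), rule refl)
  have orp: "orthogonal_rook_placement ty n (set \<beta>s)" using assms(4,5) by simp
  have sub: "set \<beta>s \<subseteq> pos_roots ty n" using orp by (simp add: orthogonal_rook_placement_def)
  have l: "l_stat ty n \<sigma> = ninv (ty = TypeB) n (wperm (map (enc n) \<beta>s))"
    unfolding assms(7) by (rule l_stat_eq_ninv[OF assms(1,2) sub])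
  have s: "s_stat ty n \<sigma> = card (set \<beta>s)"
    unfolding assms(7) by (rule s_stat_eq_card[OF assms(1) orp assms(6)])
  \<comment> \<open>With base greater than 1 the logarithm of q ^ k is k.\<close>
  have q: "real CARD('q) > 1"
  proof -
    have "card {0, 1 :: 'q} \<le> CARD('q)" by (rule card_mono) auto
    thus ?thesis by simp
  qed
  have dim: "orbit_dim (rook_orbit ty n D \<xi>')
      = real (l_stat ty n \<sigma>) - real (s_stat ty n \<sigma>) - 2 * real (d_stat ty D)"
    if nz: "\<forall>\<beta>\<in>D. \<xi>' \<beta> \<noteq> 0" for \<xi>' :: "pos_root \<Rightarrow> 'q"
  proof -
    obtain k where k: "card (rook_orbit ty n (set \<beta>s) \<xi>') = CARD('q) ^ k"
      "k + card (set \<beta>s) + 2 * d_stat ty (set \<beta>s) = ninv (ty = TypeB) n (wperm (map (enc n) \<beta>s))"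
      using card_rook_orbit[OF assms(3) orp assms(6), of \<xi>'] nz assms(5) by auto
    have "orbit_dim (rook_orbit ty n D \<xi>') = real k"
      using q by (simp add: orbit_dim_def assms(5) k(1) log_nat_power)
    moreover have "real k + real (card (set \<beta>s)) + 2 * real (d_stat ty D) = real (l_stat ty n \<sigma>)"
      unfolding l assms(5) k(2)[symmetric] by simp
    ultimately show ?thesis using s by simp
  qed
  show ?thesis using dim assms(8) by simp
qed

end
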